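(* Let $V$ and $Z$ be irreducible highest weight modules over the quantum group $U_q(\mathfrak{g})$ ($q$ not a root of unity). Then the $U_q(\mathfrak{g})$-module $V\otimes Z$ is completely reducible if and only if the restriction of the canonical contravariant form on $V\otimes Z$ to the subspace $(V\otimes Z)^+$ spanned by the singular vectors of $V\otimes Z$ is non-degenerate.
   Context: Quantum group. $\mathfrak{g}$ is a complex semi-simple Lie algebra with Cartan subalgebra $\mathfrak{h}$, triangular decomposition $\mathfrak{g}=\mathfrak{g}_-\oplus\mathfrak{h}\oplus\mathfrak{g}_+$, and set $\Pi^+$ of simple positive roots; $(\cdot,\cdot)$ is an inner product on $\mathfrak{h}^*$ coming from a multiple of the Killing form. $q\in\mathbb{C}$, $q\neq 0$, is not a root of unity (powers $q^{(\alpha,\lambda)}$ are taken with a fixed branch of $\log q$). $U_q(\mathfrak{g})$ is the unital complex algebra generated by $e_\alpha,f_\alpha,q^{\pm h_\alpha}$, $\alpha\in\Pi^+$, where the $q^{\pm h_\alpha}$ commute, $q^{h_\alpha}q^{-h_\alpha}=1$, with relations $q^{\pm h_\alpha}e_\beta=q^{\pm(\alpha,\beta)}e_\beta q^{\pm h_\alpha}$, $q^{\pm h_\alpha}f_\beta=q^{\mp(\alpha,\beta)}f_\beta q^{\pm h_\alpha}$, $[e_\alpha,f_\beta]=\delta_{\alpha,\beta}\frac{q^{h_\alpha}-q^{-h_\alpha}}{q-q^{-1}}$, and the quantum Serre relations (with parameters $q_\alpha=q^{(\alpha,\alpha)/2}$) among the $e_\alpha$ and among the $f_\alpha$. It is a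 Hopf algebra with $\Delta(f_\alpha)=f_\alpha\otimes 1+q^{-h_\alpha}\otimes f_\alpha$, $\Delta(q^{\pm h_\alpha})=q^{\pm h_\alpha}\otimes q^{\pm h_\alpha}$, $\Delta(e_\alpha)=e_\alpha\otimes q^{h_\alpha}+1\otimes e_\alpha$, antipode $\gamma(f_\alpha)=-q^{h_\alpha}f_\alpha$, $\gamma(q^{\pm h_\alpha})=q^{\mp h_\alpha}$, $\gamma(e_\alpha)=-e_\alpha q^{-h_\alpha}$. Let $\sigma$ be the involutive algebra automorphism $e_\alpha\mapsto f_\alpha$, $f_\alpha\mapsto e_\alpha$, $q^{h_\alpha}\mapsto q^{-h_\alpha}$, and $\omega=\gamma^{-1}\circ\sigma$, an involutive algebra anti-automorphism. Modules. A vector $v$ has weight $\mu\in\mathfrak{h}^*$ if $q^{h_\alpha}v=q^{(\alpha,\mu)}v$ for all $\alpha\in\Pi^+$. A highest weight module is one generated by a weight vector (highest vector) killed by all $e_\alpha$. $V\otimes Z$ is a $U_q(\mathfrak{g})$-module via $\Delta$. A singular vector is a non-zero weight vector killed by all $e_\alpha$, $\alpha\in\Pi^+$. Forms. A symmetric bilinear form $\langle\cdot,\cdot\rangle$ on a module is contravariant if $\langle xv,w\rangle=\langle v,\omega(x)w\rangle$ for all $x\in U_q(\mathfrak{g})$. Each highest weight module carries a contravariant form, unique up to scalar, called the Shapovalov form (normalized to equal $1$ on the highest vector paired with itself); it is non-degenerate iff the module is irreducible. The canonical contravariant form on $V\otimes Z$ is the product of the Shapovalov forms: $\langle v\otimes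 z,v'\otimes z'\rangle=\langle v,v'\rangle\langle z,z'\rangle$. *)

theory Defs
  imports Complex_Main "HOL-Library.Poly_Mapping" "HOL-Algebra.QuotRing"
begin

section \<open>Complex vector spaces and their tensor product\<close>

class complex_vector = ab_group_add +
  fixes scaleC :: "complex \<Rightarrow> 'a \<Rightarrow> 'a"  (infixr "*\<^sub>C" 75)
  assumes scaleC_add_right: "a *\<^sub>C (x + y) = a *\<^sub>C x + a *\<^sub>C y"
    and scaleC_add_left: "(a + b) *\<^sub>C x = a *\<^sub>C x + b *\<^sub>C x"
    and scaleC_scaleC: "a *\<^sub>C b *\<^sub>C x = (a * b) *\<^sub>C x"
    and scaleC_one: "1 *\<^sub>C x = x"

global_interpretation cvec: vector_space "scaleC :: complex \<Rightarrow> 'a \<Rightarrow> 'a::complex_vector"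
  by unfold_locales (simp_all add: scaleC_add_right scaleC_add_left scaleC_scaleC scaleC_one)

abbreviation clinear :: "('a::complex_vector \<Rightarrow> 'b::complex_vector) \<Rightarrow> bool"
  where "clinear \<equiv> Vector_Spaces.linear scaleC scaleC"

instantiation complex :: complex_vector
begin
definition scaleC_complex :: "complex \<Rightarrow> complex \<Rightarrow> complex"
  where "scaleC_complex = (*)"
instance
  by standard (simp_all add: scaleC_complex_def algebra_simps)
end

instantiation poly_mapping :: (type, complex_vector) complex_vector
begin
definition scaleC_poly_mapping :: "complex \<Rightarrow> ('a \<Rightarrow>\<^sub>0 'b) \<Rightarrow> 'a \<Rightarrow>\<^sub>0 'b"
  where "scaleC_poly_mapping c p = Poly_Mapping.map (scaleC c) p"

lemma lookup_scaleC: "Poly_Mapping.lookup (c *\<^sub>C p) x = c *\<^sub>C Poly_Mapping.lookup p x" for p :: "'a \<Rightarrow>\<^sub>0 'b"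
  by (simp add: scaleC_poly_mapping_def Poly_Mapping.map.rep_eq when_def cvec.scale_zero_right)

instance
  by standard (rule poly_mapping_eqI,
      simp add: lookup_scaleC lookup_add scaleC_add_right scaleC_add_left scaleC_scaleC scaleC_one)+
end

definition tensor_relations :: "('v::complex_vector \<times> 'z::complex_vector \<Rightarrow>\<^sub>0 complex) set"
  where "tensor_relations =
     {Poly_Mapping.single (v + v', z) 1 - Poly_Mapping.single (v, z) 1
        - Poly_Mapping.single (v', z) 1 | v v' z. True}
   \<union> {Poly_Mapping.single (v, z + z') 1 - Poly_Mapping.single (v, z) 1
        - Poly_Mapping.single (v, z') 1 | v z z'. True}
   \<union> {Poly_Mapping.single (c *\<^sub>C v, z) 1 - c *\<^sub>C Poly_Mapping.single (v, z) 1 | c v z. True}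
   \<union> {Poly_Mapping.single (v, c *\<^sub>C z) 1 - c *\<^sub>C Poly_Mapping.single (v, z) 1 | c v z. True}"

definition tensor_eq ::
  "('v::complex_vector \<times> 'z::complex_vector \<Rightarrow>\<^sub>0 complex) \<Rightarrow> ('v \<times> 'z \<Rightarrow>\<^sub>0 complex) \<Rightarrow> bool"
  where "tensor_eq p r \<longleftrightarrow> p - r \<in> cvec.span tensor_relations"

quotient_type (overloaded) ('v, 'z) tensor =
  "('v::complex_vector \<times> 'z::complex_vector) \<Rightarrow>\<^sub>0 complex" / tensor_eq
proof (rule equivpI)
  show "reflp tensor_eq"
    by (simp add: reflp_def tensor_eq_def cvec.span_zero)
  show "symp tensor_eq"
    unfolding symp_def tensor_eq_def using cvec.span_neg by fastforce
  show "transp tensor_eq"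
    unfolding transp_def tensor_eq_def using cvec.span_add by fastforce
qed

instantiation tensor :: (complex_vector, complex_vector) complex_vector
begin

lift_definition zero_tensor :: "('a, 'b) tensor" is 0 .

lift_definition plus_tensor :: "('a, 'b) tensor \<Rightarrow> ('a, 'b) tensor \<Rightarrow> ('a, 'b) tensor" is "(+)"
  unfolding tensor_eq_def using cvec.span_add by (fastforce simp: algebra_simps)

lift_definition uminus_tensor :: "('a, 'b) tensor \<Rightarrow> ('a, 'b) tensor" is uminus
  unfolding tensor_eq_def using cvec.span_neg by (fastforce simp: algebra_simps)

lift_definition minus_tensor :: "('a, 'b) tensor \<Rightarrow> ('a, 'b) tensor \<Rightarrow> ('a, 'b) tensor" is "(-)"
  unfolding tensor_eq_def using cvec.span_diff by (fastforce simp: algebra_simps)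

lift_definition scaleC_tensor :: "complex \<Rightarrow> ('a, 'b) tensor \<Rightarrow> ('a, 'b) tensor" is scaleC
  unfolding tensor_eq_def
  by (metis cvec.scale_right_diff_distrib cvec.span_scale)

instance
  by standard
    (transfer, simp add: tensor_eq_def cvec.span_zero algebra_simps
      scaleC_add_right scaleC_add_left scaleC_scaleC scaleC_one)+

end

lift_definition tensor :: "'v::complex_vector \<Rightarrow> 'z::complex_vector \<Rightarrow> ('v, 'z) tensor"
  (infixr "\<otimes>\<^sub>t" 76) is "\<lambda>v z. Poly_Mapping.single (v, z) 1" .


definition bilinear_form :: "('v::complex_vector \<Rightarrow> 'v \<Rightarrow> complex) \<Rightarrow> bool"
  where "bilinear_form B \<longleftrightarrow> (\<forall>v. clinear (B v)) \<and> (\<forall>w. clinear (\<lambda>v. B v w))"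

definition symmetric_form :: "('v \<Rightarrow> 'v \<Rightarrow> complex) \<Rightarrow> bool"
  where "symmetric_form B \<longleftrightarrow> (\<forall>v w. B v w = B w v)"

definition nondegenerate_on :: "'v::zero set \<Rightarrow> ('v \<Rightarrow> 'v \<Rightarrow> complex) \<Rightarrow> bool"
  where "nondegenerate_on W B \<longleftrightarrow> (\<forall>w\<in>W. (\<forall>w'\<in>W. B w w' = 0) \<longrightarrow> w = 0)"

text \<open>
  The linear map on the tensor product induced by a bilinear map. It is computed on an arbitrary
  representative; for bilinear maps the choice does not matter (see \<open>tensor_form_tensor\<close> below).
\<close>

definition tensor_lift ::
  "('v::complex_vector \<Rightarrow> 'z::complex_vector \<Rightarrow> complex) \<Rightarrow> ('v, 'z) tensor \<Rightarrow> complex"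
  where "tensor_lift f t =
    (\<Sum>(v, z) \<in> Poly_Mapping.keys (rep_tensor t). Poly_Mapping.lookup (rep_tensor t) (v, z) * f v z)"

definition tensor_form ::
  "('v::complex_vector \<Rightarrow> 'v \<Rightarrow> complex) \<Rightarrow> ('z::complex_vector \<Rightarrow> 'z \<Rightarrow> complex)
     \<Rightarrow> ('v, 'z) tensor \<Rightarrow> ('v, 'z) tensor \<Rightarrow> complex"
  where "tensor_form BV BZ s t =
    tensor_lift (\<lambda>v z. tensor_lift (\<lambda>v' z'. BV v v' * BZ z z') t) s"


lemma clinear_functional_iff:
  "clinear f \<longleftrightarrow> (\<forall>x y. f (x + y) = f x + f y) \<and> (\<forall>c x. f (c *\<^sub>C x) = c * f x)"
  for f :: "'a::complex_vector \<Rightarrow> complex"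
  using cvec.module_axioms[where 'a = complex] cvec.module_axioms[where 'a = 'a]
  by (auto simp: linear_iff_module_hom module_hom_iff scaleC_complex_def)

lemma tensor_lift_linear:
  assumes "\<And>v. clinear (f v)" and "\<And>z. clinear (\<lambda>v. f v z)"
  shows "clinear (tensor_lift f)" and "tensor_lift f (v \<otimes>\<^sub>t z) = f v z"
proof -
  define L where "L p = (\<Sum>x\<in>Poly_Mapping.keys p. Poly_Mapping.lookup p x * (case x of (v, z) \<Rightarrow> f v z))" for p
  have L_eq: "L p = (\<Sum>x\<in>A. Poly_Mapping.lookup p x * (case x of (v, z) \<Rightarrow> f v z))"
    if "finite A" "Poly_Mapping.keys p \<subseteq> A" for p A
    unfolding L_def using that by (intro sum.mono_neutral_left) (auto simp: in_keys_iff)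
  have L_add: "L (p + r) = L p + L r" for p r
  proof -
    let ?A = "Poly_Mapping.keys p \<union> Poly_Mapping.keys r"
    have "Poly_Mapping.keys (p + r) \<subseteq> ?A" by (rule Poly_Mapping.keys_add)
    then show ?thesis
      by (simp add: L_eq[of ?A] lookup_add sum.distrib algebra_simps)
  qed
  have L_scale: "L (c *\<^sub>C p) = c * L p" for c p
  proof -
    have "Poly_Mapping.keys (c *\<^sub>C p) \<subseteq> Poly_Mapping.keys p"
      by (auto simp: in_keys_iff lookup_scaleC scaleC_complex_def)
    then show ?thesis
      by (simp add: L_eq[of "Poly_Mapping.keys p"] lookup_scaleC scaleC_complex_def
          sum_distrib_left mult.assoc)
  qed
  have L_linear: "clinear L"
    by (simp add: clinear_functional_iff L_add L_scale)
  interpret L: Vector_Spaces.linear scaleC scaleC L by (rule L_linear)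
  have L_single: "L (Poly_Mapping.single (v, z) 1) = f v z" for v z
    by (simp add: L_eq[of "{(v, z)}"])
  have f1: "f (v + v') z = f v z + f v' z" "f (c *\<^sub>C v) z = c * f v z"
    and f2: "f v (z + z') = f v z + f v z'" "f v (c *\<^sub>C z) = c * f v z" for v v' z z' c
    using assms by (auto simp: clinear_functional_iff)
  have "L p = 0" if "p \<in> cvec.span tensor_relations" for p
    using that
  proof (induction rule: cvec.span_induct_alt)
    case base
    show ?case by (simp add: L_def)
  next
    case (step c x y)
    have "L x = 0"
      using step(1) by (auto simp: tensor_relations_def L.diff L_single L_scale f1 f2)
    then show ?case by (simp add: L_add L_scale step(2))
  qed
  then have L_cong: "L p = L r" if "tensor_eq p r" for p r
    using that unfolding tensor_eq_def by (metis L.diff eq_iff_diff_eq_0)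
  have lift_abs: "tensor_lift f (abs_tensor p) = L p" for p
  proof -
    have "tensor_lift f t = L (rep_tensor t)" for t
      unfolding tensor_lift_def L_def by (simp add: case_prod_unfold)
    moreover have "tensor_eq (rep_tensor (abs_tensor p)) p"
      by (rule Quotient3_rep_abs[OF Quotient3_tensor])
        (simp add: tensor_eq_def cvec.span_zero)
    ultimately show ?thesis using L_cong by metis
  qed
  show "tensor_lift f (v \<otimes>\<^sub>t z) = f v z"
    by (simp add: tensor.abs_eq lift_abs L_single)
  have "tensor_lift f (s + t) = tensor_lift f s + tensor_lift f t" for s t
    by (induct s; induct t) (simp add: plus_tensor.abs_eq lift_abs L_add)
  moreover have "tensor_lift f (c *\<^sub>C t) = c * tensor_lift f t" for c t
    by (induct t) (simp add: scaleC_tensor.abs_eq lift_abs L_scale)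
  ultimately show "clinear (tensor_lift f)"
    by (simp add: clinear_functional_iff)
qed

lemma tensor_form_tensor:
  assumes "bilinear_form BV" and "bilinear_form BZ"
  shows "tensor_form BV BZ (v \<otimes>\<^sub>t z) (v' \<otimes>\<^sub>t z') = BV v v' * BZ z z'"
    and "bilinear_form (tensor_form BV BZ)"
proof -
  have V: "clinear (BV v)" "clinear (\<lambda>v. BV v w)"
    and Z: "clinear (BZ z)" "clinear (\<lambda>z. BZ z y)" for v w z y
    using assms by (auto simp: bilinear_form_def)
  have times: "clinear (\<lambda>x. f x * c)" "clinear (\<lambda>x. c * f x)"
    if "clinear f" for f :: "'c::complex_vector \<Rightarrow> complex" and c
    using that by (auto simp: clinear_functional_iff algebra_simps)
  have inner: "clinear (tensor_lift (\<lambda>v' z'. BV v v' * BZ z z'))"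
    "tensor_lift (\<lambda>v' z'. BV v v' * BZ z z') (v' \<otimes>\<^sub>t z') = BV v v' * BZ z z'" for v z v' z'
    by (intro tensor_lift_linear times V Z)+
  have lift_add: "tensor_lift (\<lambda>v z. f v z + g v z) t = tensor_lift f t + tensor_lift g t"
    and lift_mult: "tensor_lift (\<lambda>v z. c * f v z) t = c * tensor_lift f t"
    for f g :: "'x::complex_vector \<Rightarrow> 'y::complex_vector \<Rightarrow> complex" and t c
    by (simp_all add: tensor_lift_def case_prod_unfold algebra_simps sum.distrib sum_distrib_left)
  have outer: "clinear (\<lambda>v. tensor_lift (\<lambda>v' z'. BV v v' * BZ z z') t)"
    "clinear (\<lambda>z. tensor_lift (\<lambda>v' z'. BV v v' * BZ z z') t)" for v z t
    using V Z by (simp_all add: clinear_functional_iff distrib_right distrib_left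
        mult.assoc mult.left_commute lift_add lift_mult)
  show "tensor_form BV BZ (v \<otimes>\<^sub>t z) (v' \<otimes>\<^sub>t z') = BV v v' * BZ z z'"
    unfolding tensor_form_def
    using tensor_lift_linear(2)[OF outer(2) outer(1)] inner(2) by metis
  have "clinear (\<lambda>s. tensor_form BV BZ s t)" for t
    unfolding tensor_form_def by (rule tensor_lift_linear(1)[OF outer(2) outer(1)])
  moreover have "clinear (tensor_form BV BZ s)" for s
    using inner(1) unfolding tensor_form_def clinear_functional_iff
    by (simp add: lift_add lift_mult)
  ultimately show "bilinear_form (tensor_form BV BZ)"
    unfolding bilinear_form_def by blast
qed


section \<open>Semisimple Lie algebras, Cartan subalgebras, simple roots\<close>

definition lie_bracket :: "('g::complex_vector \<Rightarrow> 'g \<Rightarrow> 'g) \<Rightarrow> bool"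
  where "lie_bracket br \<longleftrightarrow>
     (\<forall>x. clinear (br x)) \<and> (\<forall>y. clinear (\<lambda>x. br x y)) \<and> (\<forall>x. br x x = 0) \<and>
     (\<forall>x y z. br x (br y z) + br y (br z x) + br z (br x y) = 0)"

definition finite_dimensional :: "'g::complex_vector itself \<Rightarrow> bool"
  where "finite_dimensional TYPE('g) \<longleftrightarrow> (\<exists>B :: 'g set. finite B \<and> cvec.span B = UNIV)"

definition bracket_span :: "('g::complex_vector \<Rightarrow> 'g \<Rightarrow> 'g) \<Rightarrow> 'g set \<Rightarrow> 'g set \<Rightarrow> 'g set"
  where "bracket_span br A B = cvec.span {br x y | x y. x \<in> A \<and> y \<in> B}"

definition lie_subalgebra :: "('g::complex_vector \<Rightarrow> 'g \<Rightarrow> 'g) \<Rightarrow> 'g set \<Rightarrow> bool"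
  where "lie_subalgebra br L \<longleftrightarrow> cvec.subspace L \<and> (\<forall>x\<in>L. \<forall>y\<in>L. br x y \<in> L)"

definition lie_ideal :: "('g::complex_vector \<Rightarrow> 'g \<Rightarrow> 'g) \<Rightarrow> 'g set \<Rightarrow> bool"
  where "lie_ideal br I \<longleftrightarrow> cvec.subspace I \<and> (\<forall>x. \<forall>y\<in>I. br x y \<in> I)"

definition solvable :: "('g::complex_vector \<Rightarrow> 'g \<Rightarrow> 'g) \<Rightarrow> 'g set \<Rightarrow> bool"
  where "solvable br L \<longleftrightarrow> (\<exists>n. ((\<lambda>A. bracket_span br A A) ^^ n) L = {0})"

definition nilpotent :: "('g::complex_vector \<Rightarrow> 'g \<Rightarrow> 'g) \<Rightarrow> 'g set \<Rightarrow> bool"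
  where "nilpotent br L \<longleftrightarrow> (\<exists>n. (bracket_span br L ^^ n) L = {0})"

definition semisimple_lie_algebra :: "('g::complex_vector \<Rightarrow> 'g \<Rightarrow> 'g) \<Rightarrow> bool"
  where "semisimple_lie_algebra br \<longleftrightarrow>
     lie_bracket br \<and> finite_dimensional TYPE('g) \<and>
     (\<forall>I. lie_ideal br I \<and> solvable br I \<longrightarrow> I = {0})"

definition cartan_subalgebra :: "('g::complex_vector \<Rightarrow> 'g \<Rightarrow> 'g) \<Rightarrow> 'g set \<Rightarrow> bool"
  where "cartan_subalgebra br H \<longleftrightarrow>
     lie_subalgebra br H \<and> nilpotent br H \<and> {x. \<forall>h\<in>H. br x h \<in> H} = H"

text \<open>
  Linear functionals on a subspace \<open>H\<close> are represented by functions vanishing outside \<open>H\<close>, so that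
  equality of functionals is equality of functions.
\<close>

definition dual_space :: "'g::complex_vector set \<Rightarrow> ('g \<Rightarrow> complex) set"
  where "dual_space H = {\<mu>. (\<forall>x\<in>H. \<forall>y\<in>H. \<mu> (x + y) = \<mu> x + \<mu> y) \<and>
     (\<forall>c. \<forall>x\<in>H. \<mu> (c *\<^sub>C x) = c * \<mu> x) \<and> (\<forall>x. x \<notin> H \<longrightarrow> \<mu> x = 0)}"

definition root_space :: "('g::complex_vector \<Rightarrow> 'g \<Rightarrow> 'g) \<Rightarrow> 'g set \<Rightarrow> ('g \<Rightarrow> complex) \<Rightarrow> 'g set"
  where "root_space br H \<alpha> = {x. \<forall>h\<in>H. br h x = \<alpha> h *\<^sub>C x}"

definition roots :: "('g::complex_vector \<Rightarrow> 'g \<Rightarrow> 'g) \<Rightarrow> 'g set \<Rightarrow> ('g \<Rightarrow> complex) set"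
  where "roots br H = {\<alpha> \<in> dual_space H. \<alpha> \<noteq> (\<lambda>_. 0) \<and> root_space br H \<alpha> \<noteq> {0}}"

text \<open>
  Choosing a triangular decomposition with the given Cartan subalgebra amounts to choosing a set
  \<open>P\<close> of simple positive roots, i.e. a base of the root system.
\<close>

definition simple_roots ::
  "('g::complex_vector \<Rightarrow> 'g \<Rightarrow> 'g) \<Rightarrow> 'g set \<Rightarrow> ('g \<Rightarrow> complex) set \<Rightarrow> bool"
  where "simple_roots br H P \<longleftrightarrow>
     finite P \<and> P \<subseteq> roots br H \<and>
     (\<forall>c :: ('g \<Rightarrow> complex) \<Rightarrow> complex.
        (\<forall>h. (\<Sum>\<alpha>\<in>P. c \<alpha> * \<alpha> h) = 0) \<longrightarrow> (\<forall>\<alpha>\<in>P. c \<alpha> = 0)) \<and>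
     (\<forall>\<beta>\<in>roots br H. \<exists>n :: ('g \<Rightarrow> complex) \<Rightarrow> nat.
        (\<forall>h. \<beta> h = (\<Sum>\<alpha>\<in>P. of_nat (n \<alpha>) * \<alpha> h)) \<or>
        (\<forall>h. \<beta> h = - (\<Sum>\<alpha>\<in>P. of_nat (n \<alpha>) * \<alpha> h)))"

definition linear_trace :: "('g::complex_vector \<Rightarrow> 'g) \<Rightarrow> complex"
  where "linear_trace f =
    (let B = (SOME B. cvec.independent B \<and> cvec.span B = UNIV)
     in \<Sum>b\<in>B. cvec.representation B (f b) b)"

definition killing_form :: "('g::complex_vector \<Rightarrow> 'g \<Rightarrow> 'g) \<Rightarrow> 'g \<Rightarrow> 'g \<Rightarrow> complex"
  where "killing_form br x y = linear_trace (br x \<circ> br y)"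

definition killing_functional ::
  "('g::complex_vector \<Rightarrow> 'g \<Rightarrow> 'g) \<Rightarrow> 'g set \<Rightarrow> 'g \<Rightarrow> ('g \<Rightarrow> complex)"
  where "killing_functional br H x = (\<lambda>h. if h \<in> H then killing_form br x h else 0)"

text \<open>
  The symmetric bilinear form on the dual of \<open>H\<close> transported from a positive multiple of the Killing
  form along the isomorphism \<open>killing_functional\<close>. Positivity of the factor makes it an inner product
  on the real span of the roots.
\<close>

definition killing_inner_product ::
  "('g::complex_vector \<Rightarrow> 'g \<Rightarrow> 'g) \<Rightarrow> 'g set
     \<Rightarrow> (('g \<Rightarrow> complex) \<Rightarrow> ('g \<Rightarrow> complex) \<Rightarrow> complex) \<Rightarrow> bool"
  where "killing_inner_product br H ip \<longleftrightarrow>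
     (\<forall>\<mu>\<in>dual_space H. \<forall>\<nu>\<in>dual_space H. ip \<mu> \<nu> = ip \<nu> \<mu>) \<and>
     (\<forall>\<mu>\<in>dual_space H. \<forall>\<mu>'\<in>dual_space H. \<forall>\<nu>\<in>dual_space H.
        ip (\<lambda>h. \<mu> h + \<mu>' h) \<nu> = ip \<mu> \<nu> + ip \<mu>' \<nu>) \<and>
     (\<forall>c. \<forall>\<mu>\<in>dual_space H. \<forall>\<nu>\<in>dual_space H. ip (\<lambda>h. c * \<mu> h) \<nu> = c * ip \<mu> \<nu>) \<and>
     (\<exists>c::real. c > 0 \<and> (\<forall>x\<in>H. \<forall>y\<in>H.
        ip (killing_functional br H x) (killing_functional br H y)
          = complex_of_real c * killing_form br x y))"


section \<open>The quantum group\<close>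

text \<open>
  Non-commutative polynomials are finitely supported functions on words. With concatenation as
  addition on words, \<^typ>\<open>'a list \<Rightarrow>\<^sub>0 complex\<close> carries the convolution product of
  \<^theory>\<open>HOL-Library.Poly_Mapping\<close>, i.e. it is the free algebra.
\<close>

instantiation list :: (type) monoid_add
begin
definition zero_list :: "'a list" where "zero_list = []"
definition plus_list :: "'a list \<Rightarrow> 'a list \<Rightarrow> 'a list" where "plus_list = (@)"
instance by standard (simp_all add: zero_list_def plus_list_def)
end

datatype 'r generator = E 'r | F 'r | K 'r | Kinv 'r

type_synonym 'r free_algebra = "'r generator list \<Rightarrow>\<^sub>0 complex"

abbreviation gen :: "'r generator \<Rightarrow> 'r free_algebra"
  where "gen x \<equiv> Poly_Mapping.single [x] 1"

abbreviation scal :: "complex \<Rightarrow> 'r free_algebra"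
  where "scal c \<equiv> Poly_Mapping.single [] c"

definition generators :: "'r set \<Rightarrow> 'r generator set"
  where "generators P = E ` P \<union> F ` P \<union> K ` P \<union> Kinv ` P"

definition free_ring :: "'r set \<Rightarrow> 'r free_algebra ring"
  where "free_ring P =
    \<lparr>carrier = {p. \<forall>w\<in>Poly_Mapping.keys p. set w \<subseteq> generators P}, mult = (*), one = 1, zero = 0, add = (+)\<rparr>"

definition free_hom :: "('r generator \<Rightarrow> 'r free_algebra) \<Rightarrow> 'r free_algebra \<Rightarrow> 'r free_algebra"
  where "free_hom f p = (\<Sum>w\<in>Poly_Mapping.keys p. Poly_Mapping.lookup p w *\<^sub>C prod_list (map f w))"

definition free_antihom :: "('r generator \<Rightarrow> 'r free_algebra) \<Rightarrow> 'r free_algebra \<Rightarrow> 'r free_algebra"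
  where "free_antihom f p = (\<Sum>w\<in>Poly_Mapping.keys p. Poly_Mapping.lookup p w *\<^sub>C prod_list (map f (rev w)))"

definition q_int :: "complex \<Rightarrow> nat \<Rightarrow> complex"
  where "q_int p n = (p ^ n - inverse p ^ n) / (p - inverse p)"

definition q_binomial :: "complex \<Rightarrow> nat \<Rightarrow> nat \<Rightarrow> complex"
  where "q_binomial p n k =
    (\<Prod>i=1..n. q_int p i) / ((\<Prod>i=1..k. q_int p i) * (\<Prod>i=1..n - k. q_int p i))"

definition serre_element :: "complex \<Rightarrow> nat \<Rightarrow> 'a::ring_1 \<Rightarrow> 'a \<Rightarrow> (complex \<Rightarrow> 'a) \<Rightarrow> 'a"
  where "serre_element p n x y \<iota> =
    (\<Sum>k\<le>n. \<iota> ((-1) ^ k * q_binomial p n k) * x ^ (n - k) * y * x ^ k)"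

text \<open>
  In the following \<open>P\<close> is the set of simple roots, \<open>ip\<close> the inner product, and \<open>lq\<close> the chosen
  logarithm of \<open>q\<close>.
\<close>

definition q_power :: "complex \<Rightarrow> complex \<Rightarrow> complex"
  where "q_power lq x = exp (x * lq)"

context
  fixes P :: "'r set" and ip :: "'r \<Rightarrow> 'r \<Rightarrow> complex" and lq :: complex
begin

definition torus_relations :: "'r free_algebra set"
  where "torus_relations =
     {gen x * gen y - gen y * gen x | x y. x \<in> K ` P \<union> Kinv ` P \<and> y \<in> K ` P \<union> Kinv ` P}
   \<union> {gen (K \<alpha>) * gen (Kinv \<alpha>) - 1 | \<alpha>. \<alpha> \<in> P}"

definition weight_relations :: "'r free_algebra set"
  where "weight_relations =
     {gen (K \<alpha>) * gen (E \<beta>) - scal (q_power lq (ip \<alpha> \<beta>)) * gen (E \<beta>) * gen (K \<alpha>)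
        | \<alpha> \<beta>. \<alpha> \<in> P \<and> \<beta> \<in> P}
   \<union> {gen (Kinv \<alpha>) * gen (E \<beta>) - scal (q_power lq (- ip \<alpha> \<beta>)) * gen (E \<beta>) * gen (Kinv \<alpha>)
        | \<alpha> \<beta>. \<alpha> \<in> P \<and> \<beta> \<in> P}
   \<union> {gen (K \<alpha>) * gen (F \<beta>) - scal (q_power lq (- ip \<alpha> \<beta>)) * gen (F \<beta>) * gen (K \<alpha>)
        | \<alpha> \<beta>. \<alpha> \<in> P \<and> \<beta> \<in> P}
   \<union> {gen (Kinv \<alpha>) * gen (F \<beta>) - scal (q_power lq (ip \<alpha> \<beta>)) * gen (F \<beta>) * gen (Kinv \<alpha>)
        | \<alpha> \<beta>. \<alpha> \<in> P \<and> \<beta> \<in> P}"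

definition commutator_relations :: "'r free_algebra set"
  where "commutator_relations =
     {gen (E \<alpha>) * gen (F \<beta>) - gen (F \<beta>) * gen (E \<alpha>)
        - (if \<alpha> = \<beta>
           then scal (1 / (q_power lq 1 - q_power lq (-1))) * (gen (K \<alpha>) - gen (Kinv \<alpha>))
           else 0)
        | \<alpha> \<beta>. \<alpha> \<in> P \<and> \<beta> \<in> P}"

text \<open>
  The exponent \<open>n\<close> is \<open>1 - 2 (\<alpha>, \<beta>) / (\<alpha>, \<alpha>)\<close>, i.e. one minus an entry of the Cartan matrix.
\<close>

definition serre_relations :: "'r free_algebra set"
  where "serre_relations =
     {serre_element (q_power lq (ip \<alpha> \<alpha> / 2)) n (gen (X \<alpha>)) (gen (X \<beta>)) scal
        | \<alpha> \<beta> n X. \<alpha> \<in> P \<and> \<beta> \<in> P \<and> \<alpha> \<noteq> \<beta> \<and> of_nat n = 1 - 2 * ip \<alpha> \<beta> / ip \<alpha> \<alpha> \<and> X \<in> {E, F}}"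

definition quantum_ideal :: "'r free_algebra set"
  where "quantum_ideal = genideal (free_ring P)
     (torus_relations \<union> weight_relations \<union> commutator_relations \<union> serre_relations)"

definition Uq :: "'r free_algebra set ring"
  where "Uq = free_ring P Quot quantum_ideal"

definition cls :: "'r free_algebra \<Rightarrow> 'r free_algebra set"
  where "cls p = quantum_ideal +>\<^bsub>free_ring P\<^esub> p"

text \<open>
  Each of the maps below is given on the free algebra by its values on generators and descends to
  the quotient; the union runs over classes that all coincide.
\<close>

definition antipode :: "'r free_algebra set \<Rightarrow> 'r free_algebra set"
  where "antipode X = (\<Union>p\<in>X. cls (free_antihom (\<lambda>g. case g of
       E \<alpha> \<Rightarrow> - gen (E \<alpha>) * gen (Kinv \<alpha>)
     | F \<alpha> \<Rightarrow> - gen (K \<alpha>) * gen (F \<alpha>)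
     | K \<alpha> \<Rightarrow> gen (Kinv \<alpha>)
     | Kinv \<alpha> \<Rightarrow> gen (K \<alpha>)) p))"

definition sigma :: "'r free_algebra set \<Rightarrow> 'r free_algebra set"
  where "sigma X = (\<Union>p\<in>X. cls (free_hom (\<lambda>g. case g of
       E \<alpha> \<Rightarrow> gen (F \<alpha>)
     | F \<alpha> \<Rightarrow> gen (E \<alpha>)
     | K \<alpha> \<Rightarrow> gen (Kinv \<alpha>)
     | Kinv \<alpha> \<Rightarrow> gen (K \<alpha>)) p))"

definition omega :: "'r free_algebra set \<Rightarrow> 'r free_algebra set"
  where "omega X = inv_into (carrier Uq) antipode (sigma X)"

text \<open>The coproduct of a generator, as a list of pairs \<open>(a, b)\<close> standing for the sum of \<open>a \<otimes> b\<close>.\<close>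

definition coproduct :: "'r generator \<Rightarrow> ('r free_algebra \<times> 'r free_algebra) list"
  where "coproduct g = (case g of
       E \<alpha> \<Rightarrow> [(gen (E \<alpha>), gen (K \<alpha>)), (1, gen (E \<alpha>))]
     | F \<alpha> \<Rightarrow> [(gen (F \<alpha>), 1), (gen (Kinv \<alpha>), gen (F \<alpha>))]
     | K \<alpha> \<Rightarrow> [(gen (K \<alpha>), gen (K \<alpha>))]
     | Kinv \<alpha> \<Rightarrow> [(gen (Kinv \<alpha>), gen (Kinv \<alpha>))])"


definition uq_module :: "('r free_algebra set \<Rightarrow> 'v::complex_vector \<Rightarrow> 'v) \<Rightarrow> bool"
  where "uq_module \<rho> \<longleftrightarrow>
     (\<forall>x\<in>carrier Uq. clinear (\<rho> x)) \<and>
     (\<forall>x\<in>carrier Uq. \<forall>y\<in>carrier Uq. \<forall>v. \<rho> (x \<oplus>\<^bsub>Uq\<^esub> y) v = \<rho> x v + \<rho> y v) \<and>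
     (\<forall>x\<in>carrier Uq. \<forall>y\<in>carrier Uq. \<forall>v. \<rho> (x \<otimes>\<^bsub>Uq\<^esub> y) v = \<rho> x (\<rho> y v)) \<and>
     (\<forall>c v. \<rho> (cls (scal c)) v = c *\<^sub>C v)"

definition submodule ::
  "('r free_algebra set \<Rightarrow> 'v::complex_vector \<Rightarrow> 'v) \<Rightarrow> 'v set \<Rightarrow> bool"
  where "submodule \<rho> N \<longleftrightarrow> cvec.subspace N \<and> (\<forall>x\<in>carrier Uq. \<forall>v\<in>N. \<rho> x v \<in> N)"

definition irreducible_submodule ::
  "('r free_algebra set \<Rightarrow> 'v::complex_vector \<Rightarrow> 'v) \<Rightarrow> 'v set \<Rightarrow> bool"
  where "irreducible_submodule \<rho> N \<longleftrightarrow>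
     submodule \<rho> N \<and> N \<noteq> {0} \<and> (\<forall>M. submodule \<rho> M \<and> M \<subseteq> N \<longrightarrow> M = {0} \<or> M = N)"

abbreviation irreducible_module :: "('r free_algebra set \<Rightarrow> 'v::complex_vector \<Rightarrow> 'v) \<Rightarrow> bool"
  where "irreducible_module \<rho> \<equiv> irreducible_submodule \<rho> UNIV"

definition completely_reducible ::
  "('r free_algebra set \<Rightarrow> 'v::complex_vector \<Rightarrow> 'v) \<Rightarrow> bool"
  where "completely_reducible \<rho> \<longleftrightarrow> (\<exists>\<S>.
     (\<forall>S\<in>\<S>. irreducible_submodule \<rho> S) \<and>
     cvec.span (\<Union>\<S>) = UNIV \<and>
     (\<forall>S\<in>\<S>. S \<inter> cvec.span (\<Union>(\<S> - {S})) = {0}))"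

text \<open>
  The module structure on the tensor product via the coproduct. As the coproduct is an algebra
  homomorphism, the generators determine the action of the whole algebra.
\<close>

definition tensor_action ::
  "('r free_algebra set \<Rightarrow> 'v::complex_vector \<Rightarrow> 'v)
    \<Rightarrow> ('r free_algebra set \<Rightarrow> 'z::complex_vector \<Rightarrow> 'z)
    \<Rightarrow> ('r free_algebra set \<Rightarrow> ('v, 'z) tensor \<Rightarrow> ('v, 'z) tensor) \<Rightarrow> bool"
  where "tensor_action \<rho>V \<rho>Z \<rho>T \<longleftrightarrow>
     uq_module \<rho>T \<and>
     (\<forall>g\<in>generators P. \<forall>v z. \<rho>T (cls (gen g)) (v \<otimes>\<^sub>t z) =
        (\<Sum>(a, b)\<leftarrow>coproduct g. \<rho>V (cls a) v \<otimes>\<^sub>t \<rho>Z (cls b) z))"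

definition contravariant ::
  "('r free_algebra set \<Rightarrow> 'v::complex_vector \<Rightarrow> 'v) \<Rightarrow> ('v \<Rightarrow> 'v \<Rightarrow> complex) \<Rightarrow> bool"
  where "contravariant \<rho> B \<longleftrightarrow> bilinear_form B \<and> symmetric_form B \<and>
     (\<forall>x\<in>carrier Uq. \<forall>v w. B (\<rho> x v) w = B v (\<rho> (omega x) w))"

end

context
  fixes H :: "'g::complex_vector set" and P :: "('g \<Rightarrow> complex) set"
    and ip :: "('g \<Rightarrow> complex) \<Rightarrow> ('g \<Rightarrow> complex) \<Rightarrow> complex" and lq :: complex
begin

definition weight_vector ::
  "(('g \<Rightarrow> complex) free_algebra set \<Rightarrow> 'v::complex_vector \<Rightarrow> 'v) \<Rightarrow> 'v \<Rightarrow> bool"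
  where "weight_vector \<rho> v \<longleftrightarrow> (\<exists>\<mu>\<in>dual_space H. \<forall>\<alpha>\<in>P.
     \<rho> (cls P ip lq (gen (K \<alpha>))) v = q_power lq (ip \<alpha> \<mu>) *\<^sub>C v)"

definition singular_vector ::
  "(('g \<Rightarrow> complex) free_algebra set \<Rightarrow> 'v::complex_vector \<Rightarrow> 'v) \<Rightarrow> 'v \<Rightarrow> bool"
  where "singular_vector \<rho> v \<longleftrightarrow>
     v \<noteq> 0 \<and> weight_vector \<rho> v \<and> (\<forall>\<alpha>\<in>P. \<rho> (cls P ip lq (gen (E \<alpha>))) v = 0)"

definition highest_vector ::
  "(('g \<Rightarrow> complex) free_algebra set \<Rightarrow> 'v::complex_vector \<Rightarrow> 'v) \<Rightarrow> 'v \<Rightarrow> bool"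
  where "highest_vector \<rho> v \<longleftrightarrow>
     singular_vector \<rho> v \<and> (\<lambda>x. \<rho> x v) ` carrier (Uq P ip lq) = UNIV"

definition shapovalov_form ::
  "(('g \<Rightarrow> complex) free_algebra set \<Rightarrow> 'v::complex_vector \<Rightarrow> 'v) \<Rightarrow> 'v
     \<Rightarrow> ('v \<Rightarrow> 'v \<Rightarrow> complex) \<Rightarrow> bool"
  where "shapovalov_form \<rho> v B \<longleftrightarrow> contravariant P ip lq \<rho> B \<and> B v v = 1"

end

end

theory Submission
  imports Defs "HOL-Library.Multiset"
begin

text \<open>
  Put \<open>M = V \<otimes> Z\<close>, let \<open>M\<^sup>+\<close> be the space of vectors killed by all \<open>e\<^sub>\<alpha>\<close> (called extremal below),
  and let \<open>F M\<close> be the span of the images of all \<open>f\<^sub>\<alpha>\<close>. Since the anti-involution sends \<open>e\<^sub>\<alpha>\<close> to \<open>- f\<^sub>\<alpha> q\<^sup>h\<close> and fixes the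
  torus, and since it is compatible with the coproduct, the product of the two Shapovalov forms is
  contravariant on \<open>M\<close>; it is non-degenerate because the factors are irreducible. Two facts carry the
  proof. First, \<open>M\<^sup>+\<close> is orthogonal to \<open>F M\<close> (\<open>extremal_orthogonal_F_image\<close>). Secondly, the submodule
  generated by a torus-stable subspace \<open>W\<close> of \<open>M\<^sup>+\<close> is obtained by applying the \<open>f\<^sub>\<alpha>\<close> only, so that it
  lies in \<open>W + F M\<close> (\<open>F_closure_invariant\<close>, \<open>F_closure_mod_F_image\<close>).

  If \<open>M\<close> is a sum of irreducible submodules \<open>S\<close>, then each \<open>S\<close> contains a non-zero vector of \<open>M\<^sup>+\<close>, hence is
  generated by \<open>S \<inter> M\<^sup>+\<close>; therefore \<open>M = M\<^sup>+ + F M\<close>. A vector of \<open>M\<^sup>+\<close> orthogonal to \<open>M\<^sup>+\<close> is then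
  orthogonal to all of \<open>M\<close> and vanishes (\<open>nondegenerate_if_semisimple\<close>).

  Conversely, let the form be non-degenerate on \<open>M\<^sup>+\<close>. Then \<open>M\<^sup>+ \<inter> F M = 0\<close>. It follows that a
  non-zero homogeneous vector \<open>u\<close> of \<open>M\<^sup>+\<close> generates an irreducible submodule: a non-zero submodule of it contains
  a non-zero vector of \<open>M\<^sup>+\<close>, which is congruent to a multiple of \<open>u\<close> modulo \<open>F M\<close> and so equal to it. In
  the same way the submodules generated by the members of a homogeneous basis of \<open>M\<^sup>+\<close> form a direct
  sum. This sum is \<open>M\<close>: otherwise its orthogonal complement, a non-zero submodule, would contain a
  non-zero vector of \<open>M\<^sup>+\<close> orthogonal to \<open>M\<^sup>+\<close> (\<open>F_closure_extremal\<close>, \<open>semisimple_if_nondegenerate\<close>).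

  The existence of vectors of \<open>M\<^sup>+\<close> in submodules and the passage to orthogonal complements use a
  grading of \<open>M\<close> by multisets of simple roots with finite-dimensional, mutually orthogonal components,
  which the \<open>f\<^sub>\<alpha>\<close> raise and the \<open>e\<^sub>\<alpha>\<close> lower. On \<open>V\<close> and \<open>Z\<close> it comes from the words in the \<open>f\<^sub>\<alpha>\<close> applied to the
  highest vector, and contravariance makes the components orthogonal. The torus acts on each non-zero component
  by a character of the form required of a weight vector, so that \<open>M\<^sup>+\<close> is precisely the span of the
  singular vectors.

  The anti-involution is defined through the inverse of the antipode on the quotient algebra. Its
  values on the generators require that the antipode descends to the quotient and is injective there,
  which is the purpose of the computations with the defining relations (\<open>twisted_antipode_I\<close>,
  \<open>twisted_antipode_inverse\<close>, \<open>omega_gen\<close>).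
\<close>

section \<open>Maps out of the free algebra\<close>

lemma free_algebra_expansion:
  "p = (\<Sum>w\<in>Poly_Mapping.keys p. Poly_Mapping.single w (Poly_Mapping.lookup p w))"
  for p :: "'r free_algebra"
  by (rule poly_mapping_eqI) (simp add: lookup_sum lookup_single when_def in_keys_iff)

lemma scaleC_single: "c *\<^sub>C Poly_Mapping.single w a = Poly_Mapping.single w (c * a)"
  for a c :: complex
  by (rule poly_mapping_eqI) (simp add: lookup_scaleC lookup_single scaleC_complex_def when_def)

lemma single_append:
  "Poly_Mapping.single (u @ w) (a * b) = Poly_Mapping.single u a * Poly_Mapping.single w b"
  for a b :: complex
  by (simp add: mult_single plus_list_def)

lemma scaleC_eq_scal: "c *\<^sub>C p = scal c * p" for p :: "'r free_algebra"
  by (subst (1 2) free_algebra_expansion[of p])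
    (simp add: cvec.scale_sum_right sum_distrib_left scaleC_single
      flip: single_append)

lemma scal_commute: "p * scal c = scal c * p" for p :: "'r free_algebra"
  by (subst (1 2) free_algebra_expansion[of p])
    (simp add: sum_distrib_left sum_distrib_right mult.commute flip: single_append)

lemma scal_mult: "scal (a * b) = (scal a * scal b :: 'r free_algebra)"
  using single_append[of "[]" "[]" a b] by simp

lemma scal_mult_mult: "scal (a * b) * (x * y) = (scal a * x) * (scal b * y)" for x y :: "'r free_algebra"
  by (metis mult.assoc scal_commute scal_mult)

lemma scal_one: "scal 1 = (1 :: 'r free_algebra)"
  by (metis single_one zero_list_def)

text \<open>
  Both \<^const>\<open>free_hom\<close> and \<^const>\<open>free_antihom\<close> extend a function on words linearly, which is where
  their additivity comes from.
\<close>

definition word_extension :: "('r generator list \<Rightarrow> 'a::complex_vector) \<Rightarrow> 'r free_algebra \<Rightarrow> 'a"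
  where "word_extension g p = (\<Sum>w\<in>Poly_Mapping.keys p. Poly_Mapping.lookup p w *\<^sub>C g w)"

lemma word_extension_superset:
  assumes "finite A" "Poly_Mapping.keys p \<subseteq> A"
  shows "word_extension g p = (\<Sum>w\<in>A. Poly_Mapping.lookup p w *\<^sub>C g w)"
  unfolding word_extension_def using assms
  by (intro sum.mono_neutral_left) (auto simp: in_keys_iff)

lemma word_extension_add: "word_extension g (p + r) = word_extension g p + word_extension g r"
proof -
  let ?A = "Poly_Mapping.keys p \<union> Poly_Mapping.keys r"
  have "Poly_Mapping.keys (p + r) \<subseteq> ?A"
    by (rule Poly_Mapping.keys_add)
  then show ?thesis
    by (simp add: word_extension_superset[of ?A] lookup_add scaleC_add_left sum.distrib)
qed

lemma word_extension_single: "word_extension g (Poly_Mapping.single w c) = c *\<^sub>C g w"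
  by (simp add: word_extension_superset[of "{w}"])

lemma word_extension_zero [simp]: "word_extension g 0 = 0"
  by (simp add: word_extension_def)

lemma word_extension_sum: "word_extension g (sum h A) = (\<Sum>x\<in>A. word_extension g (h x))"
  by (induction A rule: infinite_finite_induct) (simp_all add: word_extension_add)

lemma word_extension_diff: "word_extension g (p - r) = word_extension g p - word_extension g r"
  by (metis add_diff_cancel diff_add_cancel word_extension_add)

lemma free_hom_eq: "free_hom f = word_extension (\<lambda>w. prod_list (map f w))"
  by (simp add: free_hom_def word_extension_def fun_eq_iff)

lemma free_antihom_eq: "free_antihom f = word_extension (\<lambda>w. prod_list (map f (rev w)))"
  by (simp add: free_antihom_def word_extension_def fun_eq_iff)

lemma free_hom_sum: "free_hom f (sum h A) = (\<Sum>x\<in>A. free_hom f (h x))"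
  by (simp add: free_hom_eq word_extension_sum)

lemma free_hom_simps:
  shows free_hom_add: "free_hom f (p + r) = free_hom f p + free_hom f r"
    and free_hom_diff: "free_hom f (p - r) = free_hom f p - free_hom f r"
    and free_hom_zero: "free_hom f 0 = 0"
    and free_hom_scal: "free_hom f (scal c) = scal c"
    and free_hom_one: "free_hom f 1 = 1"
    and free_hom_gen: "free_hom f (gen g) = f g"
    and free_hom_mult: "free_hom f (p * r) = free_hom f p * free_hom f r"
proof -
  show scal: "free_hom f (scal c) = scal c" for c
    by (simp add: free_hom_eq word_extension_single scaleC_eq_scal)
  show "free_hom f 1 = 1"
    using scal[of 1] by (simp add: scal_one)
  have "free_hom f (Poly_Mapping.single u a * Poly_Mapping.single w b) =
    free_hom f (Poly_Mapping.single u a) * free_hom f (Poly_Mapping.single w b)" for u w a b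
    by (simp add: free_hom_eq word_extension_single scaleC_eq_scal scal_mult_mult flip: single_append)
  then show "free_hom f (p * r) = free_hom f p * free_hom f r"
    by (subst (1 2) free_algebra_expansion[of p], subst (1 2) free_algebra_expansion[of r])
      (simp only: sum_product free_hom_sum)
qed (simp_all add: free_hom_eq word_extension_add word_extension_diff
    word_extension_single scaleC_one)

lemma free_antihom_sum: "free_antihom f (sum h A) = (\<Sum>x\<in>A. free_antihom f (h x))"
  by (simp add: free_antihom_eq word_extension_sum)

lemma free_antihom_simps:
  shows free_antihom_add: "free_antihom f (p + r) = free_antihom f p + free_antihom f r"
    and free_antihom_diff: "free_antihom f (p - r) = free_antihom f p - free_antihom f r"
    and free_antihom_zero: "free_antihom f 0 = 0"
    and free_antihom_scal: "free_antihom f (scal c) = scal c"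
    and free_antihom_one: "free_antihom f 1 = 1"
    and free_antihom_gen: "free_antihom f (gen g) = f g"
    and free_antihom_mult: "free_antihom f (p * r) = free_antihom f r * free_antihom f p"
proof -
  show scal: "free_antihom f (scal c) = scal c" for c
    by (simp add: free_antihom_eq word_extension_single scaleC_eq_scal)
  show "free_antihom f 1 = 1"
    using scal[of 1] by (simp add: scal_one)
  have "free_antihom f (Poly_Mapping.single u a * Poly_Mapping.single w b) =
    free_antihom f (Poly_Mapping.single w b) * free_antihom f (Poly_Mapping.single u a)" for u w a b
    by (simp add: free_antihom_eq word_extension_single scaleC_eq_scal scal_mult_mult mult.commute[of a]
        flip: single_append)
  then show "free_antihom f (p * r) = free_antihom f r * free_antihom f p"
    by (subst (1 2) free_algebra_expansion[of p], subst (1 2) free_algebra_expansion[of r])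
      (simp only: sum_product free_antihom_sum, rule sum.swap)
qed (simp_all add: free_antihom_eq word_extension_add word_extension_diff
    word_extension_single scaleC_one)

lemma mult_scaleC_right: "p * (c *\<^sub>C r) = c *\<^sub>C (p * r)" for p r :: "'r free_algebra"
  by (metis mult.assoc scal_commute scaleC_eq_scal)

lemma mult_scaleC_left: "(c *\<^sub>C p) * r = c *\<^sub>C (p * r)" for p r :: "'r free_algebra"
  by (simp add: scaleC_eq_scal mult.assoc)

lemmas scaleC_simps = mult_scaleC_right mult_scaleC_left scaleC_scaleC scaleC_one

lemma free_hom_scaleC: "free_hom f (c *\<^sub>C p) = c *\<^sub>C free_hom f p"
  by (simp add: scaleC_eq_scal free_hom_mult free_hom_scal)

lemma free_antihom_scaleC: "free_antihom f (c *\<^sub>C p) = c *\<^sub>C free_antihom f p"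
  by (simp add: scaleC_eq_scal free_antihom_mult free_antihom_scal scal_commute)

lemma free_hom_power: "free_hom f (p ^ n) = free_hom f p ^ n"
  by (induction n) (simp_all add: free_hom_one free_hom_mult)

lemma free_antihom_power: "free_antihom f (p ^ n) = free_antihom f p ^ n"
  by (induction n) (simp_all add: free_antihom_one free_antihom_mult power_commutes)

section \<open>The quantum group as a quotient\<close>

lemma carrier_free_ring: "p \<in> carrier (free_ring P) \<longleftrightarrow> (\<forall>w\<in>Poly_Mapping.keys p. set w \<subseteq> generators P)"
  by (simp add: free_ring_def)

lemma free_ring_simps [simp]:
  "p \<otimes>\<^bsub>free_ring P\<^esub> r = p * r" "p \<oplus>\<^bsub>free_ring P\<^esub> r = p + r"
  "\<one>\<^bsub>free_ring P\<^esub> = 1" "\<zero>\<^bsub>free_ring P\<^esub> = 0"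
  by (simp_all add: free_ring_def)

lemma free_ring_zero: "0 \<in> carrier (free_ring P)"
  by (simp add: carrier_free_ring)

lemma free_ring_add:
  "p \<in> carrier (free_ring P) \<Longrightarrow> r \<in> carrier (free_ring P) \<Longrightarrow> p + r \<in> carrier (free_ring P)"
  unfolding carrier_free_ring using Poly_Mapping.keys_add[of p r] by blast

lemma free_ring_uminus: "p \<in> carrier (free_ring P) \<Longrightarrow> - p \<in> carrier (free_ring P)"
  by (simp add: carrier_free_ring)

lemma free_ring_diff:
  "p \<in> carrier (free_ring P) \<Longrightarrow> r \<in> carrier (free_ring P) \<Longrightarrow> p - r \<in> carrier (free_ring P)"
  by (metis add_uminus_conv_diff free_ring_add free_ring_uminus)

lemma free_ring_mult:
  "p \<in> carrier (free_ring P) \<Longrightarrow> r \<in> carrier (free_ring P) \<Longrightarrow> p * r \<in> carrier (free_ring P)"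
  unfolding carrier_free_ring using Poly_Mapping.keys_mult[of p r]
  by (fastforce simp: plus_list_def)

lemma free_ring_scal: "scal c \<in> carrier (free_ring P)"
  by (simp add: carrier_free_ring)

lemma free_ring_one: "1 \<in> carrier (free_ring P)"
  using free_ring_scal[of 1 P] by (simp add: scal_one)

lemma free_ring_gen: "gen g \<in> carrier (free_ring P) \<longleftrightarrow> g \<in> generators P"
  by (simp add: carrier_free_ring)

lemma free_ring_sum:
  "(\<And>x. x \<in> A \<Longrightarrow> h x \<in> carrier (free_ring P)) \<Longrightarrow> sum h A \<in> carrier (free_ring P)"
  by (induction A rule: infinite_finite_induct) (auto simp: free_ring_zero free_ring_add)

lemma free_ring_power: "p \<in> carrier (free_ring P) \<Longrightarrow> p ^ n \<in> carrier (free_ring P)"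
  by (induction n) (auto simp: free_ring_one free_ring_mult)

lemmas free_ring_closed = free_ring_zero free_ring_add free_ring_uminus free_ring_diff free_ring_mult
  free_ring_scal free_ring_one free_ring_sum free_ring_power

lemma in_generators [simp]:
  "E \<alpha> \<in> generators P \<longleftrightarrow> \<alpha> \<in> P" "F \<alpha> \<in> generators P \<longleftrightarrow> \<alpha> \<in> P"
  "K \<alpha> \<in> generators P \<longleftrightarrow> \<alpha> \<in> P" "Kinv \<alpha> \<in> generators P \<longleftrightarrow> \<alpha> \<in> P"
  by (auto simp: generators_def)

text \<open>
  Membership in the free ring only says that all letters come from \<open>P\<close>; this rule reduces statements
  about its elements to scalars and generators.
\<close>

lemma free_ring_induct [consumes 1, case_names scal gen add mult]:
  assumes p: "p \<in> carrier (free_ring P)"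
    and "\<And>c. Q (scal c)" and "\<And>g. g \<in> generators P \<Longrightarrow> Q (gen g)"
    and "\<And>p r. p \<in> carrier (free_ring P) \<Longrightarrow> r \<in> carrier (free_ring P) \<Longrightarrow> Q p \<Longrightarrow> Q r \<Longrightarrow> Q (p + r)"
    and "\<And>p r. p \<in> carrier (free_ring P) \<Longrightarrow> r \<in> carrier (free_ring P) \<Longrightarrow> Q p \<Longrightarrow> Q r \<Longrightarrow> Q (p * r)"
  shows "Q p"
proof -
  have word: "Q (Poly_Mapping.single w 1) \<and> Poly_Mapping.single w 1 \<in> carrier (free_ring P)"
    if "set w \<subseteq> generators P" for w
    using that
  proof (induction w)
    case Nil
    show ?case using assms(2) by (simp add: free_ring_scal)
  next
    case (Cons g w)
    have "Poly_Mapping.single (g # w) 1 = gen g * Poly_Mapping.single w (1::complex)"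
      using single_append[of "[g]" w 1 1] by simp
    then show ?case
      using Cons assms(3,5) by (auto simp: free_ring_gen free_ring_mult)
  qed
  have monomial: "Q (Poly_Mapping.single w c) \<and> Poly_Mapping.single w c \<in> carrier (free_ring P)"
    if "set w \<subseteq> generators P" for w c
    using single_append[of "[]" w c 1] word[OF that] assms(2,5) by (simp add: free_ring_closed)
  have "Q (\<Sum>w\<in>A. Poly_Mapping.single w (Poly_Mapping.lookup p w)) \<and>
        (\<Sum>w\<in>A. Poly_Mapping.single w (Poly_Mapping.lookup p w)) \<in> carrier (free_ring P)"
    if "finite A" "A \<subseteq> Poly_Mapping.keys p" for A
    using that
  proof (induction A)
    case empty
    show ?case using assms(2)[of 0] by (simp add: free_ring_closed)
  next
    case (insert w A)
    moreover have "set w \<subseteq> generators P"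
      using insert p by (auto simp: carrier_free_ring)
    ultimately show ?case using monomial assms(4) by (simp add: free_ring_add)
  qed
  then show ?thesis
    using free_algebra_expansion[of p] by (metis finite_keys order_refl)
qed

lemma ring_free_ring: "ring (free_ring P)"
proof (rule ringI)
  show "abelian_group (free_ring P)"
  proof (rule abelian_groupI)
    show "\<exists>y\<in>carrier (free_ring P). y \<oplus>\<^bsub>free_ring P\<^esub> x = \<zero>\<^bsub>free_ring P\<^esub>"
      if "x \<in> carrier (free_ring P)" for x
      using that by (intro bexI[of _ "- x"]) (simp_all add: free_ring_closed)
  qed (simp_all add: free_ring_closed algebra_simps)
  show "Group.monoid (free_ring P)"
    by (rule monoidI) (simp_all add: free_ring_closed mult.assoc)
qed (simp_all add: algebra_simps)

lemma free_ring_scaleC: "p \<in> carrier (free_ring P) \<Longrightarrow> c *\<^sub>C p \<in> carrier (free_ring P)"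
  by (simp add: scaleC_eq_scal free_ring_closed)

lemma free_hom_carrier:
  assumes "\<And>g. g \<in> generators P \<Longrightarrow> f g \<in> carrier (free_ring P)" and "p \<in> carrier (free_ring P)"
  shows "free_hom f p \<in> carrier (free_ring P)"
  using assms(2)
  by (induction rule: free_ring_induct)
    (simp_all add: free_hom_simps free_ring_closed assms(1))

lemma free_antihom_carrier:
  assumes "\<And>g. g \<in> generators P \<Longrightarrow> f g \<in> carrier (free_ring P)" and "p \<in> carrier (free_ring P)"
  shows "free_antihom f p \<in> carrier (free_ring P)"
  using assms(2)
  by (induction rule: free_ring_induct)
    (simp_all add: free_antihom_simps free_ring_closed assms(1))

lemma q_power_add: "q_power lq (x + y) = q_power lq x * q_power lq y"
  by (simp add: q_power_def exp_add distrib_right)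

lemma q_power_minus: "q_power lq (- x) = inverse (q_power lq x)"
  by (simp add: q_power_def exp_minus)

lemma q_power_nonzero: "q_power lq x \<noteq> 0"
  by (simp add: q_power_def)

lemma q_binomial_reflect: "k \<le> n \<Longrightarrow> q_binomial p n (n - k) = q_binomial p n k"
  by (simp add: q_binomial_def mult.commute)

locale quantum_group =
  fixes P :: "'r set" and ip :: "'r \<Rightarrow> 'r \<Rightarrow> complex" and lq :: complex
  assumes ip_commute: "\<alpha> \<in> P \<Longrightarrow> \<beta> \<in> P \<Longrightarrow> ip \<alpha> \<beta> = ip \<beta> \<alpha>"
begin

abbreviation R where "R \<equiv> free_ring P"

abbreviation I where "I \<equiv> quantum_ideal P ip lq"

abbreviation relations where
  "relations \<equiv> torus_relations P \<union> weight_relations P ip lq \<union> commutator_relations P lq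
     \<union> serre_relations P ip lq"

definition qp :: "'r \<Rightarrow> 'r \<Rightarrow> complex" where "qp \<alpha> \<beta> = q_power lq (ip \<alpha> \<beta>)"

definition kappa :: complex where "kappa = 1 / (q_power lq 1 - q_power lq (-1))"

lemma qp_nonzero [simp]: "qp \<alpha> \<beta> \<noteq> 0"
  by (simp add: qp_def q_power_nonzero)

lemma qp_commute: "\<alpha> \<in> P \<Longrightarrow> \<beta> \<in> P \<Longrightarrow> qp \<alpha> \<beta> = qp \<beta> \<alpha>"
  by (simp add: qp_def ip_commute)

lemma carrier_gen: "g \<in> generators P \<Longrightarrow> gen g \<in> carrier R"
  by (simp add: free_ring_gen)

lemmas carrier_simps = free_ring_closed free_ring_gen free_ring_scaleC

lemma serre_element_carrier:
  "x \<in> carrier R \<Longrightarrow> y \<in> carrier R \<Longrightarrow> serre_element p n x y scal \<in> carrier R"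
  unfolding serre_element_def by (auto intro!: carrier_simps)

lemma relations_carrier: "relations \<subseteq> carrier R"
  by (auto simp: torus_relations_def weight_relations_def commutator_relations_def serre_relations_def
      intro!: carrier_simps(1-9) serre_element_carrier carrier_simps(10)[THEN iffD2])

lemma ideal_I: "ideal I R"
  unfolding quantum_ideal_def by (rule ring.genideal_ideal[OF ring_free_ring relations_carrier])

lemma relations_I: "x \<in> relations \<Longrightarrow> x \<in> I"
  unfolding quantum_ideal_def using ring.genideal_self[OF ring_free_ring relations_carrier] by blast

lemma I_carrier: "x \<in> I \<Longrightarrow> x \<in> carrier R"
  using ideal_I by (meson additive_subgroup.a_Hcarr ideal_def)

lemma I_zero: "0 \<in> I"
  using additive_subgroup.zero_closed[OF ideal.axioms(1)[OF ideal_I]] by simp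

lemma I_add: "x \<in> I \<Longrightarrow> y \<in> I \<Longrightarrow> x + y \<in> I"
  using additive_subgroup.a_closed[OF ideal.axioms(1)[OF ideal_I], of x y] by simp

lemma I_mult_left: "x \<in> I \<Longrightarrow> y \<in> carrier R \<Longrightarrow> y * x \<in> I"
  using ideal.I_l_closed[OF ideal_I] by simp

lemma I_mult_right: "x \<in> I \<Longrightarrow> y \<in> carrier R \<Longrightarrow> x * y \<in> I"
  using ideal.I_r_closed[OF ideal_I] by simp

lemma I_scaleC: "x \<in> I \<Longrightarrow> c *\<^sub>C x \<in> I"
  by (simp add: scaleC_eq_scal I_mult_left free_ring_scal)

lemma I_uminus: "x \<in> I \<Longrightarrow> - x \<in> I"
  using I_scaleC[of x "- 1"] by (simp add: cvec.scale_minus_left scaleC_one)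

lemma a_minus_eq: "x \<in> carrier R \<Longrightarrow> y \<in> carrier R \<Longrightarrow> x \<ominus>\<^bsub>R\<^esub> y = x - y"
proof -
  assume x: "x \<in> carrier R" and y: "y \<in> carrier R"
  interpret ring R by (rule ring_free_ring)
  have "\<ominus>\<^bsub>R\<^esub> y = - y"
    by (rule minus_equality) (use y in \<open>simp_all add: free_ring_closed\<close>)
  then show ?thesis by (simp add: a_minus_def)
qed

definition cong :: "'r free_algebra \<Rightarrow> 'r free_algebra \<Rightarrow> bool"  (infix "\<approx>" 50)
  where "p \<approx> r \<longleftrightarrow> p \<in> carrier R \<and> r \<in> carrier R \<and> p - r \<in> I"

lemma cls_eq_iff: "p \<in> carrier R \<Longrightarrow> r \<in> carrier R \<Longrightarrow> cls P ip lq p = cls P ip lq r \<longleftrightarrow> p \<approx> r"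
  unfolding cls_def cong_def
  using ring.quotient_eq_iff_same_a_r_cos[OF ring_free_ring ideal_I, of p r] by (simp add: a_minus_eq)

lemma cong_refl: "p \<in> carrier R \<Longrightarrow> p \<approx> p"
  by (simp add: cong_def I_zero)

lemma cong_sym: "p \<approx> r \<Longrightarrow> r \<approx> p"
  unfolding cong_def using I_uminus[of "p - r"] by simp

lemma cong_trans [trans]: "p \<approx> r \<Longrightarrow> r \<approx> s \<Longrightarrow> p \<approx> s"
  unfolding cong_def using I_add[of "p - r" "r - s"] by simp

lemma cong_add: "p \<approx> r \<Longrightarrow> p' \<approx> r' \<Longrightarrow> p + p' \<approx> r + r'"
  unfolding cong_def using I_add[of "p - r" "p' - r'"] by (simp add: free_ring_closed algebra_simps)

lemma cong_scaleC: "p \<approx> r \<Longrightarrow> c *\<^sub>C p \<approx> c *\<^sub>C r"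
  unfolding cong_def using I_scaleC[of "p - r" c]
  by (simp add: free_ring_scaleC cvec.scale_right_diff_distrib)

lemma cong_uminus: "p \<approx> r \<Longrightarrow> - p \<approx> - r"
  unfolding cong_def using I_uminus[of "p - r"] by (simp add: free_ring_closed)

lemma cong_diff: "p \<approx> r \<Longrightarrow> p' \<approx> r' \<Longrightarrow> p - p' \<approx> r - r'"
  using cong_add[of p r "- p'" "- r'"] cong_uminus[of p' r'] by simp

lemma cong_mult: "p \<approx> r \<Longrightarrow> p' \<approx> r' \<Longrightarrow> p * p' \<approx> r * r'"
proof -
  assume *: "p \<approx> r" "p' \<approx> r'"
  then have "(p - r) * p' + r * (p' - r') \<in> I"
    by (intro I_add I_mult_left I_mult_right) (simp_all add: cong_def)
  then show ?thesis
    using * by (simp add: cong_def free_ring_closed algebra_simps)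
qed

lemma cong_sum: "(\<And>x. x \<in> A \<Longrightarrow> h x \<approx> h' x) \<Longrightarrow> sum h A \<approx> sum h' A"
  by (induction A rule: infinite_finite_induct) (auto intro!: cong_add cong_refl free_ring_closed)

lemma cong_carrier: "p \<approx> r \<Longrightarrow> p \<in> carrier R" "p \<approx> r \<Longrightarrow> r \<in> carrier R"
  by (simp_all add: cong_def)

lemma cong_relation: "p - r \<in> relations \<Longrightarrow> p \<in> carrier R \<Longrightarrow> r \<in> carrier R \<Longrightarrow> p \<approx> r"
  by (simp add: cong_def relations_I)

text \<open>
  These instances for equations take precedence over the general substitution rules, whose
  higher-order unification is very expensive on sums of products.
\<close>

lemma cong_eq_trans [trans]: "p = r \<Longrightarrow> r \<approx> s \<Longrightarrow> p \<approx> s" "p \<approx> r \<Longrightarrow> r = s \<Longrightarrow> p \<approx> s"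
  by simp_all

lemma torus_commute:
  assumes "x \<in> K ` P \<union> Kinv ` P" "y \<in> K ` P \<union> Kinv ` P"
  shows "gen x * gen y \<approx> gen y * gen x"
  using assms by (intro cong_relation) (auto simp: torus_relations_def intro!: free_ring_mult carrier_gen)

lemma K_Kinv: "\<alpha> \<in> P \<Longrightarrow> gen (K \<alpha>) * gen (Kinv \<alpha>) \<approx> 1"
  by (intro cong_relation) (auto simp: torus_relations_def intro!: free_ring_closed carrier_gen)

lemma Kinv_K: "\<alpha> \<in> P \<Longrightarrow> gen (Kinv \<alpha>) * gen (K \<alpha>) \<approx> 1"
  by (rule cong_trans[OF torus_commute K_Kinv]) auto

lemma weight_cong:
  assumes "\<alpha> \<in> P" "\<beta> \<in> P"
  shows KE: "gen (K \<alpha>) * gen (E \<beta>) \<approx> qp \<alpha> \<beta> *\<^sub>C (gen (E \<beta>) * gen (K \<alpha>))"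
    and KinvE: "gen (Kinv \<alpha>) * gen (E \<beta>) \<approx> inverse (qp \<alpha> \<beta>) *\<^sub>C (gen (E \<beta>) * gen (Kinv \<alpha>))"
    and KF: "gen (K \<alpha>) * gen (F \<beta>) \<approx> inverse (qp \<alpha> \<beta>) *\<^sub>C (gen (F \<beta>) * gen (K \<alpha>))"
    and KinvF: "gen (Kinv \<alpha>) * gen (F \<beta>) \<approx> qp \<alpha> \<beta> *\<^sub>C (gen (F \<beta>) * gen (Kinv \<alpha>))"
proof -
  have rel: "p \<approx> c *\<^sub>C r" if "p - scal c * r \<in> weight_relations P ip lq" "p \<in> carrier R" "r \<in> carrier R" for p c r
    using that by (intro cong_relation) (simp_all add: scaleC_eq_scal free_ring_closed)
  show "gen (K \<alpha>) * gen (E \<beta>) \<approx> qp \<alpha> \<beta> *\<^sub>C (gen (E \<beta>) * gen (K \<alpha>))"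
    by (rule rel) (use assms in \<open>simp_all only: carrier_gen free_ring_mult in_generators weight_relations_def qp_def mult.assoc, blast?\<close>)
  show "gen (Kinv \<alpha>) * gen (E \<beta>) \<approx> inverse (qp \<alpha> \<beta>) *\<^sub>C (gen (E \<beta>) * gen (Kinv \<alpha>))"
    by (rule rel) (use assms in \<open>simp_all only: carrier_gen free_ring_mult in_generators weight_relations_def qp_def q_power_minus[symmetric] mult.assoc, blast?\<close>)
  show "gen (K \<alpha>) * gen (F \<beta>) \<approx> inverse (qp \<alpha> \<beta>) *\<^sub>C (gen (F \<beta>) * gen (K \<alpha>))"
    by (rule rel) (use assms in \<open>simp_all only: carrier_gen free_ring_mult in_generators weight_relations_def qp_def q_power_minus[symmetric] mult.assoc, blast?\<close>)
  show "gen (Kinv \<alpha>) * gen (F \<beta>) \<approx> qp \<alpha> \<beta> *\<^sub>C (gen (F \<beta>) * gen (Kinv \<alpha>))"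
    by (rule rel) (use assms in \<open>simp_all only: carrier_gen free_ring_mult in_generators weight_relations_def qp_def mult.assoc, blast?\<close>)
qed

lemma weight_relations_cases:
  assumes "x \<in> weight_relations P ip lq"
  obtains \<alpha> \<beta> where "\<alpha> \<in> P" "\<beta> \<in> P"
      "x = gen (K \<alpha>) * gen (E \<beta>) - scal (qp \<alpha> \<beta>) * gen (E \<beta>) * gen (K \<alpha>)"
    | \<alpha> \<beta> where "\<alpha> \<in> P" "\<beta> \<in> P"
      "x = gen (Kinv \<alpha>) * gen (E \<beta>) - scal (inverse (qp \<alpha> \<beta>)) * gen (E \<beta>) * gen (Kinv \<alpha>)"
    | \<alpha> \<beta> where "\<alpha> \<in> P" "\<beta> \<in> P"
      "x = gen (K \<alpha>) * gen (F \<beta>) - scal (inverse (qp \<alpha> \<beta>)) * gen (F \<beta>) * gen (K \<alpha>)"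
    | \<alpha> \<beta> where "\<alpha> \<in> P" "\<beta> \<in> P"
      "x = gen (Kinv \<alpha>) * gen (F \<beta>) - scal (qp \<alpha> \<beta>) * gen (F \<beta>) * gen (Kinv \<alpha>)"
  using assms unfolding weight_relations_def qp_def q_power_minus by blast

lemma EF_cong:
  assumes "\<alpha> \<in> P" "\<beta> \<in> P"
  shows "gen (E \<alpha>) * gen (F \<beta>) - gen (F \<beta>) * gen (E \<alpha>)
    \<approx> (if \<alpha> = \<beta> then kappa *\<^sub>C (gen (K \<alpha>) - gen (Kinv \<alpha>)) else 0)"
proof (rule cong_relation)
  have "gen (E \<alpha>) * gen (F \<beta>) - gen (F \<beta>) * gen (E \<alpha>)
    - (if \<alpha> = \<beta> then kappa *\<^sub>C (gen (K \<alpha>) - gen (Kinv \<alpha>)) else 0) \<in> commutator_relations P lq"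
    unfolding commutator_relations_def kappa_def scaleC_eq_scal using assms by blast
  then show "gen (E \<alpha>) * gen (F \<beta>) - gen (F \<beta>) * gen (E \<alpha>)
    - (if \<alpha> = \<beta> then kappa *\<^sub>C (gen (K \<alpha>) - gen (Kinv \<alpha>)) else 0) \<in> relations"
    by blast
qed (use assms in \<open>auto intro!: free_ring_closed free_ring_scaleC carrier_gen\<close>)

lemma serre_I:
  assumes "\<alpha> \<in> P" "\<beta> \<in> P" "\<alpha> \<noteq> \<beta>" "of_nat n = 1 - 2 * ip \<alpha> \<beta> / ip \<alpha> \<alpha>" "X \<in> {E, F}"
  shows "serre_element (q_power lq (ip \<alpha> \<alpha> / 2)) n (gen (X \<alpha>)) (gen (X \<beta>)) scal \<in> I"
  using assms by (intro relations_I UnI2) (unfold serre_relations_def, blast)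

text \<open>
  The preimage of an ideal under an additive map that preserves or reverses products is again an
  ideal, so that it suffices to look at the defining relations.
\<close>

lemma I_preserved:
  assumes add: "\<And>p r. \<phi> (p + r) = \<phi> p + \<phi> r"
    and carr: "\<And>p. p \<in> carrier R \<Longrightarrow> \<phi> p \<in> carrier R"
    and mult: "(\<forall>p r. \<phi> (p * r) = \<phi> p * \<phi> r) \<or> (\<forall>p r. \<phi> (p * r) = \<phi> r * \<phi> p)"
    and rel: "\<And>x. x \<in> relations \<Longrightarrow> \<phi> x \<in> I"
    and x: "x \<in> I"
  shows "\<phi> x \<in> I"
proof -
  have zero: "\<phi> 0 = 0"
    using add[of 0 0] by simp
  have minus: "\<phi> (- p) = - \<phi> p" for p
    using add[of p "- p"] zero by (simp add: eq_neg_iff_add_eq_0 add.commute)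
  interpret ring R by (rule ring_free_ring)
  let ?J = "{p \<in> carrier R. \<phi> p \<in> I}"
  have "ideal ?J R"
  proof (rule idealI[OF ring_free_ring])
    show "subgroup ?J (add_monoid R)"
    proof (rule add.subgroupI)
      show "\<ominus>\<^bsub>R\<^esub> a \<in> ?J" if "a \<in> ?J" for a
      proof -
        have "\<ominus>\<^bsub>R\<^esub> a = - a"
          by (rule minus_equality) (use that in \<open>simp_all add: free_ring_closed\<close>)
        then show ?thesis using that by (simp add: minus I_uminus free_ring_closed)
      qed
    qed (auto simp: zero add I_zero I_add free_ring_closed)
    show "x \<otimes>\<^bsub>R\<^esub> a \<in> ?J" "a \<otimes>\<^bsub>R\<^esub> x \<in> ?J" if "a \<in> ?J" "x \<in> carrier R" for a x
      using that mult carr by (auto simp: free_ring_mult I_mult_left I_mult_right)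
  qed
  moreover have "relations \<subseteq> ?J"
    using relations_carrier rel by blast
  ultimately have "I \<subseteq> ?J"
    unfolding quantum_ideal_def by (rule genideal_minimal)
  then show ?thesis using x by blast
qed

text \<open>
  The antipode and \<open>\<sigma>\<close> are given as unions over all representatives of a class. Such a union collapses
  to a single class as soon as the map preserves the ideal.
\<close>

lemma cls_image:
  assumes diff: "\<And>p r. \<phi> (p - r) = \<phi> p - \<phi> r"
    and carr: "\<And>p. p \<in> carrier R \<Longrightarrow> \<phi> p \<in> carrier R"
    and I: "\<And>x. x \<in> I \<Longrightarrow> \<phi> x \<in> I"
    and p: "p \<in> carrier R"
  shows "(\<Union>r\<in>cls P ip lq p. cls P ip lq (\<phi> r)) = cls P ip lq (\<phi> p)"
proof -
  have "p \<in> cls P ip lq p"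
    unfolding cls_def using abelian_subgroup.a_rcos_self[OF abelian_subgroupI3 p] ideal_I ring_free_ring
    by (metis ideal.axioms(1) ring.is_abelian_group)
  moreover have "cls P ip lq (\<phi> r) = cls P ip lq (\<phi> p)" if "r \<in> cls P ip lq p" for r
  proof -
    from that obtain h where h: "h \<in> I" "r = h + p"
      by (auto simp: cls_def a_r_coset_def r_coset_def)
    then have r: "r \<in> carrier R" "r - p \<in> I"
      using p I_carrier by (auto simp: free_ring_add)
    then have "\<phi> r - \<phi> p \<in> I"
      using I[of "r - p"] by (simp add: diff)
    then show ?thesis
      using r p carr by (simp add: cls_eq_iff cong_def)
  qed
  ultimately show ?thesis by blast
qed

section \<open>The antipode and the anti-involution\<close>

lemma power_commute_cong:
  assumes carr: "x \<in> carrier R" "u \<in> carrier R" and ux: "u * x \<approx> t *\<^sub>C (x * u)"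
  shows "u ^ i * x ^ j \<approx> t ^ (i * j) *\<^sub>C (x ^ j * u ^ i)"
proof -
  have one: "u * x ^ j \<approx> t ^ j *\<^sub>C (x ^ j * u)" for j
  proof (induction j)
    case (Suc j)
    have "u * x ^ Suc j = (u * x) * x ^ j" by (simp add: mult.assoc)
    also have "\<dots> \<approx> (t *\<^sub>C (x * u)) * x ^ j"
      by (intro cong_mult cong_refl ux carr free_ring_closed)
    also have "(t *\<^sub>C (x * u)) * x ^ j = t *\<^sub>C (x * (u * x ^ j))"
      by (simp add: scaleC_simps mult.assoc)
    also have "\<dots> \<approx> t *\<^sub>C (x * (t ^ j *\<^sub>C (x ^ j * u)))"
      by (intro cong_scaleC cong_mult cong_refl Suc carr)
    finally show ?case by (simp add: scaleC_simps mult.assoc)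
  qed (simp add: scaleC_simps cong_refl carr)
  show ?thesis
  proof (induction i)
    case (Suc i)
    have "u ^ Suc i * x ^ j = u * (u ^ i * x ^ j)" by (simp add: mult.assoc)
    also have "\<dots> \<approx> u * (t ^ (i * j) *\<^sub>C (x ^ j * u ^ i))"
      by (intro cong_mult cong_refl Suc carr)
    also have "\<dots> = t ^ (i * j) *\<^sub>C ((u * x ^ j) * u ^ i)"
      by (simp add: scaleC_simps mult.assoc)
    also have "\<dots> \<approx> t ^ (i * j) *\<^sub>C ((t ^ j *\<^sub>C (x ^ j * u)) * u ^ i)"
      by (intro cong_scaleC cong_mult cong_refl one carr free_ring_closed)
    finally show ?case by (simp add: scaleC_simps mult.assoc power_add mult.commute)
  qed (simp add: scaleC_simps cong_refl carr free_ring_closed)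
qed

text \<open>
  Reordering \<open>(x u) \<cdots> (x u)\<close> into \<open>x \<cdots> x u \<cdots> u\<close> moves a \<open>u\<close> past an \<open>x\<close> once for every pair of factors.
\<close>

lemma twisted_power_cong:
  assumes carr: "x \<in> carrier R" "u \<in> carrier R" and ux: "u * x \<approx> t *\<^sub>C (x * u)"
    and z: "z \<approx> a *\<^sub>C (x * u)"
  shows "z ^ i \<approx> (a ^ i * t ^ (i choose 2)) *\<^sub>C (x ^ i * u ^ i)"
proof (induction i)
  case (Suc i)
  let ?c = "a ^ i * t ^ (i choose 2)"
  have "z ^ Suc i = z * z ^ i" by simp
  also have "\<dots> \<approx> (a *\<^sub>C (x * u)) * (?c *\<^sub>C (x ^ i * u ^ i))"
    by (intro cong_mult z Suc)
  also have "\<dots> = (a * ?c) *\<^sub>C (x * (u ^ 1 * x ^ i) * u ^ i)"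
    by (simp add: scaleC_simps mult.assoc)
  also have "\<dots> \<approx> (a * ?c) *\<^sub>C (x * (t ^ (1 * i) *\<^sub>C (x ^ i * u ^ 1)) * u ^ i)"
    by (intro cong_scaleC cong_mult cong_refl power_commute_cong[OF carr ux] carr free_ring_closed)
  finally show ?case
    by (simp add: scaleC_simps mult.assoc power_add mult.commute mult.left_commute numeral_2_eq_2)
qed (simp add: scaleC_simps cong_refl carr free_ring_closed numeral_2_eq_2)

text \<open>
  The scalar collected when the torus elements are moved to the right does not depend on the
  position of \<open>y\<close>, which is why the quantum Serre relations survive the antipode.
\<close>

lemma twisted_monomial_cong:
  assumes carr: "x \<in> carrier R" "y \<in> carrier R" "u \<in> carrier R" "v \<in> carrier R"
    and ux: "u * x \<approx> t *\<^sub>C (x * u)" and uy: "u * y \<approx> s *\<^sub>C (y * u)"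
    and vx: "v * x \<approx> s *\<^sub>C (x * v)" and vu: "v * u \<approx> u * v"
    and z: "z \<approx> a *\<^sub>C (x * u)" and w: "w \<approx> b *\<^sub>C (y * v)"
  shows "z ^ i * w * z ^ j \<approx> (a ^ (i + j) * b * s ^ (i + j) * t ^ ((i + j) choose 2)) *\<^sub>C
    (x ^ i * y * x ^ j) * (u ^ (i + j) * v)"
proof -
  let ?c = "\<lambda>i. a ^ i * t ^ (i choose 2)"
  have choose: "(i + j) choose 2 = (i choose 2) + (j choose 2) + i * j"
    by (induction j) (simp_all add: numeral_2_eq_2)
  have vu': "v ^ 1 * u ^ j \<approx> 1 ^ (1 * j) *\<^sub>C (u ^ j * v ^ 1)"
    by (rule power_commute_cong) (simp_all add: carr vu scaleC_simps)
  note closed = carr free_ring_closed free_ring_scaleC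
  have "z ^ i * w * z ^ j \<approx>
    (?c i *\<^sub>C (x ^ i * u ^ i)) * (b *\<^sub>C (y * v)) * (?c j *\<^sub>C (x ^ j * u ^ j))"
    by (intro cong_mult twisted_power_cong[OF _ _ ux z] w carr)
  also have "\<dots> = (?c i * b * ?c j) *\<^sub>C
      (x ^ i * (u ^ i * y ^ 1) * ((v ^ 1 * x ^ j) * u ^ j))"
    by (simp add: scaleC_simps mult.assoc)
  also have "\<dots> \<approx> (?c i * b * ?c j) *\<^sub>C
      (x ^ i * (s ^ (i * 1) *\<^sub>C (y ^ 1 * u ^ i)) * ((s ^ (1 * j) *\<^sub>C (x ^ j * v ^ 1)) * u ^ j))"
    by (intro cong_scaleC cong_mult cong_refl closed power_commute_cong[OF _ _ uy]
        power_commute_cong[OF _ _ vx])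
  also have "\<dots> = (?c i * b * ?c j * s ^ (i + j)) *\<^sub>C
      (x ^ i * y * (u ^ i * x ^ j) * (v ^ 1 * u ^ j))"
    by (simp add: scaleC_simps mult.assoc power_add)
  also have "\<dots> \<approx> (?c i * b * ?c j * s ^ (i + j)) *\<^sub>C
      (x ^ i * y * (t ^ (i * j) *\<^sub>C (x ^ j * u ^ i)) * (1 ^ (1 * j) *\<^sub>C (u ^ j * v ^ 1)))"
    by (intro cong_scaleC cong_mult cong_refl closed power_commute_cong[OF _ _ ux] vu')
  finally show ?thesis
    by (simp add: scaleC_simps mult.assoc power_add choose mult.commute mult.left_commute)
qed

text \<open>
  An anti-homomorphism exchanges the powers on the two sides of \<open>y\<close> in each term of a Serre element; up
  to a sign the sum is unchanged because quantum binomial coefficients are symmetric.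
\<close>

lemma serre_reflect:
  "(\<Sum>k\<le>n. ((-1) ^ k * q_binomial p n k) *\<^sub>C (x ^ k * y * x ^ (n - k)))
    = (-1) ^ n *\<^sub>C serre_element p n x y scal"
proof -
  have "(\<Sum>k\<le>n. ((-1) ^ k * q_binomial p n k) *\<^sub>C (x ^ k * y * x ^ (n - k)))
      = (\<Sum>k\<le>n. ((-1) ^ (n - k) * q_binomial p n (n - k)) *\<^sub>C (x ^ (n - k) * y * x ^ (n - (n - k))))"
    by (rule sum.reindex_bij_witness[of _ "\<lambda>k. n - k" "\<lambda>k. n - k"]) auto
  also have "\<dots> = (\<Sum>k\<le>n. (-1) ^ n *\<^sub>C scal ((-1) ^ k * q_binomial p n k) * x ^ (n - k) * y * x ^ k)"
  proof (rule sum.cong)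
    fix k assume "k \<in> {..n}"
    then have k: "k \<le> n" by simp
    have "(-1) ^ n = (-1) ^ (n - k) * (-1 :: complex) ^ k"
      by (simp add: k flip: power_add)
    then have "(-1) ^ (n - k) = (-1) ^ n * (-1 :: complex) ^ k"
      by (simp flip: power_mult_distrib)
    then show "((-1) ^ (n - k) * q_binomial p n (n - k)) *\<^sub>C (x ^ (n - k) * y * x ^ (n - (n - k)))
      = (-1) ^ n *\<^sub>C scal ((-1) ^ k * q_binomial p n k) * x ^ (n - k) * y * x ^ k"
      using k by (simp add: q_binomial_reflect scaleC_simps mult.assoc flip: scaleC_eq_scal)
  qed simp
  finally show ?thesis
    by (simp add: serre_element_def cvec.scale_sum_right scaleC_simps)
qed

lemma serre_antihom_I:
  assumes carr: "x \<in> carrier R" "y \<in> carrier R" "u \<in> carrier R" "v \<in> carrier R"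
    and ux: "u * x \<approx> t *\<^sub>C (x * u)" and uy: "u * y \<approx> s *\<^sub>C (y * u)"
    and vx: "v * x \<approx> s *\<^sub>C (x * v)" and vu: "v * u \<approx> u * v"
    and z: "free_antihom f x \<approx> a *\<^sub>C (x * u)" and w: "free_antihom f y \<approx> b *\<^sub>C (y * v)"
    and serre: "serre_element p n x y scal \<in> I"
  shows "free_antihom f (serre_element p n x y scal) \<in> I"
proof -
  let ?c = "\<lambda>k. (-1) ^ k * q_binomial p n k"
  let ?m = "a ^ n * b * s ^ n * t ^ (n choose 2)"
  let ?z = "free_antihom f x" and ?w = "free_antihom f y"
  have "free_antihom f (serre_element p n x y scal) = (\<Sum>k\<le>n. ?c k *\<^sub>C (?z ^ k * ?w * ?z ^ (n - k)))"
    unfolding serre_element_def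
    by (simp add: free_antihom_sum free_antihom_mult free_antihom_power free_antihom_scaleC
        mult.assoc scaleC_simps flip: scaleC_eq_scal)
  also have "\<dots> \<approx> (\<Sum>k\<le>n. ?c k *\<^sub>C (?m *\<^sub>C (x ^ k * y * x ^ (n - k)) * (u ^ n * v)))"
  proof (intro cong_sum cong_scaleC)
    fix k assume "k \<in> {..n}"
    then have "k + (n - k) = n" by simp
    then show "?z ^ k * ?w * ?z ^ (n - k) \<approx> ?m *\<^sub>C (x ^ k * y * x ^ (n - k)) * (u ^ n * v)"
      using twisted_monomial_cong[OF carr ux uy vx vu z w, of k "n - k"] by simp
  qed
  also have "\<dots> = ?m *\<^sub>C ((\<Sum>k\<le>n. ?c k *\<^sub>C (x ^ k * y * x ^ (n - k))) * (u ^ n * v))"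
    by (simp add: cvec.scale_sum_right sum_distrib_right scaleC_simps mult.commute)
  finally have "free_antihom f (serre_element p n x y scal)
    \<approx> ?m *\<^sub>C (((-1) ^ n *\<^sub>C serre_element p n x y scal) * (u ^ n * v))"
    by (simp only: serre_reflect)
  moreover have "?m *\<^sub>C (((-1) ^ n *\<^sub>C serre_element p n x y scal) * (u ^ n * v)) \<in> I"
    by (intro I_scaleC I_mult_right serre free_ring_closed carr)
  ultimately show ?thesis
    unfolding cong_def using I_add by fastforce
qed

text \<open>
  The antipode is the case \<open>c = 1\<close>; its square rescales the \<open>e\<^sub>\<alpha>\<close>, so that the inverse is another
  member of the same family.
\<close>

definition twisted_antipode :: "('r \<Rightarrow> complex) \<Rightarrow> 'r free_algebra \<Rightarrow> 'r free_algebra"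
  where "twisted_antipode c = free_antihom (\<lambda>g. case g of
       E \<alpha> \<Rightarrow> (- c \<alpha>) *\<^sub>C (gen (E \<alpha>) * gen (Kinv \<alpha>))
     | F \<alpha> \<Rightarrow> (- inverse (c \<alpha>)) *\<^sub>C (gen (K \<alpha>) * gen (F \<alpha>))
     | K \<alpha> \<Rightarrow> gen (Kinv \<alpha>)
     | Kinv \<alpha> \<Rightarrow> gen (K \<alpha>))"

lemma twisted_antipode_gen:
  "twisted_antipode c (gen (E \<alpha>)) = (- c \<alpha>) *\<^sub>C (gen (E \<alpha>) * gen (Kinv \<alpha>))"
  "twisted_antipode c (gen (F \<alpha>)) = (- inverse (c \<alpha>)) *\<^sub>C (gen (K \<alpha>) * gen (F \<alpha>))"
  "twisted_antipode c (gen (K \<alpha>)) = gen (Kinv \<alpha>)"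
  "twisted_antipode c (gen (Kinv \<alpha>)) = gen (K \<alpha>)"
  by (simp_all add: twisted_antipode_def free_antihom_gen)

lemma twisted_antipode_simps:
  "twisted_antipode c (p + r) = twisted_antipode c p + twisted_antipode c r"
  "twisted_antipode c (p - r) = twisted_antipode c p - twisted_antipode c r"
  "twisted_antipode c 0 = 0"
  "twisted_antipode c (scal a) = scal a"
  "twisted_antipode c 1 = 1"
  "twisted_antipode c (p * r) = twisted_antipode c r * twisted_antipode c p"
  "twisted_antipode c (a *\<^sub>C p) = a *\<^sub>C twisted_antipode c p"
  by (simp_all add: twisted_antipode_def free_antihom_simps free_antihom_scaleC)

lemma twisted_antipode_carrier: "p \<in> carrier R \<Longrightarrow> twisted_antipode c p \<in> carrier R"
  unfolding twisted_antipode_def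
  by (rule free_antihom_carrier)
    (auto simp: generators_def intro!: free_ring_mult free_ring_uminus free_ring_scaleC carrier_gen)

text \<open>
  The common shape of the four weight relations after an anti-homomorphism that inverts the torus:
  \<open>y\<close> is sent to a multiple of \<open>y t\<close>, and \<open>x\<close> is the image of the torus generator.
\<close>

lemma torus_pair_weight_flip:
  assumes carr: "x \<in> carrier R" "y \<in> carrier R" "t \<in> carrier R"
    and xy: "x * y \<approx> inverse \<chi> *\<^sub>C (y * x)" and tx: "t * x \<approx> x * t"
    and z: "z \<approx> m *\<^sub>C (y * t)" and \<chi>: "\<chi> \<noteq> 0"
  shows "z * x \<approx> \<chi> *\<^sub>C (x * z)"
proof -
  note closed = carr free_ring_closed free_ring_scaleC
  have "z * x \<approx> (m *\<^sub>C (y * t)) * x"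
    by (intro cong_mult cong_refl z carr)
  also have "\<dots> = m *\<^sub>C (y * (t * x))"
    by (simp add: scaleC_simps mult.assoc)
  also have "\<dots> \<approx> m *\<^sub>C (y * (x * t))"
    by (intro cong_scaleC cong_mult cong_refl tx carr)
  also have "\<dots> = (m * \<chi>) *\<^sub>C ((inverse \<chi> *\<^sub>C (y * x)) * t)"
    by (simp add: scaleC_simps mult.assoc \<chi>)
  also have "\<dots> \<approx> (m * \<chi>) *\<^sub>C ((x * y) * t)"
    by (intro cong_scaleC cong_mult cong_refl cong_sym[OF xy] carr)
  also have "\<dots> = \<chi> *\<^sub>C (x * (m *\<^sub>C (y * t)))"
    by (simp add: scaleC_simps mult.assoc mult.commute)
  also have "\<dots> \<approx> \<chi> *\<^sub>C (x * z)"
    by (intro cong_scaleC cong_mult cong_refl cong_sym[OF z] carr)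
  finally show ?thesis .
qed

context
  fixes c :: "'r \<Rightarrow> complex"
  assumes c: "\<And>\<alpha>. c \<alpha> \<noteq> 0"
begin

lemma twisted_antipode_E_cong:
  "\<alpha> \<in> P \<Longrightarrow> twisted_antipode c (gen (E \<alpha>)) \<approx> (- c \<alpha>) *\<^sub>C (gen (E \<alpha>) * gen (Kinv \<alpha>))"
  by (simp add: twisted_antipode_gen cong_refl free_ring_closed free_ring_scaleC carrier_gen)

lemma twisted_antipode_F_cong:
  "\<alpha> \<in> P \<Longrightarrow> twisted_antipode c (gen (F \<alpha>))
     \<approx> (- inverse (c \<alpha>) * inverse (qp \<alpha> \<alpha>)) *\<^sub>C (gen (F \<alpha>) * gen (K \<alpha>))"
  using cong_scaleC[OF KF[of \<alpha> \<alpha>], of "- inverse (c \<alpha>)"]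
  by (simp add: twisted_antipode_gen scaleC_simps)

lemma twisted_antipode_torus_I: "x \<in> torus_relations P \<Longrightarrow> twisted_antipode c x \<in> I"
proof -
  assume "x \<in> torus_relations P"
  then consider (comm) g h where "x = gen g * gen h - gen h * gen g"
      "g \<in> K ` P \<union> Kinv ` P" "h \<in> K ` P \<union> Kinv ` P"
    | (inv) \<alpha> where "x = gen (K \<alpha>) * gen (Kinv \<alpha>) - 1" "\<alpha> \<in> P"
    unfolding torus_relations_def by blast
  then show ?thesis
  proof cases
    case comm
    have "\<exists>g'. twisted_antipode c (gen g) = gen g' \<and> g' \<in> K ` P \<union> Kinv ` P"
      if "g \<in> K ` P \<union> Kinv ` P" for g
      using that by (auto simp: twisted_antipode_gen)
    then obtain g' h' where "twisted_antipode c (gen g) = gen g'" "g' \<in> K ` P \<union> Kinv ` P"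
      "twisted_antipode c (gen h) = gen h'" "h' \<in> K ` P \<union> Kinv ` P"
      using comm by metis
    then show ?thesis
      using torus_commute[of h' g'] comm(1) by (simp add: twisted_antipode_simps cong_def)
  next
    case inv
    then show ?thesis
      using K_Kinv[of \<alpha>] by (simp add: twisted_antipode_simps twisted_antipode_gen cong_def)
  qed
qed

lemma twisted_antipode_weight_I: "x \<in> weight_relations P ip lq \<Longrightarrow> twisted_antipode c x \<in> I"
proof -
  let ?S = "twisted_antipode c"
  have goal: "?S (gen g * gen h - scal \<chi> * gen h * gen g) \<in> I"
    if "?S (gen h) * ?S (gen g) \<approx> \<chi> *\<^sub>C (?S (gen g) * ?S (gen h))" for g h \<chi>
    using that
    by (simp add: twisted_antipode_simps cong_def mult_scaleC_left flip: scaleC_eq_scal)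
  assume "x \<in> weight_relations P ip lq"
  then show ?thesis
  proof (cases rule: weight_relations_cases)
    case 1
    show ?thesis unfolding 1(3)
      by (rule goal, unfold twisted_antipode_gen(3))
        (rule torus_pair_weight_flip[OF _ _ _ KinvE[OF 1(1,2)] _ twisted_antipode_E_cong[OF 1(2)]];
          use 1 in \<open>auto intro: carrier_gen torus_commute\<close>)
  next
    case 2
    show ?thesis unfolding 2(3)
      by (rule goal, unfold twisted_antipode_gen(4))
        (rule torus_pair_weight_flip[OF _ _ _ _ _ twisted_antipode_E_cong[OF 2(2)]];
          use 2 KE[OF 2(1,2)] in \<open>auto intro: carrier_gen torus_commute\<close>)
  next
    case 3
    show ?thesis unfolding 3(3)
      by (rule goal, unfold twisted_antipode_gen(3))
        (rule torus_pair_weight_flip[OF _ _ _ _ _ twisted_antipode_F_cong[OF 3(2)]];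
          use 3 KinvF[OF 3(1,2)] in \<open>auto intro: carrier_gen torus_commute\<close>)
  next
    case 4
    show ?thesis unfolding 4(3)
      by (rule goal, unfold twisted_antipode_gen(4))
        (rule torus_pair_weight_flip[OF _ _ _ KF[OF 4(1,2)] _ twisted_antipode_F_cong[OF 4(2)]];
          use 4 in \<open>auto intro: carrier_gen torus_commute\<close>)
  qed
qed

lemma twisted_antipode_serre_I: "x \<in> serre_relations P ip lq \<Longrightarrow> twisted_antipode c x \<in> I"
proof -
  assume "x \<in> serre_relations P ip lq"
  then obtain \<alpha> \<beta> n X where P: "\<alpha> \<in> P" "\<beta> \<in> P" and ne: "\<alpha> \<noteq> \<beta>"
    and n: "of_nat n = 1 - 2 * ip \<alpha> \<beta> / ip \<alpha> \<alpha>"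
    and x: "x = serre_element (q_power lq (ip \<alpha> \<alpha> / 2)) n (gen (X \<alpha>)) (gen (X \<beta>)) scal"
    and X: "X \<in> {E, F}"
    unfolding serre_relations_def by blast
  note serre = serre_I[OF P ne n X]
  from X consider "X = E" | "X = F" by blast
  then show ?thesis
  proof cases
    case 1
    show ?thesis
      unfolding x 1 twisted_antipode_def
      by (rule serre_antihom_I[OF _ _ _ _ KinvE[OF P(1,1)] KinvE[OF P]
            KinvE[OF P(2,1), unfolded qp_commute[OF P(2,1)]] _
            twisted_antipode_E_cong[OF P(1), unfolded twisted_antipode_def]
            twisted_antipode_E_cong[OF P(2), unfolded twisted_antipode_def] serre[unfolded 1]])
        (use P in \<open>auto intro: carrier_gen torus_commute\<close>)
  next
    case 2
    show ?thesis
      unfolding x 2 twisted_antipode_def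
      by (rule serre_antihom_I[OF _ _ _ _ KF[OF P(1,1)] KF[OF P]
            KF[OF P(2,1), unfolded qp_commute[OF P(2,1)]] _
            twisted_antipode_F_cong[OF P(1), unfolded twisted_antipode_def]
            twisted_antipode_F_cong[OF P(2), unfolded twisted_antipode_def] serre[unfolded 2]])
        (use P in \<open>auto intro: carrier_gen torus_commute\<close>)
  qed
qed

lemma twisted_antipode_commutator_I:
  assumes "x \<in> commutator_relations P lq"
  shows "twisted_antipode c x \<in> I"
proof -
  from assms obtain \<alpha> \<beta> where P: "\<alpha> \<in> P" "\<beta> \<in> P"
    and x: "x = gen (E \<alpha>) * gen (F \<beta>) - gen (F \<beta>) * gen (E \<alpha>)
        - (if \<alpha> = \<beta> then kappa *\<^sub>C (gen (K \<alpha>) - gen (Kinv \<alpha>)) else 0)"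
    unfolding commutator_relations_def kappa_def scaleC_eq_scal by blast
  let ?e = "gen (E \<alpha>)" and ?f = "gen (F \<beta>)" and ?ki = "gen (Kinv \<alpha>)" and ?k = "gen (K \<beta>)"
  let ?T = "?k * ?ki" and ?m = "c \<alpha> * inverse (c \<beta>)" and ?r = "inverse (qp \<beta> \<beta>) * qp \<alpha> \<beta>"
  let ?d = "if \<alpha> = \<beta> then kappa *\<^sub>C (gen (K \<alpha>) - gen (Kinv \<alpha>)) else 0"
  have carr [simp]: "?e \<in> carrier R" "?f \<in> carrier R" "?ki \<in> carrier R" "?k \<in> carrier R"
    "gen (K \<alpha>) \<in> carrier R" "gen (Kinv \<beta>) \<in> carrier R"
    using P by (auto intro: carrier_gen)
  note closed = carr free_ring_closed free_ring_scaleC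
  have fe: "(?k * ?f) * (?e * ?ki) \<approx> ?r *\<^sub>C ((?f * ?e) * ?T)"
  proof -
    have "(?k * ?f) * (?e * ?ki) \<approx> (inverse (qp \<beta> \<beta>) *\<^sub>C (?f * ?k)) * (?e * ?ki)"
      by (intro cong_mult cong_refl KF P closed)
    also have "\<dots> = inverse (qp \<beta> \<beta>) *\<^sub>C (?f * (?k * ?e) * ?ki)"
      by (simp add: scaleC_simps mult.assoc)
    also have "\<dots> \<approx> inverse (qp \<beta> \<beta>) *\<^sub>C (?f * (qp \<beta> \<alpha> *\<^sub>C (?e * ?k)) * ?ki)"
      by (intro cong_scaleC cong_mult cong_refl KE P closed)
    finally show ?thesis
      by (simp add: scaleC_simps mult.assoc qp_commute[OF P(2,1)])
  qed
  have ef: "(?e * ?ki) * (?k * ?f) \<approx> ?r *\<^sub>C ((?e * ?f) * ?T)"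
  proof -
    have "(?e * ?ki) * (?k * ?f) \<approx> (?e * ?ki) * (inverse (qp \<beta> \<beta>) *\<^sub>C (?f * ?k))"
      by (intro cong_mult cong_refl KF P closed)
    also have "\<dots> = inverse (qp \<beta> \<beta>) *\<^sub>C (?e * (?ki * ?f) * ?k)"
      by (simp add: scaleC_simps mult.assoc)
    also have "\<dots> \<approx> inverse (qp \<beta> \<beta>) *\<^sub>C (?e * (qp \<alpha> \<beta> *\<^sub>C (?f * ?ki)) * ?k)"
      by (intro cong_scaleC cong_mult cong_refl KinvF P closed)
    also have "\<dots> = ?r *\<^sub>C ((?e * ?f) * (?ki * ?k))"
      by (simp add: scaleC_simps mult.assoc)
    also have "\<dots> \<approx> ?r *\<^sub>C ((?e * ?f) * ?T)"
      by (intro cong_scaleC cong_mult cong_refl torus_commute closed) (use P in auto)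
    finally show ?thesis .
  qed
  have pull: "a *\<^sub>C (b *\<^sub>C (p * t)) - a *\<^sub>C (b *\<^sub>C (r * t)) - s = (- (a * b)) *\<^sub>C ((r - p) * t) - s"
    for a b and p r s t :: "'r free_algebra"
    by (simp add: scaleC_scaleC cvec.scale_right_diff_distrib left_diff_distrib)
  have "twisted_antipode c x
    = ?m *\<^sub>C ((?k * ?f) * (?e * ?ki)) - ?m *\<^sub>C ((?e * ?ki) * (?k * ?f)) - twisted_antipode c ?d"
    unfolding x by (simp add: twisted_antipode_simps(2,6) twisted_antipode_gen scaleC_simps mult.commute)
  also have "\<dots> \<approx> ?m *\<^sub>C (?r *\<^sub>C ((?f * ?e) * ?T)) - ?m *\<^sub>C (?r *\<^sub>C ((?e * ?f) * ?T)) - twisted_antipode c ?d"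
    by (intro cong_diff cong_scaleC fe ef cong_refl twisted_antipode_carrier) (auto intro!: closed)
  also have "\<dots> = (- (?m * ?r)) *\<^sub>C ((?e * ?f - ?f * ?e) * ?T) - twisted_antipode c ?d"
    by (rule pull)
  also have "\<dots> \<approx> (- (?m * ?r)) *\<^sub>C (?d * ?T) - twisted_antipode c ?d"
    by (intro cong_diff cong_scaleC cong_mult EF_cong P cong_refl twisted_antipode_carrier) (auto intro!: closed)
  also have "\<dots> \<approx> 0"
  proof (cases "\<alpha> = \<beta>")
    case True
    have "?m * ?r = 1"
      using c True by simp
    then have "(- (?m * ?r)) *\<^sub>C (?d * ?T) - twisted_antipode c ?d
      = kappa *\<^sub>C (?ki * gen (K \<alpha>) * ?ki - gen (K \<alpha>) * (gen (K \<alpha>) * ?ki)) - kappa *\<^sub>C (?ki - gen (K \<alpha>))"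
      using True by (simp add: twisted_antipode_simps(2,7) twisted_antipode_gen scaleC_simps
          cvec.scale_right_diff_distrib left_diff_distrib mult.assoc)
    also have "\<dots> \<approx> kappa *\<^sub>C (1 * ?ki - gen (K \<alpha>) * 1) - kappa *\<^sub>C (?ki - gen (K \<alpha>))"
      by (intro cong_diff cong_scaleC cong_mult cong_refl Kinv_K K_Kinv P closed)
    finally show ?thesis by simp
  next
    case False
    then have "(- (?m * ?r)) *\<^sub>C (?d * ?T) - twisted_antipode c ?d = 0"
      by (simp only: if_False mult_zero_left cvec.scale_zero_right twisted_antipode_simps(3) diff_self)
    then show ?thesis
      using cong_refl[OF free_ring_zero] by simp
  qed
  finally show ?thesis
    by (simp add: cong_def)
qed

lemma twisted_antipode_I: "x \<in> I \<Longrightarrow> twisted_antipode c x \<in> I"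
  by (rule I_preserved)
    (auto simp: twisted_antipode_simps twisted_antipode_carrier twisted_antipode_torus_I
      twisted_antipode_weight_I twisted_antipode_commutator_I twisted_antipode_serre_I)

end

text \<open>
  The image of \<open>e\<^sub>\<alpha>\<close> under both maps is \<open>c d q\<^sup>h e\<^sub>\<alpha> q\<^sup>-\<^sup>h\<close>; moving the torus element past \<open>e\<^sub>\<alpha>\<close> produces the
  factor \<open>q\<^bsup>(\<alpha>, \<alpha>)\<^esup>\<close>, which explains the relation imposed on \<open>c\<close> and \<open>d\<close>.
\<close>

lemma twisted_antipode_inverse:
  assumes c: "\<And>\<alpha>. c \<alpha> \<noteq> 0" and cd: "\<And>\<alpha>. c \<alpha> * d \<alpha> * qp \<alpha> \<alpha> = 1" and p: "p \<in> carrier R"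
  shows "twisted_antipode d (twisted_antipode c p) \<approx> p"
  using p
proof (induction rule: free_ring_induct)
  case (scal a)
  show ?case by (simp add: twisted_antipode_simps cong_refl free_ring_closed)
next
  case (add p r)
  then show ?case by (simp add: twisted_antipode_simps cong_add)
next
  case (mult p r)
  then show ?case by (simp add: twisted_antipode_simps cong_mult)
next
  case (gen g)
  from gen consider (E) \<alpha> where "g = E \<alpha>" "\<alpha> \<in> P" | (F) \<alpha> where "g = F \<alpha>" "\<alpha> \<in> P"
    | (T) \<alpha> where "g = K \<alpha> \<or> g = Kinv \<alpha>" "\<alpha> \<in> P"
    by (auto simp: generators_def)
  then show ?case
  proof cases
    case E
    let ?e = "gen (E \<alpha>)" and ?k = "gen (K \<alpha>)" and ?ki = "gen (Kinv \<alpha>)"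
    have carr: "?e \<in> carrier R" "?k \<in> carrier R" "?ki \<in> carrier R"
      using E by (auto intro: carrier_gen)
    have "twisted_antipode d (twisted_antipode c ?e) = (c \<alpha> * d \<alpha>) *\<^sub>C ((?k * ?e) * ?ki)"
      by (simp add: twisted_antipode_gen twisted_antipode_simps(6,7) scaleC_simps mult.assoc del: cvec.scale_minus_left)
    also have "\<dots> \<approx> (c \<alpha> * d \<alpha>) *\<^sub>C ((qp \<alpha> \<alpha> *\<^sub>C (?e * ?k)) * ?ki)"
      by (intro cong_scaleC cong_mult cong_refl KE E carr)
    also have "\<dots> = (c \<alpha> * d \<alpha> * qp \<alpha> \<alpha>) *\<^sub>C (?e * (?k * ?ki))"
      by (simp add: scaleC_simps mult.assoc)
    also have "\<dots> \<approx> (c \<alpha> * d \<alpha> * qp \<alpha> \<alpha>) *\<^sub>C (?e * 1)"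
      by (intro cong_scaleC cong_mult cong_refl K_Kinv E carr)
    finally show ?thesis using E by (simp add: cd scaleC_one)
  next
    case F
    let ?f = "gen (F \<alpha>)" and ?k = "gen (K \<alpha>)" and ?ki = "gen (Kinv \<alpha>)"
    have carr: "?f \<in> carrier R" "?k \<in> carrier R" "?ki \<in> carrier R"
      using F by (auto intro: carrier_gen)
    have "inverse (c \<alpha>) * inverse (d \<alpha>) * inverse (qp \<alpha> \<alpha>) = inverse (c \<alpha> * d \<alpha> * qp \<alpha> \<alpha>)"
      by (simp add: mult.assoc)
    then have one: "inverse (c \<alpha>) * inverse (d \<alpha>) * inverse (qp \<alpha> \<alpha>) = 1"
      by (simp add: cd)
    have "twisted_antipode d (twisted_antipode c ?f) = (inverse (c \<alpha>) * inverse (d \<alpha>)) *\<^sub>C ((?k * ?f) * ?ki)"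
      by (simp add: twisted_antipode_gen twisted_antipode_simps(6,7) scaleC_simps mult.assoc del: cvec.scale_minus_left)
    also have "\<dots> \<approx> (inverse (c \<alpha>) * inverse (d \<alpha>)) *\<^sub>C ((inverse (qp \<alpha> \<alpha>) *\<^sub>C (?f * ?k)) * ?ki)"
      by (intro cong_scaleC cong_mult cong_refl KF F carr)
    also have "\<dots> = (inverse (c \<alpha>) * inverse (d \<alpha>) * inverse (qp \<alpha> \<alpha>)) *\<^sub>C (?f * (?k * ?ki))"
      by (simp add: scaleC_simps mult.assoc)
    also have "\<dots> \<approx> (inverse (c \<alpha>) * inverse (d \<alpha>) * inverse (qp \<alpha> \<alpha>)) *\<^sub>C (?f * 1)"
      by (intro cong_scaleC cong_mult cong_refl K_Kinv F carr)
    finally show ?thesis using F by (simp add: one scaleC_one)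
  next
    case T
    then show ?thesis
      by (auto simp: twisted_antipode_gen intro!: cong_refl carrier_gen)
  qed
qed

abbreviation sigma_rep :: "'r free_algebra \<Rightarrow> 'r free_algebra"
  where "sigma_rep \<equiv> free_hom (\<lambda>g. case g of
       E \<alpha> \<Rightarrow> gen (F \<alpha>)
     | F \<alpha> \<Rightarrow> gen (E \<alpha>)
     | K \<alpha> \<Rightarrow> gen (Kinv \<alpha>)
     | Kinv \<alpha> \<Rightarrow> gen (K \<alpha>))"

lemma sigma_rep_carrier: "p \<in> carrier R \<Longrightarrow> sigma_rep p \<in> carrier R"
  by (rule free_hom_carrier) (auto simp: generators_def intro!: carrier_gen)

lemma sigma_rep_serre:
  "sigma_rep (serre_element p n (gen (E \<alpha>)) (gen (E \<beta>)) scal) = serre_element p n (gen (F \<alpha>)) (gen (F \<beta>)) scal"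
  "sigma_rep (serre_element p n (gen (F \<alpha>)) (gen (F \<beta>)) scal) = serre_element p n (gen (E \<alpha>)) (gen (E \<beta>)) scal"
  by (simp_all add: serre_element_def free_hom_simps free_hom_sum free_hom_power)

lemma sigma_rep_relations: "x \<in> relations \<Longrightarrow> sigma_rep x \<in> I"
proof -
  note simps = free_hom_simps free_hom_scaleC
  assume "x \<in> relations"
  then consider "x \<in> torus_relations P" | "x \<in> weight_relations P ip lq"
    | "x \<in> commutator_relations P lq" | "x \<in> serre_relations P ip lq" by blast
  then show ?thesis
  proof cases
    case 1
    then consider (comm) g h where "x = gen g * gen h - gen h * gen g"
        "g \<in> K ` P \<union> Kinv ` P" "h \<in> K ` P \<union> Kinv ` P"
      | (inv) \<alpha> where "x = gen (K \<alpha>) * gen (Kinv \<alpha>) - 1" "\<alpha> \<in> P"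
      unfolding torus_relations_def by blast
    then show ?thesis
    proof cases
      case comm
      have "\<exists>g'. sigma_rep (gen g) = gen g' \<and> g' \<in> K ` P \<union> Kinv ` P"
        if "g \<in> K ` P \<union> Kinv ` P" for g
        using that by (auto simp: simps)
      then obtain g' h' where "sigma_rep (gen g) = gen g'" "g' \<in> K ` P \<union> Kinv ` P"
        "sigma_rep (gen h) = gen h'" "h' \<in> K ` P \<union> Kinv ` P"
        using comm by metis
      then show ?thesis
        using torus_commute[of g' h'] comm(1)
        by (simp add: free_hom_diff free_hom_mult cong_def del: free_hom_gen)
    next
      case inv
      then show ?thesis using Kinv_K[of \<alpha>] by (simp add: simps cong_def)
    qed
  next
    case 2
    have goal: "sigma_rep (gen g * gen h - scal \<chi> * gen h * gen g) \<in> I"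
      if "sigma_rep (gen g) * sigma_rep (gen h) \<approx> \<chi> *\<^sub>C (sigma_rep (gen h) * sigma_rep (gen g))" for g h \<chi>
      using that
      by (simp add: free_hom_diff free_hom_mult free_hom_scal cong_def scaleC_eq_scal mult.assoc)
    from 2 show ?thesis
    proof (cases rule: weight_relations_cases)
      case 1
      show ?thesis unfolding 1(3) by (rule goal) (simp add: free_hom_gen KinvF 1)
    next
      case 2
      show ?thesis unfolding 2(3) by (rule goal) (simp add: free_hom_gen KF 2)
    next
      case 3
      show ?thesis unfolding 3(3) by (rule goal) (simp add: free_hom_gen KinvE 3)
    next
      case 4
      show ?thesis unfolding 4(3) by (rule goal) (simp add: free_hom_gen KE 4)
    qed
  next
    case 3
    then obtain \<alpha> \<beta> where P: "\<alpha> \<in> P" "\<beta> \<in> P"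
      and x: "x = gen (E \<alpha>) * gen (F \<beta>) - gen (F \<beta>) * gen (E \<alpha>)
        - (if \<alpha> = \<beta> then kappa *\<^sub>C (gen (K \<alpha>) - gen (Kinv \<alpha>)) else 0)"
      unfolding commutator_relations_def kappa_def scaleC_eq_scal by blast
    have "sigma_rep x = - (gen (E \<beta>) * gen (F \<alpha>) - gen (F \<alpha>) * gen (E \<beta>)
        - (if \<beta> = \<alpha> then kappa *\<^sub>C (gen (K \<beta>) - gen (Kinv \<beta>)) else 0))"
      unfolding x by (simp add: simps cvec.scale_right_diff_distrib)
    also have "\<dots> \<in> I"
      using EF_cong[OF P(2,1)] by (intro I_uminus) (simp add: cong_def)
    finally show ?thesis .
  next
    case 4
    then show ?thesis
      unfolding serre_relations_def by (auto simp: sigma_rep_serre intro!: serre_I)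
  qed
qed

lemma sigma_rep_I: "x \<in> I \<Longrightarrow> sigma_rep x \<in> I"
  by (rule I_preserved) (auto simp: free_hom_add free_hom_mult sigma_rep_carrier sigma_rep_relations)

abbreviation "cl \<equiv> cls P ip lq"

lemma carrier_Uq: "carrier (Uq P ip lq) = cl ` carrier R"
  by (auto simp: Uq_def FactRing_def A_RCOSETS_def RCOSETS_def cls_def a_r_coset_def)

lemma cl_in_carrier: "p \<in> carrier R \<Longrightarrow> cl p \<in> carrier (Uq P ip lq)"
  by (auto simp: carrier_Uq)

lemma sigma_cl: "p \<in> carrier R \<Longrightarrow> sigma P ip lq (cl p) = cl (sigma_rep p)"
  unfolding sigma_def by (rule cls_image) (auto simp: free_hom_diff sigma_rep_carrier sigma_rep_I)

lemma antipode_cl: "p \<in> carrier R \<Longrightarrow> antipode P ip lq (cl p) = cl (twisted_antipode (\<lambda>_. 1) p)"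
proof -
  have "(\<lambda>g. case g of
       E \<alpha> \<Rightarrow> - gen (E \<alpha>) * gen (Kinv \<alpha>)
     | F \<alpha> \<Rightarrow> - gen (K \<alpha>) * gen (F \<alpha>)
     | K \<alpha> \<Rightarrow> gen (Kinv \<alpha>)
     | Kinv \<alpha> \<Rightarrow> gen (K \<alpha>)) = (\<lambda>g. case g of
       E \<alpha> \<Rightarrow> (- 1) *\<^sub>C (gen (E \<alpha>) * gen (Kinv \<alpha>))
     | F \<alpha> \<Rightarrow> (- inverse 1) *\<^sub>C (gen (K \<alpha>) * gen (F \<alpha>))
     | K \<alpha> \<Rightarrow> gen (Kinv \<alpha>)
     | Kinv \<alpha> \<Rightarrow> gen (K \<alpha>))"
    by (auto simp: fun_eq_iff scaleC_one split: generator.split)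
  then have eq: "free_antihom (\<lambda>g. case g of
       E \<alpha> \<Rightarrow> - gen (E \<alpha>) * gen (Kinv \<alpha>)
     | F \<alpha> \<Rightarrow> - gen (K \<alpha>) * gen (F \<alpha>)
     | K \<alpha> \<Rightarrow> gen (Kinv \<alpha>)
     | Kinv \<alpha> \<Rightarrow> gen (K \<alpha>)) = twisted_antipode (\<lambda>_. 1)"
    unfolding twisted_antipode_def by (rule arg_cong)
  assume "p \<in> carrier R"
  then show ?thesis
    unfolding antipode_def eq
    by (intro cls_image) (auto simp: twisted_antipode_simps twisted_antipode_carrier twisted_antipode_I)
qed

text \<open>
  The antipode is injective on classes since \<open>twisted_antipode_inverse\<close> gives it a left inverse, and the
  same map is a right inverse; the choice made by \<^const>\<open>inv_into\<close> is therefore forced.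
\<close>

lemma omega_cl:
  assumes p: "p \<in> carrier R"
  shows "omega P ip lq (cl p) = cl (twisted_antipode (\<lambda>\<alpha>. inverse (qp \<alpha> \<alpha>)) (sigma_rep p))"
proof -
  let ?d = "\<lambda>\<alpha>. inverse (qp \<alpha> \<alpha>)"
  let ?S = "twisted_antipode (\<lambda>_. 1)" and ?S' = "twisted_antipode ?d"
  note carr = twisted_antipode_carrier sigma_rep_carrier
  have S'S: "?S' (?S r) \<approx> r" and SS': "?S (?S' r) \<approx> r" if "r \<in> carrier R" for r
    using that by (auto intro!: twisted_antipode_inverse)
  have inj: "inj_on (antipode P ip lq) (carrier (Uq P ip lq))"
  proof (rule inj_onI)
    fix X Y
    assume "X \<in> carrier (Uq P ip lq)" "Y \<in> carrier (Uq P ip lq)"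
      and eq: "antipode P ip lq X = antipode P ip lq Y"
    then obtain r s where r: "r \<in> carrier R" "X = cl r" and s: "s \<in> carrier R" "Y = cl s"
      by (auto simp: carrier_Uq)
    then have "?S r - ?S s \<in> I"
      using eq carr by (simp add: antipode_cl cls_eq_iff cong_def)
    then have "?S' (?S r - ?S s) \<in> I"
      by (intro twisted_antipode_I) auto
    then have "?S' (?S r) \<approx> ?S' (?S s)"
      using r s carr by (simp add: cong_def twisted_antipode_simps)
    then have "r \<approx> s"
      using S'S r s by (meson cong_sym cong_trans)
    then show "X = Y"
      using r s by (simp add: cls_eq_iff)
  qed
  have "antipode P ip lq (cl (?S' (sigma_rep p))) = cl (sigma_rep p)"
    using p carr SS' by (simp add: antipode_cl cls_eq_iff)
  moreover have "inv_into (carrier (Uq P ip lq)) (antipode P ip lq) (antipode P ip lq (cl (?S' (sigma_rep p))))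
      = cl (?S' (sigma_rep p))"
    by (rule inv_into_f_f[OF inj]) (intro cl_in_carrier carr p)
  ultimately show ?thesis
    by (simp only: omega_def sigma_cl[OF p])
qed

lemma omega_gen:
  assumes "\<alpha> \<in> P"
  shows "omega P ip lq (cl (gen (E \<alpha>))) = cl (- (gen (F \<alpha>) * gen (K \<alpha>)))"
    and "omega P ip lq (cl (gen (K \<alpha>))) = cl (gen (K \<alpha>))"
proof -
  have carr: "gen (E \<alpha>) \<in> carrier R" "gen (F \<alpha>) \<in> carrier R" "gen (K \<alpha>) \<in> carrier R"
    using assms by (auto intro: carrier_gen)
  have "twisted_antipode (\<lambda>\<alpha>. inverse (qp \<alpha> \<alpha>)) (gen (F \<alpha>)) \<approx> - (gen (F \<alpha>) * gen (K \<alpha>))"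
    using twisted_antipode_F_cong[OF _ assms, of "\<lambda>\<alpha>. inverse (qp \<alpha> \<alpha>)"] by (simp add: scaleC_one)
  then show "omega P ip lq (cl (gen (E \<alpha>))) = cl (- (gen (F \<alpha>) * gen (K \<alpha>)))"
    using carr by (simp add: omega_cl free_hom_gen cls_eq_iff cong_carrier)
  show "omega P ip lq (cl (gen (K \<alpha>))) = cl (gen (K \<alpha>))"
    using carr by (simp add: omega_cl free_hom_gen twisted_antipode_gen)
qed

end

section \<open>Bilinear forms\<close>

lemma bilinear_simps:
  assumes "bilinear_form B"
  shows "B (x + y) z = B x z + B y z" "B x (y + z) = B x y + B x z"
    "B (c *\<^sub>C x) z = c * B x z" "B x (c *\<^sub>C z) = c * B x z"
    "B 0 z = 0" "B x 0 = 0" "B (x - y) z = B x z - B y z" "B x (y - z) = B x y - B x z"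
    "B (- x) z = - B x z" "B x (- z) = - B x z"
proof -
  have lin: "clinear (B u)" "clinear (\<lambda>v. B v u)" for u
    using assms by (simp_all add: bilinear_form_def)
  interpret l: Vector_Spaces.linear scaleC scaleC "B x" by (rule lin)
  interpret r: Vector_Spaces.linear scaleC scaleC "\<lambda>v. B v z" by (rule lin)
  show "B (x + y) z = B x z + B y z" "B x (y + z) = B x y + B x z"
    "B 0 z = 0" "B x 0 = 0" "B (x - y) z = B x z - B y z" "B x (y - z) = B x y - B x z"
    "B (- x) z = - B x z" "B x (- z) = - B x z"
    by (simp_all only: l.add r.add l.zero r.zero l.diff r.diff l.neg r.neg)
  show "B (c *\<^sub>C x) z = c * B x z" "B x (c *\<^sub>C z) = c * B x z"
    using l.scale r.scale by (simp_all add: scaleC_complex_def)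
qed

lemma bilinear_sum:
  assumes "bilinear_form B"
  shows "B (sum h A) z = (\<Sum>i\<in>A. B (h i) z)" "B z (sum h A) = (\<Sum>i\<in>A. B z (h i))"
  by (induction A rule: infinite_finite_induct) (simp_all add: bilinear_simps[OF assms])

lemma bilinear_zero_on_span:
  assumes "bilinear_form B" "\<And>y. y \<in> S \<Longrightarrow> B x y = 0" "y \<in> cvec.span S"
  shows "B x y = 0"
  using assms(3)
  by (induction rule: cvec.span_induct_alt) (simp_all add: bilinear_simps[OF assms(1)] assms(2))

text \<open>
  This replaces a dimension count: a proper subspace of a finite-dimensional subspace has a non-zero
  vector orthogonal to it, although the ambient space may have infinite dimension. Adding a vector \<open>t\<close>
  to \<open>T\<close>, the induction hypothesis is applied once to \<open>t\<close> and once to \<open>x\<close> corrected by a multiple of \<open>t\<close>, and the two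
  separating vectors are combined.
\<close>

lemma separating_vector:
  fixes B :: "'m::complex_vector \<Rightarrow> 'm \<Rightarrow> complex"
  assumes B: "bilinear_form B" and nondeg: "\<And>x. x \<noteq> 0 \<Longrightarrow> \<exists>y. B y x \<noteq> 0"
    and "finite T" "x \<notin> cvec.span T"
  shows "\<exists>y. (\<forall>t\<in>T. B y t = 0) \<and> B y x \<noteq> 0"
  using assms(3,4)
proof (induction T arbitrary: x)
  case empty
  then show ?case using nondeg by (simp add: cvec.span_empty)
next
  case (insert t T)
  note lin = bilinear_simps[OF B]
  show ?case
  proof (cases "t \<in> cvec.span T")
    case True
    from insert obtain y where y: "\<forall>t\<in>T. B y t = 0" "B y x \<noteq> 0"
      using True by (metis cvec.span_redundant)
    have "B y z = 0" if "z \<in> cvec.span T" for z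
      by (rule bilinear_zero_on_span[OF B _ that]) (use y(1) in blast)
    then show ?thesis using y True by auto
  next
    case False
    then obtain s where s: "\<forall>t\<in>T. B s t = 0" "B s t \<noteq> 0"
      using insert.IH by blast
    let ?c = "B s x / B s t"
    have "x - ?c *\<^sub>C t \<notin> cvec.span T"
    proof
      assume "x - ?c *\<^sub>C t \<in> cvec.span T"
      then have "x \<in> cvec.span (insert t T)"
        by (auto simp: cvec.span_insert)
      with insert.prems show False by blast
    qed
    then obtain y where y: "\<forall>t\<in>T. B y t = 0" "B y (x - ?c *\<^sub>C t) \<noteq> 0"
      using insert.IH by blast
    let ?y = "y - (B y t / B s t) *\<^sub>C s"
    have "\<forall>t'\<in>insert t T. B ?y t' = 0"
      using s y(1) by (auto simp: lin)
    moreover have "B ?y x \<noteq> 0"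
      using y(2) s(2) by (simp add: lin mult.commute)
    ultimately show ?thesis by blast
  qed
qed

section \<open>Operators satisfying the quantum group relations\<close>

text \<open>
  These are the relations that control how vectors generate submodules: they allow words in the
  generators to be reordered.
\<close>

locale quantum_operators =
  fixes P :: "'r set" and qp :: "'r \<Rightarrow> 'r \<Rightarrow> complex" and kappa :: complex
    and X :: "'r generator \<Rightarrow> 'm::complex_vector \<Rightarrow> 'm"
  assumes X_linear: "g \<in> generators P \<Longrightarrow> clinear (X g)"
    and K_Kinv: "\<alpha> \<in> P \<Longrightarrow> X (K \<alpha>) (X (Kinv \<alpha>) x) = x"
    and Kinv_K: "\<alpha> \<in> P \<Longrightarrow> X (Kinv \<alpha>) (X (K \<alpha>) x) = x"
    and KE: "\<alpha> \<in> P \<Longrightarrow> \<beta> \<in> P \<Longrightarrow> X (K \<alpha>) (X (E \<beta>) x) = qp \<alpha> \<beta> *\<^sub>C X (E \<beta>) (X (K \<alpha>) x)"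
    and KF: "\<alpha> \<in> P \<Longrightarrow> \<beta> \<in> P \<Longrightarrow> X (K \<alpha>) (X (F \<beta>) x) = inverse (qp \<alpha> \<beta>) *\<^sub>C X (F \<beta>) (X (K \<alpha>) x)"
    and EF: "\<alpha> \<in> P \<Longrightarrow> \<beta> \<in> P \<Longrightarrow> X (E \<alpha>) (X (F \<beta>) x) = X (F \<beta>) (X (E \<alpha>) x)
        + (if \<alpha> = \<beta> then kappa *\<^sub>C (X (K \<alpha>) x - X (Kinv \<alpha>) x) else 0)"
    and qp_nonzero [simp]: "qp \<alpha> \<beta> \<noteq> 0"
begin

lemma X_simps:
  assumes "g \<in> generators P"
  shows "X g (x + y) = X g x + X g y" "X g (c *\<^sub>C x) = c *\<^sub>C X g x" "X g 0 = 0"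
    "X g (x - y) = X g x - X g y" "X g (- x) = - X g x"
proof -
  interpret Vector_Spaces.linear scaleC scaleC "X g" by (rule X_linear[OF assms])
  show "X g (x + y) = X g x + X g y" "X g (c *\<^sub>C x) = c *\<^sub>C X g x" "X g 0 = 0"
    "X g (x - y) = X g x - X g y" "X g (- x) = - X g x"
    by (simp_all only: add scale zero diff neg)
qed

lemma KinvE:
  assumes "\<alpha> \<in> P" "\<beta> \<in> P"
  shows "X (Kinv \<alpha>) (X (E \<beta>) x) = inverse (qp \<alpha> \<beta>) *\<^sub>C X (E \<beta>) (X (Kinv \<alpha>) x)"
proof -
  have "X (Kinv \<alpha>) (X (E \<beta>) x) = X (Kinv \<alpha>) (X (E \<beta>) (X (K \<alpha>) (X (Kinv \<alpha>) x)))"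
    using assms by (simp add: K_Kinv)
  also have "X (E \<beta>) (X (K \<alpha>) (X (Kinv \<alpha>) x)) = inverse (qp \<alpha> \<beta>) *\<^sub>C X (K \<alpha>) (X (E \<beta>) (X (Kinv \<alpha>) x))"
    using assms by (simp add: KE scaleC_scaleC scaleC_one)
  finally show ?thesis
    using assms by (simp add: X_simps Kinv_K)
qed

lemma KinvF:
  assumes "\<alpha> \<in> P" "\<beta> \<in> P"
  shows "X (Kinv \<alpha>) (X (F \<beta>) x) = qp \<alpha> \<beta> *\<^sub>C X (F \<beta>) (X (Kinv \<alpha>) x)"
proof -
  have "X (Kinv \<alpha>) (X (F \<beta>) x) = X (Kinv \<alpha>) (X (F \<beta>) (X (K \<alpha>) (X (Kinv \<alpha>) x)))"
    using assms by (simp add: K_Kinv)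
  also have "X (F \<beta>) (X (K \<alpha>) (X (Kinv \<alpha>) x)) = qp \<alpha> \<beta> *\<^sub>C X (K \<alpha>) (X (F \<beta>) (X (Kinv \<alpha>) x))"
    using assms by (simp add: KF scaleC_scaleC scaleC_one)
  finally show ?thesis
    using assms by (simp add: X_simps Kinv_K)
qed

definition invariant :: "'m set \<Rightarrow> bool"
  where "invariant N \<longleftrightarrow> cvec.subspace N \<and> (\<forall>g\<in>generators P. \<forall>x\<in>N. X g x \<in> N)"

definition simple :: "'m set \<Rightarrow> bool"
  where "simple N \<longleftrightarrow> invariant N \<and> N \<noteq> {0} \<and> (\<forall>M. invariant M \<and> M \<subseteq> N \<longrightarrow> M = {0} \<or> M = N)"

definition semisimple :: bool
  where "semisimple \<longleftrightarrow> (\<exists>\<S>. (\<forall>S\<in>\<S>. simple S) \<and> cvec.span (\<Union>\<S>) = UNIV \<and>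
     (\<forall>S\<in>\<S>. S \<inter> cvec.span (\<Union>(\<S> - {S})) = {0}))"

text \<open>
  The space \<open>M\<^sup>+\<close>. For a tensor product of highest weight modules it is spanned by weight vectors, that
  is, by singular vectors.
\<close>

definition extremal :: "'m set"
  where "extremal = {x. \<forall>\<alpha>\<in>P. X (E \<alpha>) x = 0}"

definition F_image :: "'m set"
  where "F_image = cvec.span {X (F \<alpha>) x | \<alpha> x. \<alpha> \<in> P}"

definition torus_stable :: "'m set \<Rightarrow> bool"
  where "torus_stable W \<longleftrightarrow> cvec.subspace W \<and> (\<forall>\<alpha>\<in>P. \<forall>x\<in>W. X (K \<alpha>) x \<in> W \<and> X (Kinv \<alpha>) x \<in> W)"

inductive_set F_closure :: "'m set \<Rightarrow> 'm set" for W
  where base: "x \<in> W \<Longrightarrow> x \<in> F_closure W"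
  | zero: "0 \<in> F_closure W"
  | add: "x \<in> F_closure W \<Longrightarrow> y \<in> F_closure W \<Longrightarrow> x + y \<in> F_closure W"
  | scale: "x \<in> F_closure W \<Longrightarrow> c *\<^sub>C x \<in> F_closure W"
  | F: "x \<in> F_closure W \<Longrightarrow> \<alpha> \<in> P \<Longrightarrow> X (F \<alpha>) x \<in> F_closure W"

lemma invariant_subspace: "invariant N \<Longrightarrow> cvec.subspace N"
  by (simp add: invariant_def)

lemma invariant_X: "invariant N \<Longrightarrow> g \<in> generators P \<Longrightarrow> x \<in> N \<Longrightarrow> X g x \<in> N"
  by (simp add: invariant_def)

lemma invariantI:
  assumes "cvec.subspace N" "\<And>\<alpha> x. \<alpha> \<in> P \<Longrightarrow> x \<in> N \<Longrightarrow> X (E \<alpha>) x \<in> N"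
    "\<And>\<alpha> x. \<alpha> \<in> P \<Longrightarrow> x \<in> N \<Longrightarrow> X (F \<alpha>) x \<in> N" "\<And>\<alpha> x. \<alpha> \<in> P \<Longrightarrow> x \<in> N \<Longrightarrow> X (K \<alpha>) x \<in> N"
    "\<And>\<alpha> x. \<alpha> \<in> P \<Longrightarrow> x \<in> N \<Longrightarrow> X (Kinv \<alpha>) x \<in> N"
  shows "invariant N"
  using assms by (auto simp: invariant_def generators_def)

lemma F_closure_subspace: "cvec.subspace (F_closure W)"
  by (auto simp: cvec.subspace_def intro: F_closure.intros)

lemma F_closure_minimal:
  assumes "W \<subseteq> N" "invariant N" shows "F_closure W \<subseteq> N"
proof
  note N = invariant_subspace[OF assms(2)]
  fix x assume "x \<in> F_closure W"
  then show "x \<in> N"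
  proof induction
    case (F x \<alpha>)
    then show ?case by (intro invariant_X[OF assms(2)]) simp_all
  qed (use assms(1) in \<open>auto intro: cvec.subspace_0[OF N] cvec.subspace_add[OF N] cvec.subspace_scale[OF N]\<close>)
qed

text \<open>
  The triangular decomposition in the form needed here: a relation \<open>e\<^sub>\<alpha> f\<^sub>\<beta> = f\<^sub>\<beta> e\<^sub>\<alpha> + \<dots>\<close> moves \<open>e\<^sub>\<alpha>\<close> to the
  right until it meets \<open>W\<close>, and the correction terms lie in the torus, which preserves the closure.
\<close>

lemma F_closure_invariant:
  assumes W: "torus_stable W" and ker: "W \<subseteq> extremal"
  shows "invariant (F_closure W)"
proof -
  have torus: "X (K \<alpha>) x \<in> F_closure W \<and> X (Kinv \<alpha>) x \<in> F_closure W"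
    if "x \<in> F_closure W" "\<alpha> \<in> P" for x \<alpha>
    using that
  proof induction
    case (base x)
    then show ?case using W by (auto simp: torus_stable_def intro: F_closure.base)
  qed (auto simp: X_simps KF KinvF intro: F_closure.intros)
  have "X (E \<alpha>) x \<in> F_closure W" if "x \<in> F_closure W" "\<alpha> \<in> P" for x \<alpha>
    using that
  proof induction
    case (base x)
    then have "X (E \<alpha>) x = 0" using ker unfolding extremal_def by blast
    then show ?case by (simp add: F_closure.zero)
  next
    case (F x \<beta>)
    then show ?case
      using torus by (auto simp: EF intro!: F_closure.add F_closure.F F_closure.scale
          cvec.subspace_diff[OF F_closure_subspace])
  qed (auto simp: X_simps intro: F_closure.intros)
  then show ?thesis
    using torus by (intro invariantI F_closure_subspace) (auto intro: F_closure.F)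
qed

lemma F_closure_mod_F_image:
  assumes "cvec.subspace W" "x \<in> F_closure W"
  shows "\<exists>w\<in>W. x - w \<in> F_image"
  using assms(2)
proof induction
  case (base x)
  then show ?case by (intro bexI[of _ x]) (simp_all add: F_image_def cvec.span_zero)
next
  case zero
  then show ?case
    using cvec.subspace_0[OF assms(1)] by (intro bexI[of _ 0]) (simp_all add: F_image_def cvec.span_zero)
next
  case (add x y)
  then obtain w w' where "w \<in> W" "x - w \<in> F_image" "w' \<in> W" "y - w' \<in> F_image" by blast
  then have "w + w' \<in> W" "(x + y) - (w + w') \<in> F_image"
    using cvec.subspace_add[OF assms(1)] cvec.span_add[of "x - w" _ "y - w'"]
    by (simp_all add: F_image_def add_diff_add)
  then show ?case by blast
next
  case (scale x c)
  then obtain w where "w \<in> W" "x - w \<in> F_image" by blast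
  then have "c *\<^sub>C w \<in> W" "c *\<^sub>C x - c *\<^sub>C w \<in> F_image"
    using cvec.subspace_scale[OF assms(1)] cvec.span_scale[of "x - w" _ c]
    by (simp_all add: F_image_def cvec.scale_right_diff_distrib)
  then show ?case by blast
next
  case (F x \<alpha>)
  then have "X (F \<alpha>) x \<in> F_image"
    unfolding F_image_def by (intro cvec.span_base) blast
  then show ?case
    using cvec.subspace_0[OF assms(1)] by (intro bexI[of _ 0]) simp_all
qed

lemma extremal_torus_stable:
  assumes "invariant N" shows "torus_stable (N \<inter> extremal)"
proof -
  have "cvec.subspace extremal"
    by (auto simp: cvec.subspace_def extremal_def X_simps)
  moreover have "X (K \<alpha>) x \<in> extremal" "X (Kinv \<alpha>) x \<in> extremal" if "x \<in> extremal" "\<alpha> \<in> P" for x \<alpha>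
  proof -
    have "qp \<alpha> \<beta> *\<^sub>C X (E \<beta>) (X (K \<alpha>) x) = 0" "inverse (qp \<alpha> \<beta>) *\<^sub>C X (E \<beta>) (X (Kinv \<alpha>) x) = 0"
      if \<beta>: "\<beta> \<in> P" for \<beta>
    proof -
      have "X (E \<beta>) x = 0"
        using \<open>x \<in> extremal\<close> \<beta> by (simp add: extremal_def)
      then show "qp \<alpha> \<beta> *\<^sub>C X (E \<beta>) (X (K \<alpha>) x) = 0" "inverse (qp \<alpha> \<beta>) *\<^sub>C X (E \<beta>) (X (Kinv \<alpha>) x) = 0"
        using KE[OF \<open>\<alpha> \<in> P\<close> \<beta>, of x] KinvE[OF \<open>\<alpha> \<in> P\<close> \<beta>, of x] \<open>\<alpha> \<in> P\<close> by (simp_all add: X_simps)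
    qed
    then show "X (K \<alpha>) x \<in> extremal" "X (Kinv \<alpha>) x \<in> extremal"
      by (simp_all add: extremal_def cvec.scale_eq_0_iff)
  qed
  ultimately show ?thesis
    using assms by (auto simp: torus_stable_def invariant_def intro: cvec.subspace_inter)
qed

lemma invariant_UNIV: "invariant UNIV"
  by (simp add: invariant_def cvec.subspace_UNIV)

lemma extremal_subspace: "cvec.subspace extremal"
  using extremal_torus_stable[OF invariant_UNIV] by (simp add: torus_stable_def)

lemma span_image_subset:
  assumes "g \<in> generators P" "\<And>x. x \<in> S \<Longrightarrow> X g x \<in> cvec.span T" "x \<in> cvec.span S"
  shows "X g x \<in> cvec.span T"
  using assms(3)
  by (induction rule: cvec.span_induct_alt)
    (simp_all add: X_simps assms(1,2) cvec.span_zero cvec.span_add cvec.span_scale)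

lemma span_invariant:
  assumes "\<And>g x. g \<in> generators P \<Longrightarrow> x \<in> S \<Longrightarrow> X g x \<in> cvec.span S"
  shows "invariant (cvec.span S)"
  unfolding invariant_def
proof (intro conjI ballI)
  show "X g x \<in> cvec.span S" if "g \<in> generators P" "x \<in> cvec.span S" for g x
    by (rule span_image_subset[OF that(1) assms[OF that(1)] that(2)])
qed simp

lemma span_Union_invariant:
  assumes "\<And>N. N \<in> \<N> \<Longrightarrow> invariant N"
  shows "invariant (cvec.span (\<Union>\<N>))"
  by (rule span_invariant) (use assms in \<open>auto intro: cvec.span_base dest: invariant_X\<close>)

end

section \<open>Graded modules with a contravariant form\<close>

locale contravariant_operators = quantum_operators P qp kappa X
  for P :: "'r set" and qp kappa and X :: "'r generator \<Rightarrow> 'm::complex_vector \<Rightarrow> 'm" +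
  fixes B :: "'m \<Rightarrow> 'm \<Rightarrow> complex"
  assumes bilinear: "bilinear_form B" and symmetric: "B x y = B y x"
    and contravariant_E: "\<alpha> \<in> P \<Longrightarrow> B (X (E \<alpha>) x) y = - B x (X (F \<alpha>) (X (K \<alpha>) y))"
    and contravariant_K: "\<alpha> \<in> P \<Longrightarrow> B (X (K \<alpha>) x) y = B x (X (K \<alpha>) y)"
begin

lemmas B_simps = bilinear_simps[OF bilinear]
lemmas B_sum = bilinear_sum[OF bilinear]

lemma contravariant_Kinv: "\<alpha> \<in> P \<Longrightarrow> B (X (Kinv \<alpha>) x) y = B x (X (Kinv \<alpha>) y)"
  using contravariant_K[of \<alpha> "X (Kinv \<alpha>) x" "X (Kinv \<alpha>) y"] by (simp add: K_Kinv)

text \<open>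
  This is the formula for \<open>e\<^sub>\<alpha>\<close> read backwards by symmetry, with \<open>q\<^sup>h\<close> moved to the other side.
\<close>

lemma contravariant_F: "\<alpha> \<in> P \<Longrightarrow> B (X (F \<alpha>) x) y = - B x (X (Kinv \<alpha>) (X (E \<alpha>) y))"
proof -
  assume \<alpha>: "\<alpha> \<in> P"
  have "B (X (E \<alpha>) y) (X (Kinv \<alpha>) x) = - B y (X (F \<alpha>) x)"
    using \<alpha> by (simp add: contravariant_E K_Kinv)
  then show ?thesis
    using \<alpha> by (metis contravariant_Kinv minus_equation_iff symmetric)
qed

lemma extremal_orthogonal_F_image:
  assumes "u \<in> extremal" "y \<in> F_image" shows "B u y = 0"
  using assms(2) unfolding F_image_def
proof (rule bilinear_zero_on_span[OF bilinear, rotated])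
  fix y assume "y \<in> {X (F \<alpha>) x | \<alpha> x. \<alpha> \<in> P}"
  then show "B u y = 0"
    using assms(1) by (subst symmetric) (auto simp: contravariant_F extremal_def X_simps B_simps)
qed

lemma orthogonal_complement_invariant:
  assumes "invariant N"
  shows "invariant {x. \<forall>y\<in>N. B x y = 0}"
  by (rule invariantI)
    (use assms in \<open>auto simp: cvec.subspace_def B_simps contravariant_E contravariant_F
      contravariant_K contravariant_Kinv invariant_X\<close>)

end

text \<open>
  Degrees are multisets of simple roots, with \<open>\<beta>\<close> standing for the weight \<open>\<lambda> - \<Sum>\<beta>\<close>. Orthogonality of the
  components and non-degeneracy make the grading direct, even if the torus should act by the same
  character in two degrees.
\<close>

locale graded_contravariant = contravariant_operators P qp kappa X B
  for P :: "'r set" and qp kappa and X :: "'r generator \<Rightarrow> 'm::complex_vector \<Rightarrow> 'm" and B +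
  fixes G :: "'r multiset \<Rightarrow> 'm set" and wt :: "'r \<Rightarrow> 'r multiset \<Rightarrow> complex"
  assumes nondegenerate: "(\<And>y. B x y = 0) \<Longrightarrow> x = 0"
    and G_finite_dim: "\<exists>S. finite S \<and> G \<beta> = cvec.span S"
    and G_total: "cvec.span (\<Union>\<beta>. G \<beta>) = UNIV"
    and E_G: "\<alpha> \<in> P \<Longrightarrow> x \<in> G (add_mset \<alpha> \<beta>) \<Longrightarrow> X (E \<alpha>) x \<in> G \<beta>"
    and E_G_zero: "\<alpha> \<in> P \<Longrightarrow> x \<in> G \<beta> \<Longrightarrow> \<alpha> \<notin># \<beta> \<Longrightarrow> X (E \<alpha>) x = 0"
    and F_G: "\<alpha> \<in> P \<Longrightarrow> x \<in> G \<beta> \<Longrightarrow> X (F \<alpha>) x \<in> G (add_mset \<alpha> \<beta>)"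
    and K_G: "\<alpha> \<in> P \<Longrightarrow> x \<in> G \<beta> \<Longrightarrow> X (K \<alpha>) x = wt \<alpha> \<beta> *\<^sub>C x"
    and orthogonal: "x \<in> G \<beta> \<Longrightarrow> y \<in> G \<gamma> \<Longrightarrow> \<beta> \<noteq> \<gamma> \<Longrightarrow> B x y = 0"
begin

lemma G_subspace: "cvec.subspace (G \<beta>)"
  using G_finite_dim[of \<beta>] by auto

lemma Kinv_G: "\<alpha> \<in> P \<Longrightarrow> x \<in> G \<beta> \<Longrightarrow> X (Kinv \<alpha>) x = inverse (wt \<alpha> \<beta>) *\<^sub>C x"
  using Kinv_K[of \<alpha> x] K_G[of \<alpha> x \<beta>]
  by (cases "wt \<alpha> \<beta> = 0") (auto simp: X_simps scaleC_scaleC scaleC_one dest: arg_cong[where f = "scaleC (inverse (wt \<alpha> \<beta>))"])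

lemma zero_if_orthogonal_to_graded:
  assumes "\<And>\<beta> y. y \<in> G \<beta> \<Longrightarrow> B x y = 0" shows "x = 0"
  by (rule nondegenerate, rule bilinear_zero_on_span[OF bilinear, of "\<Union>\<beta>. G \<beta>"])
    (auto simp: G_total assms)

lemma graded_sum:
  "\<exists>A c. finite A \<and> x = (\<Sum>\<beta>\<in>A. c \<beta>) \<and> (\<forall>\<beta>. c \<beta> \<in> G \<beta>) \<and> (\<forall>\<beta>. \<beta> \<notin> A \<longrightarrow> c \<beta> = 0)"
proof -
  have "x \<in> cvec.span (\<Union>\<beta>. G \<beta>)"
    by (simp add: G_total)
  then show ?thesis
  proof (induction rule: cvec.span_induct_alt)
    case base
    show ?case
      using cvec.subspace_0[OF G_subspace] by (intro exI[of _ "{}"] exI[of _ "\<lambda>_. 0"]) simp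
  next
    case (step a x y)
    then obtain \<gamma> A c where x: "x \<in> G \<gamma>" and A: "finite A" "y = (\<Sum>\<beta>\<in>A. c \<beta>)"
      "\<And>\<beta>. c \<beta> \<in> G \<beta>" "\<And>\<beta>. \<beta> \<notin> A \<Longrightarrow> c \<beta> = 0" by blast
    let ?c = "\<lambda>\<beta>. (if \<beta> = \<gamma> then a *\<^sub>C x else 0) + c \<beta>"
    have "a *\<^sub>C x + y = (\<Sum>\<beta>\<in>insert \<gamma> A. ?c \<beta>)"
    proof -
      have "(\<Sum>\<beta>\<in>insert \<gamma> A. c \<beta>) = y"
        using A by (cases "\<gamma> \<in> A") (simp_all add: insert_absorb)
      then show ?thesis
        using A(1) by (simp add: sum.distrib)
    qed
    moreover have "\<forall>\<beta>. ?c \<beta> \<in> G \<beta>"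
      using x A(3) G_subspace by (auto intro: cvec.subspace_add cvec.subspace_scale)
    ultimately show ?case
      using A(1,4) by (intro exI[of _ "insert \<gamma> A"] exI[of _ ?c]) auto
  qed
qed

lemma graded_sum_form:
  assumes "finite A" "\<And>\<beta>. c \<beta> \<in> G \<beta>" "\<And>\<beta>. \<beta> \<notin> A \<Longrightarrow> c \<beta> = 0" "z \<in> G \<gamma>"
  shows "B (\<Sum>\<beta>\<in>A. c \<beta>) z = B (c \<gamma>) z"
proof -
  have "B (\<Sum>\<beta>\<in>A. c \<beta>) z = (\<Sum>\<beta>\<in>A. if \<beta> = \<gamma> then B (c \<gamma>) z else 0)"
    unfolding B_sum
  proof (rule sum.cong)
    fix \<beta>
    show "B (c \<beta>) z = (if \<beta> = \<gamma> then B (c \<gamma>) z else 0)"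
      using orthogonal[OF assms(2)[of \<beta>] assms(4)] by simp
  qed simp
  also have "\<dots> = B (c \<gamma>) z"
    using assms(1,3) by (auto simp: B_simps)
  finally show ?thesis .
qed

text \<open>
  The component of \<open>x\<close> in degree \<open>\<beta>\<close>, characterised by its pairing with that degree.
\<close>

lemma graded_component: "\<exists>y\<in>G \<beta>. \<forall>z\<in>G \<beta>. B y z = B x z"
proof -
  obtain A c where A: "finite A" "x = (\<Sum>\<beta>\<in>A. c \<beta>)" "\<And>\<beta>. c \<beta> \<in> G \<beta>" "\<And>\<beta>. \<beta> \<notin> A \<Longrightarrow> c \<beta> = 0"
    using graded_sum[of x] by blast
  then have "\<forall>z\<in>G \<beta>. B (c \<beta>) z = B x z"
    using graded_sum_form[of A c] by simp
  then show ?thesis using A(3) by blast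
qed

text \<open>
  By contravariance, \<open>e\<^sub>\<alpha> y\<close> pairs with a homogeneous \<open>z\<close> as \<open>y\<close> does with \<open>- f\<^sub>\<alpha> q\<^sup>h z\<close>, and in degree \<open>\<beta>\<close> the
  vectors \<open>y\<close> and \<open>x\<close> have the same pairings.
\<close>

lemma component_extremal:
  assumes x: "x \<in> extremal" and y: "y \<in> G \<beta>" and eq: "\<And>z. z \<in> G \<beta> \<Longrightarrow> B y z = B x z"
  shows "y \<in> extremal"
  unfolding extremal_def
proof (intro CollectI ballI zero_if_orthogonal_to_graded)
  fix \<alpha> \<gamma> z assume \<alpha>: "\<alpha> \<in> P" and z: "z \<in> G \<gamma>"
  have FKz: "X (F \<alpha>) (X (K \<alpha>) z) \<in> G (add_mset \<alpha> \<gamma>)"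
    using \<alpha> z K_G by (auto intro!: F_G cvec.subspace_scale[OF G_subspace])
  show "B (X (E \<alpha>) y) z = 0"
  proof (cases "add_mset \<alpha> \<gamma> = \<beta>")
    case True
    then have "B (X (E \<alpha>) y) z = B (X (E \<alpha>) x) z"
      using \<alpha> eq FKz by (simp add: contravariant_E)
    then show ?thesis
      using x \<alpha> by (simp add: extremal_def B_simps)
  next
    case False
    then show ?thesis
      using \<alpha> orthogonal[OF y FKz] by (simp add: contravariant_E)
  qed
qed

lemma extremal_graded_span: "extremal = cvec.span {x \<in> extremal. \<exists>\<beta>. x \<in> G \<beta>}"
proof
  show "cvec.span {x \<in> extremal. \<exists>\<beta>. x \<in> G \<beta>} \<subseteq> extremal"
    by (rule cvec.span_minimal) (auto simp: extremal_subspace)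
  show "extremal \<subseteq> cvec.span {x \<in> extremal. \<exists>\<beta>. x \<in> G \<beta>}"
  proof
    fix x assume x: "x \<in> extremal"
    obtain A c where A: "finite A" "x = (\<Sum>\<beta>\<in>A. c \<beta>)" "\<And>\<beta>. c \<beta> \<in> G \<beta>" "\<And>\<beta>. \<beta> \<notin> A \<Longrightarrow> c \<beta> = 0"
      using graded_sum[of x] by blast
    have "c \<beta> \<in> extremal" for \<beta>
      by (rule component_extremal[OF x A(3)]) (metis A graded_sum_form)
    then show "x \<in> cvec.span {x \<in> extremal. \<exists>\<beta>. x \<in> G \<beta>}"
      unfolding A(2) using A(3) by (intro cvec.span_sum cvec.span_base) blast
  qed
qed

text \<open>
  The \<open>e\<^sub>\<alpha>\<close> lower the size of the degree, hence a longest non-vanishing word in the \<open>e\<^sub>\<alpha>\<close> takes \<open>x\<close> to an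
  extremal vector.
\<close>

lemma exists_extremal:
  assumes N: "invariant N" and x: "x \<in> N" "x \<noteq> 0"
  shows "\<exists>u\<in>N. u \<in> extremal \<and> u \<noteq> 0"
proof -
  \<comment> \<open>The strict inequality makes \<open>D 0\<close> trivial, which starts the induction.\<close>
  define D where "D d = cvec.span (\<Union>\<beta>\<in>{\<beta>. size \<beta> < d}. G \<beta>)" for d :: nat
  have E_D: "X (E \<alpha>) y \<in> D d" if "y \<in> D (Suc d)" "\<alpha> \<in> P" for y \<alpha> d
    using that(1) unfolding D_def
  proof (rule span_image_subset[rotated 2])
    fix z assume "z \<in> (\<Union>\<beta>\<in>{\<beta>. size \<beta> < Suc d}. G \<beta>)"
    then obtain \<beta> where \<beta>: "size \<beta> < Suc d" "z \<in> G \<beta>" by blast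
    show "X (E \<alpha>) z \<in> cvec.span (\<Union>\<beta>\<in>{\<beta>. size \<beta> < d}. G \<beta>)"
    proof (cases "\<alpha> \<in># \<beta>")
      case True
      then obtain \<gamma> where "\<beta> = add_mset \<alpha> \<gamma>" by (metis multi_member_split)
      then show ?thesis
        using \<beta> E_G[OF that(2)] by (intro cvec.span_base) auto
    next
      case False
      then show ?thesis using E_G_zero[OF that(2) \<beta>(2)] by (simp add: cvec.span_zero)
    qed
  qed (use that(2) in simp)
  have "\<exists>u\<in>N. u \<in> extremal \<and> u \<noteq> 0" if "y \<in> D d" "y \<in> N" "y \<noteq> 0" for d y
    using that
  proof (induction d arbitrary: y)
    case 0
    then show ?case by (simp add: D_def cvec.span_empty)
  next
    case (Suc d)
    show ?case
    proof (cases "y \<in> extremal")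
      case False
      then obtain \<alpha> where "\<alpha> \<in> P" "X (E \<alpha>) y \<noteq> 0"
        by (auto simp: extremal_def)
      then show ?thesis
        using Suc E_D invariant_X[OF N] by (metis in_generators(1))
    qed (use Suc in blast)
  qed
  moreover have "\<exists>d. x \<in> D d"
  proof -
    obtain A c where A: "finite A" "x = (\<Sum>\<beta>\<in>A. c \<beta>)" "\<And>\<beta>. c \<beta> \<in> G \<beta>"
      using graded_sum[of x] by blast
    have "x \<in> D (Suc (\<Sum>\<beta>\<in>A. size \<beta>))"
      unfolding A(2) D_def
    proof (intro cvec.span_sum cvec.span_base)
      fix \<beta> assume "\<beta> \<in> A"
      then have "size \<beta> \<le> (\<Sum>\<beta>\<in>A. size \<beta>)"
        using A(1) by (simp add: member_le_sum)
      then show "c \<beta> \<in> (\<Union>\<beta>\<in>{\<beta>. size \<beta> < Suc (\<Sum>\<beta>\<in>A. size \<beta>)}. G \<beta>)"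
        using A(3)[of \<beta>] by (intro UN_I[of \<beta>]) simp_all
    qed
    then show ?thesis ..
  qed
  ultimately show ?thesis using x by blast
qed

lemma F_closure_extremal_graded:
  assumes "x \<in> F_closure extremal"
  shows "x \<in> cvec.span (\<Union>\<beta>. G \<beta> \<inter> F_closure extremal)"
  using assms
proof induction
  case (base x)
  then have "x \<in> cvec.span {x \<in> extremal. \<exists>\<beta>. x \<in> G \<beta>}"
    using extremal_graded_span by simp
  also have "\<dots> \<subseteq> cvec.span (\<Union>\<beta>. G \<beta> \<inter> F_closure extremal)"
    by (rule cvec.span_mono) (auto intro: F_closure.base)
  finally show ?case .
next
  case (F x \<alpha>)
  show ?case
    by (rule span_image_subset[OF _ _ F(3)])
      (use F(2) F_G in \<open>auto intro!: cvec.span_base intro: F_closure.F\<close>)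
qed (simp_all add: cvec.span_zero cvec.span_add cvec.span_scale)

text \<open>
  If some component \<open>G \<beta>\<close> were not contained in the submodule generated by \<open>M\<^sup>+\<close>, then
  \<open>separating_vector\<close> would give a non-zero vector of degree \<open>\<beta>\<close> orthogonal to this submodule; its
  orthogonal complement would then contain an extremal vector orthogonal to all extremal vectors.
\<close>

lemma F_closure_extremal:
  assumes nondeg: "nondegenerate_on extremal B"
  shows "F_closure extremal = UNIV"
proof -
  let ?M = "F_closure extremal"
  have inv: "invariant ?M"
    using F_closure_invariant extremal_torus_stable[OF invariant_UNIV] by simp
  have "G \<beta> \<subseteq> ?M" for \<beta>
  proof (rule ccontr)
    assume "\<not> G \<beta> \<subseteq> ?M"
    then obtain x where x: "x \<in> G \<beta>" "x \<notin> ?M" by blast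
    obtain S where S: "finite S" "G \<beta> = cvec.span S" using G_finite_dim by blast
    obtain T where T: "T \<subseteq> G \<beta> \<inter> ?M" "cvec.independent T" "G \<beta> \<inter> ?M \<subseteq> cvec.span T"
      by (rule cvec.maximal_independent_subset)
    have "finite T"
      using cvec.independent_span_bound[OF S(1) T(2)] T(1) S(2) by auto
    moreover have "x \<notin> cvec.span T"
      using cvec.span_minimal[of T ?M] T(1) F_closure_subspace x(2) by blast
    moreover have "\<exists>y. B y x \<noteq> 0" if "x \<noteq> 0" for x
    proof (rule ccontr)
      assume "\<nexists>y. B y x \<noteq> 0"
      then have "B x y = 0" for y by (subst symmetric) blast
      then show False using nondegenerate[of x] that by blast
    qed
    ultimately obtain y' where y': "\<forall>t\<in>T. B y' t = 0" "B y' x \<noteq> 0"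
      using separating_vector[OF bilinear, of T x] by blast
    obtain y where y: "y \<in> G \<beta>" "\<And>z. z \<in> G \<beta> \<Longrightarrow> B y z = B y' z"
      using graded_component[of \<beta> y'] by blast
    have "B y z = 0" if "z \<in> G \<gamma> \<inter> ?M" for \<gamma> z
    proof (cases "\<gamma> = \<beta>")
      case True
      then have "z \<in> cvec.span T"
        using that T(3) by blast
      then have "B y' z = 0"
        using bilinear_zero_on_span[OF bilinear, of T y' z] y'(1) by blast
      then show ?thesis using that True y(2)[of z] by simp
    next
      case False
      then show ?thesis using that orthogonal[OF y(1), of z \<gamma>] by simp
    qed
    then have "B y z = 0" if "z \<in> ?M" for z
      by (intro bilinear_zero_on_span[OF bilinear _ F_closure_extremal_graded[OF that]]) blast
    moreover have "y \<noteq> 0"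
      using y'(2) y(2)[OF x(1)] by (auto simp: B_simps)
    ultimately obtain u where u: "\<forall>z\<in>?M. B u z = 0" "u \<in> extremal" "u \<noteq> 0"
      using exists_extremal[OF orthogonal_complement_invariant[OF inv], of y] by blast
    then show False
      using nondeg by (auto simp: nondegenerate_on_def intro: F_closure.base)
  qed
  then have "cvec.span (\<Union>\<beta>. G \<beta>) \<subseteq> ?M"
    by (intro cvec.span_minimal F_closure_subspace) blast
  then show ?thesis by (simp add: G_total top.extremum_uniqueI)
qed

text \<open>
  The difference is extremal and lies in \<open>F M\<close>, hence is orthogonal to \<open>M\<^sup>+\<close>.
\<close>

lemma extremal_mod_F_image_unique:
  assumes "nondegenerate_on extremal B" "u \<in> extremal" "w \<in> extremal" "u - w \<in> F_image"
  shows "u = w"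
proof -
  have "u - w \<in> extremal"
    using assms by (intro cvec.subspace_diff extremal_subspace)
  then show ?thesis
    using assms(1,4) extremal_orthogonal_F_image symmetric unfolding nondegenerate_on_def by fastforce
qed

lemma homogeneous_extremal_simple:
  assumes nondeg: "nondegenerate_on extremal B" and b: "b \<in> extremal" "b \<in> G \<beta>" "b \<noteq> 0"
  shows "simple (F_closure (cvec.span {b}))"
proof -
  let ?S = "F_closure (cvec.span {b})"
  have "cvec.span {b} \<subseteq> G \<beta>"
    using b by (intro cvec.span_minimal G_subspace) simp
  then have "torus_stable (cvec.span {b})"
    unfolding torus_stable_def using K_G Kinv_G by (auto simp: cvec.span_scale subset_iff)
  moreover have sub: "cvec.span {b} \<subseteq> extremal"
    using b by (intro cvec.span_minimal extremal_subspace) simp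
  ultimately have inv: "invariant ?S"
    by (rule F_closure_invariant)
  have bS: "b \<in> ?S"
    by (intro F_closure.base cvec.span_base) simp
  have "N = {0} \<or> N = ?S" if N: "invariant N" "N \<subseteq> ?S" for N
  proof (cases "N = {0}")
    case False
    then obtain x where "x \<in> N" "x \<noteq> 0"
      using cvec.subspace_0[OF invariant_subspace[OF N(1)]] by blast
    then obtain u where u: "u \<in> N" "u \<in> extremal" "u \<noteq> 0"
      using exists_extremal[OF N(1)] by blast
    then obtain w where w: "w \<in> cvec.span {b}" "u - w \<in> F_image"
      using F_closure_mod_F_image[of "cvec.span {b}" u] N(2) by auto
    then have "u = w"
      using extremal_mod_F_image_unique[OF nondeg u(2)] sub by blast
    then obtain c where c: "u = c *\<^sub>C b"
      using w(1) by (auto simp: cvec.span_singleton)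
    then have "b = inverse c *\<^sub>C u"
      using u(3) by (auto simp: scaleC_scaleC scaleC_one)
    then have "b \<in> N"
      using u(1) cvec.subspace_scale[OF invariant_subspace[OF N(1)]] by simp
    then have "cvec.span {b} \<subseteq> N"
      by (intro cvec.span_minimal invariant_subspace[OF N(1)]) simp
    then show ?thesis
      using F_closure_minimal[OF _ N(1)] N(2) by blast
  qed simp
  then show ?thesis
    unfolding simple_def using inv bS b(3) by blast
qed

lemma semisimple_if_nondegenerate:
  assumes nondeg: "nondegenerate_on extremal B"
  shows semisimple
proof -
  \<comment> \<open>Homogeneous vectors are eigenvectors of the torus, so that each of them spans a torus-stable line.\<close>
  obtain T where T: "T \<subseteq> {x \<in> extremal. \<exists>\<beta>. x \<in> G \<beta>}" "cvec.independent T"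
      "{x \<in> extremal. \<exists>\<beta>. x \<in> G \<beta>} \<subseteq> cvec.span T"
    by (rule cvec.maximal_independent_subset)
  have T0: "b \<noteq> 0" if "b \<in> T" for b
    using T(2) that cvec.dependent_zero by blast
  let ?S = "\<lambda>b. F_closure (cvec.span {b})"
  have simple: "simple (?S b)" if "b \<in> T" for b
    using homogeneous_extremal_simple[OF nondeg] T(1) T0 that by blast
  then have inv: "invariant (?S b)" if "b \<in> T" for b
    using that by (simp add: simple_def)
  have bS: "b \<in> ?S b" for b
    by (intro F_closure.base cvec.span_base) simp
  let ?\<S> = "?S ` T"
  have spanning: "cvec.span (\<Union>?\<S>) = UNIV"
  proof -
    have span_inv: "invariant (cvec.span (\<Union>?\<S>))"
      using inv by (intro span_Union_invariant) blast
    have "T \<subseteq> cvec.span (\<Union>?\<S>)"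
      using bS by (blast intro: cvec.span_base)
    then have "cvec.span T \<subseteq> cvec.span (\<Union>?\<S>)"
      by (intro cvec.span_minimal) auto
    moreover have "extremal \<subseteq> cvec.span T"
      using cvec.span_minimal[OF T(3)] extremal_graded_span by simp
    ultimately have "F_closure extremal \<subseteq> cvec.span (\<Union>?\<S>)"
      by (intro F_closure_minimal span_inv) blast
    then show ?thesis
      using F_closure_extremal[OF nondeg] by auto
  qed
  have direct: "S \<inter> cvec.span (\<Union>(?\<S> - {S})) = {0}" if "S \<in> ?\<S>" for S
  proof (rule ccontr)
    assume ne: "S \<inter> cvec.span (\<Union>(?\<S> - {S})) \<noteq> {0}"
    from that obtain b where b: "b \<in> T" "S = ?S b" by blast
    have "invariant (cvec.span (\<Union>(?\<S> - {S})))"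
      using inv by (intro span_Union_invariant) blast
    then have "invariant (S \<inter> cvec.span (\<Union>(?\<S> - {S})))"
      using inv[OF b(1)] b(2) unfolding invariant_def by (auto intro: cvec.subspace_inter)
    then have "S \<inter> cvec.span (\<Union>(?\<S> - {S})) = S"
      using simple[OF b(1)] ne b(2) unfolding simple_def by blast
    \<comment> \<open>Reduce this membership modulo \<open>F M\<close>: it would express \<open>b\<close> by the other basis vectors.\<close>
    then have "b \<in> cvec.span (\<Union>(?\<S> - {S}))"
      using bS b(2) by blast
    also have "\<dots> \<subseteq> {x. \<exists>w\<in>cvec.span (T - {b}). x - w \<in> F_image}"
    proof (rule cvec.span_minimal)
      show "cvec.subspace {x. \<exists>w\<in>cvec.span (T - {b}). x - w \<in> F_image}"
      proof (rule cvec.subspaceI)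
        show "0 \<in> {x. \<exists>w\<in>cvec.span (T - {b}). x - w \<in> F_image}"
          by (auto intro!: bexI[of _ 0] simp: cvec.span_zero F_image_def)
        show "x + y \<in> {x. \<exists>w\<in>cvec.span (T - {b}). x - w \<in> F_image}"
          if "x \<in> {x. \<exists>w\<in>cvec.span (T - {b}). x - w \<in> F_image}"
            "y \<in> {x. \<exists>w\<in>cvec.span (T - {b}). x - w \<in> F_image}" for x y
        proof -
          from that obtain w w' where "w \<in> cvec.span (T - {b})" "x - w \<in> F_image"
            "w' \<in> cvec.span (T - {b})" "y - w' \<in> F_image" by blast
          then show ?thesis
            using cvec.span_add[of "x - w" _ "y - w'"]
            by (auto intro!: bexI[of _ "w + w'"] simp: cvec.span_add F_image_def add_diff_add)
        qed
        show "c *\<^sub>C x \<in> {x. \<exists>w\<in>cvec.span (T - {b}). x - w \<in> F_image}"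
          if "x \<in> {x. \<exists>w\<in>cvec.span (T - {b}). x - w \<in> F_image}" for c x
        proof -
          from that obtain w where "w \<in> cvec.span (T - {b})" "x - w \<in> F_image" by blast
          then show ?thesis
            using cvec.span_scale[of "x - w" _ c]
            by (auto intro!: bexI[of _ "c *\<^sub>C w"] simp: cvec.span_scale F_image_def cvec.scale_right_diff_distrib)
        qed
      qed
      show "\<Union>(?\<S> - {S}) \<subseteq> {x. \<exists>w\<in>cvec.span (T - {b}). x - w \<in> F_image}"
      proof
        fix x assume "x \<in> \<Union>(?\<S> - {S})"
        then obtain b' where b': "b' \<in> T" "b' \<noteq> b" "x \<in> ?S b'" using b(2) by blast
        then obtain w where w: "w \<in> cvec.span {b'}" "x - w \<in> F_image"
          using F_closure_mod_F_image[of "cvec.span {b'}" x] by auto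
        moreover have "cvec.span {b'} \<subseteq> cvec.span (T - {b})"
          using b' by (intro cvec.span_mono) auto
        ultimately show "x \<in> {x. \<exists>w\<in>cvec.span (T - {b}). x - w \<in> F_image}" by blast
      qed
    qed
    finally obtain w where w: "w \<in> cvec.span (T - {b})" "b - w \<in> F_image" by blast
    moreover have "cvec.span (T - {b}) \<subseteq> extremal"
      using T(1) by (intro cvec.span_minimal extremal_subspace) blast
    moreover have "b \<in> extremal"
      using b(1) T(1) by blast
    ultimately have "b = w"
      using extremal_mod_F_image_unique[OF nondeg] by blast
    then show False
      using w(1) T(2) b(1) by (auto simp: cvec.dependent_def)
  qed
  have "simple S" if "S \<in> ?\<S>" for S
    using that simple by blast
  then show ?thesis
    unfolding semisimple_def by (intro exI[of _ ?\<S>] conjI ballI spanning direct)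
qed

lemma nondegenerate_if_semisimple:
  assumes semisimple
  shows "nondegenerate_on extremal B"
proof -
  from assms obtain \<S> where "\<forall>S\<in>\<S>. simple S" and span: "cvec.span (\<Union>\<S>) = UNIV"
    unfolding semisimple_def by (elim exE conjE)
  then have simple: "\<And>S. S \<in> \<S> \<Longrightarrow> simple S"
    by blast
  have "u = 0" if u: "u \<in> extremal" "\<forall>w\<in>extremal. B u w = 0" for u
  proof (rule nondegenerate)
    fix y
    have zero: "B u y = 0" if "y \<in> \<Union>\<S>" for y
    proof -
      from that obtain S where S: "S \<in> \<S>" "y \<in> S" by blast
      then have inv: "invariant S" "S \<noteq> {0}"
        using simple by (auto simp: simple_def)
      then obtain x where "x \<in> S" "x \<noteq> 0"
        using cvec.subspace_0[OF invariant_subspace] by blast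
      then obtain v where v: "v \<in> S" "v \<in> extremal" "v \<noteq> 0"
        using exists_extremal[OF inv(1)] by blast
      let ?C = "F_closure (S \<inter> extremal)"
      have "invariant ?C"
        by (intro F_closure_invariant extremal_torus_stable inv) simp
      moreover have "?C \<subseteq> S"
        by (intro F_closure_minimal inv) simp
      moreover have "?C \<noteq> {0}"
        using F_closure.base[of v "S \<inter> extremal"] v by auto
      ultimately have "y \<in> ?C"
        using simple[OF S(1)] S(2) unfolding simple_def by blast
      then obtain w where "w \<in> extremal" "y - w \<in> F_image"
        using F_closure_mod_F_image[OF cvec.subspace_inter[OF invariant_subspace[OF inv(1)] extremal_subspace], of y]
        by blast
      then show ?thesis
        using u extremal_orthogonal_F_image[OF u(1), of "y - w"] by (simp add: B_simps)
    qed
    show "B u y = 0"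
      using bilinear_zero_on_span[OF bilinear zero, of "\<Union>\<S>" y] by (simp add: span)
  qed
  then show ?thesis
    unfolding nondegenerate_on_def by blast
qed

end

section \<open>Irreducible highest weight modules are graded\<close>

locale highest_weight_operators = contravariant_operators P qp kappa X B
  for P :: "'r set" and qp kappa and X :: "'r generator \<Rightarrow> 'm::complex_vector \<Rightarrow> 'm" and B +
  fixes v0 :: 'm and lam :: "'r \<Rightarrow> complex"
  assumes E_v0: "\<alpha> \<in> P \<Longrightarrow> X (E \<alpha>) v0 = 0"
    and K_v0: "\<alpha> \<in> P \<Longrightarrow> X (K \<alpha>) v0 = lam \<alpha> *\<^sub>C v0"
    and normalized: "B v0 v0 = 1"
    and simple_UNIV: "simple UNIV"
begin

fun F_word :: "'r list \<Rightarrow> 'm" where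
  "F_word [] = v0"
| "F_word (\<alpha> # w) = X (F \<alpha>) (F_word w)"

definition component :: "'r multiset \<Rightarrow> 'm set"
  where "component \<beta> = cvec.span {F_word w | w. set w \<subseteq> P \<and> mset w = \<beta>}"

definition weight :: "'r \<Rightarrow> 'r multiset \<Rightarrow> complex"
  where "weight \<alpha> \<beta> = lam \<alpha> * inverse (\<Prod>\<gamma>\<in>#\<beta>. qp \<alpha> \<gamma>)"

lemma F_word_component: "set w \<subseteq> P \<Longrightarrow> F_word w \<in> component (mset w)"
  unfolding component_def by (intro cvec.span_base) blast

lemma component_subspace: "cvec.subspace (component \<beta>)"
  by (simp add: component_def)

lemma K_F_word: "\<alpha> \<in> P \<Longrightarrow> set w \<subseteq> P \<Longrightarrow> X (K \<alpha>) (F_word w) = weight \<alpha> (mset w) *\<^sub>C F_word w"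
  by (induction w) (simp_all add: K_v0 weight_def KF X_simps scaleC_scaleC mult.commute mult.left_commute)

lemma K_component: "\<alpha> \<in> P \<Longrightarrow> x \<in> component \<beta> \<Longrightarrow> X (K \<alpha>) x = weight \<alpha> \<beta> *\<^sub>C x"
proof -
  assume \<alpha>: "\<alpha> \<in> P" and "x \<in> component \<beta>"
  from this(2) show ?thesis unfolding component_def
  proof (induction rule: cvec.span_induct_alt)
    case (step c x y)
    then obtain w where "x = F_word w" "set w \<subseteq> P" "mset w = \<beta>" by blast
    then have "X (K \<alpha>) x = weight \<alpha> \<beta> *\<^sub>C x"
      using K_F_word[OF \<alpha>] by blast
    with step \<alpha> show ?case
      by (simp add: X_simps scaleC_scaleC scaleC_add_right mult.commute)
  qed (use \<alpha> in \<open>simp add: X_simps\<close>)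
qed

lemma lam_nonzero: "\<alpha> \<in> P \<Longrightarrow> lam \<alpha> \<noteq> 0"
  using Kinv_K[of \<alpha> v0] K_v0[of \<alpha>] normalized by (auto simp: X_simps B_simps)

lemma weight_nonzero: "\<alpha> \<in> P \<Longrightarrow> weight \<alpha> \<beta> \<noteq> 0"
  by (auto simp: weight_def lam_nonzero prod_mset_zero_iff)

lemma Kinv_component: "\<alpha> \<in> P \<Longrightarrow> x \<in> component \<beta> \<Longrightarrow> X (Kinv \<alpha>) x = inverse (weight \<alpha> \<beta>) *\<^sub>C x"
proof -
  assume \<alpha>: "\<alpha> \<in> P" and x: "x \<in> component \<beta>"
  have "x = weight \<alpha> \<beta> *\<^sub>C X (Kinv \<alpha>) x"
    using Kinv_K[OF \<alpha>, of x] K_component[OF \<alpha> x] \<alpha> by (simp add: X_simps)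
  then have "inverse (weight \<alpha> \<beta>) *\<^sub>C x = inverse (weight \<alpha> \<beta>) *\<^sub>C weight \<alpha> \<beta> *\<^sub>C X (Kinv \<alpha>) x"
    by (rule arg_cong)
  then show ?thesis
    using weight_nonzero[OF \<alpha>] by (simp add: scaleC_scaleC scaleC_one)
qed

lemma F_component: "\<alpha> \<in> P \<Longrightarrow> x \<in> component \<beta> \<Longrightarrow> X (F \<alpha>) x \<in> component (add_mset \<alpha> \<beta>)"
  unfolding component_def
proof (rule span_image_subset)
  fix x assume \<alpha>: "\<alpha> \<in> P" and "x \<in> {F_word w | w. set w \<subseteq> P \<and> mset w = \<beta>}"
  then obtain w where "x = F_word w" "set w \<subseteq> P" "mset w = \<beta>" by blast
  then show "X (F \<alpha>) x \<in> cvec.span {F_word w | w. set w \<subseteq> P \<and> mset w = add_mset \<alpha> \<beta>}"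
    using \<alpha> by (intro cvec.span_base CollectI exI[of _ "\<alpha> # w"]) simp
qed simp_all

text \<open>
  The degrees are multisets of roots and not characters of the torus, so that the vanishing of \<open>e\<^sub>\<alpha>\<close> in
  degrees without \<open>\<alpha>\<close> has to be proved along with its effect on the other degrees.
\<close>

lemma E_F_word:
  assumes "\<alpha> \<in> P" "set w \<subseteq> P"
  shows "X (E \<alpha>) (F_word w) \<in> (if \<alpha> \<in># mset w then component (mset w - {#\<alpha>#}) else {0})"
  using assms(2)
proof (induction w)
  case Nil
  then show ?case by (simp add: E_v0 assms)
next
  case (Cons a w)
  let ?x = "F_word w" and ?\<beta> = "mset w"
  have a: "a \<in> P" and x: "?x \<in> component ?\<beta>"
    using Cons by (simp_all add: F_word_component)
  note sub = component_subspace
  have torus: "kappa *\<^sub>C (X (K \<alpha>) ?x - X (Kinv \<alpha>) ?x) \<in> component ?\<beta>"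
    using K_component[OF assms(1) x] Kinv_component[OF assms(1) x] x
    by (auto intro!: cvec.subspace_scale[OF sub] cvec.subspace_diff[OF sub])
  have EF': "X (E \<alpha>) (F_word (a # w)) = X (F a) (X (E \<alpha>) ?x)
      + (if \<alpha> = a then kappa *\<^sub>C (X (K \<alpha>) ?x - X (Kinv \<alpha>) ?x) else 0)"
    using assms(1) a by (simp add: EF)
  show ?case
  proof (cases "\<alpha> \<in># ?\<beta>")
    case True
    then have \<beta>: "add_mset a (?\<beta> - {#\<alpha>#}) = add_mset a ?\<beta> - {#\<alpha>#}"
      by simp
    have "X (E \<alpha>) ?x \<in> component (?\<beta> - {#\<alpha>#})"
      using Cons True by simp
    then have "X (F a) (X (E \<alpha>) ?x) \<in> component (add_mset a ?\<beta> - {#\<alpha>#})"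
      using F_component[OF a] \<beta> by metis
    moreover have "(if \<alpha> = a then kappa *\<^sub>C (X (K \<alpha>) ?x - X (Kinv \<alpha>) ?x) else 0) \<in> component (add_mset a ?\<beta> - {#\<alpha>#})"
      using torus cvec.subspace_0[OF sub] by auto
    ultimately show ?thesis
      using True unfolding EF' by (auto intro: cvec.subspace_add[OF sub])
  next
    case False
    then have "X (E \<alpha>) ?x = 0" using Cons by simp
    then show ?thesis
      unfolding EF' using torus a False by (auto simp: X_simps)
  qed
qed

lemma E_component: "\<alpha> \<in> P \<Longrightarrow> x \<in> component (add_mset \<alpha> \<beta>) \<Longrightarrow> X (E \<alpha>) x \<in> component \<beta>"
  unfolding component_def
proof (rule span_image_subset, simp)
  fix x assume \<alpha>: "\<alpha> \<in> P" and "x \<in> {F_word w | w. set w \<subseteq> P \<and> mset w = add_mset \<alpha> \<beta>}"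
  then obtain w where "x = F_word w" "set w \<subseteq> P" "mset w = add_mset \<alpha> \<beta>" by blast
  then show "X (E \<alpha>) x \<in> cvec.span {F_word w | w. set w \<subseteq> P \<and> mset w = \<beta>}"
    using E_F_word[OF \<alpha>, of w] by (simp add: component_def)
qed

lemma E_component_zero: "\<alpha> \<in> P \<Longrightarrow> x \<in> component \<beta> \<Longrightarrow> \<alpha> \<notin># \<beta> \<Longrightarrow> X (E \<alpha>) x = 0"
proof -
  assume \<alpha>: "\<alpha> \<in> P" "\<alpha> \<notin># \<beta>" and x: "x \<in> component \<beta>"
  have "X (E \<alpha>) x \<in> cvec.span {}"
    using _ _ x unfolding component_def
  proof (rule span_image_subset)
    fix x assume "x \<in> {F_word w | w. set w \<subseteq> P \<and> mset w = \<beta>}"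
    then obtain w where "x = F_word w" "set w \<subseteq> P" "mset w = \<beta>" by blast
    then show "X (E \<alpha>) x \<in> cvec.span {}"
      using E_F_word[OF \<alpha>(1), of w] \<alpha>(2) by (auto simp: cvec.span_empty)
  qed (use \<alpha> in simp)
  then show ?thesis by (simp add: cvec.span_empty)
qed

lemma components_total: "cvec.span (\<Union>\<beta>. component \<beta>) = UNIV"
proof -
  let ?G = "\<Union>\<beta>. component \<beta>"
  have "X g x \<in> cvec.span ?G" if g: "g \<in> generators P" and x: "x \<in> ?G" for g x
  proof -
    from x obtain \<beta> where x: "x \<in> component \<beta>" by blast
    from g consider (E) \<alpha> where "g = E \<alpha>" "\<alpha> \<in> P" | (F) \<alpha> where "g = F \<alpha>" "\<alpha> \<in> P"
      | (K) \<alpha> where "g = K \<alpha>" "\<alpha> \<in> P" | (Kinv) \<alpha> where "g = Kinv \<alpha>" "\<alpha> \<in> P"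
      by (auto simp: generators_def)
    then show ?thesis
    proof cases
      case E
      show ?thesis
      proof (cases "\<alpha> \<in># \<beta>")
        case True
        then obtain \<gamma> where "\<beta> = add_mset \<alpha> \<gamma>" by (metis multi_member_split)
        then have "X g x \<in> component \<gamma>" using E x E_component by simp
        then show ?thesis by (intro cvec.span_base) blast
      next
        case False
        then show ?thesis using E x E_component_zero by (simp add: cvec.span_zero)
      qed
    next
      case F
      then have "X g x \<in> component (add_mset \<alpha> \<beta>)" using x F_component by simp
      then show ?thesis by (intro cvec.span_base) blast
    next
      case K
      then have "X g x \<in> component \<beta>"
        using x K_component[OF _ x] by (simp add: cvec.subspace_scale[OF component_subspace])
      then show ?thesis by (intro cvec.span_base) blast
    next
      case Kinv
      then have "X g x \<in> component \<beta>"
        using x Kinv_component[OF _ x] by (simp add: cvec.subspace_scale[OF component_subspace])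
      then show ?thesis by (intro cvec.span_base) blast
    qed
  qed
  then have "invariant (cvec.span ?G)"
    by (rule span_invariant)
  moreover have "v0 \<in> cvec.span ?G"
    using F_word_component[of "[]"] by (intro cvec.span_base) auto
  moreover have "v0 \<noteq> 0"
    using normalized by (auto simp: B_simps)
  ultimately show ?thesis
    using simple_UNIV unfolding simple_def by auto
qed

text \<open>
  Each \<open>f\<^sub>\<alpha>\<close> on the left is moved to the right as \<open>- q\<^sup>-\<^sup>h e\<^sub>\<alpha>\<close>, which removes \<open>\<alpha>\<close> from the degree \<open>\<gamma>\<close>. As the
  contents differ, one meets either a root that the remaining degree does not contain, or a pairing of
  \<open>v0\<close> with the image of some \<open>f\<^sub>\<alpha>\<close>; both vanish.
\<close>

lemma F_word_orthogonal:
  assumes "set w \<subseteq> P" "y \<in> component \<gamma>" "mset w \<noteq> \<gamma>"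
  shows "B (F_word w) y = 0"
  using assms
proof (induction w arbitrary: y \<gamma>)
  case Nil
  have "B v0 z = 0" if z: "z \<in> {F_word w | w. set w \<subseteq> P \<and> mset w = \<gamma>}" for z
  proof -
    from z obtain w' where w': "z = F_word w'" "set w' \<subseteq> P" "mset w' = \<gamma>" by blast
    with Nil(3) obtain \<alpha> w where "w' = \<alpha> # w" by (cases w') auto
    with w' have "z = X (F \<alpha>) (F_word w)" "\<alpha> \<in> P" by simp_all
    then show ?thesis
      by (simp add: symmetric[of v0] contravariant_F E_v0 X_simps B_simps)
  qed
  then show ?case
    using Nil(2) unfolding component_def F_word.simps by (rule bilinear_zero_on_span[OF bilinear])
next
  case (Cons a w)
  then have a: "a \<in> P" by simp
  show ?case
  proof (cases "a \<in># \<gamma>")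
    case True
    then obtain \<delta> where \<delta>: "\<gamma> = add_mset a \<delta>" by (metis multi_member_split)
    then have Ey: "X (E a) y \<in> component \<delta>"
      using Cons.prems a E_component by blast
    then have "X (Kinv a) (X (E a) y) \<in> component \<delta>"
      using Kinv_component[OF a Ey] by (simp add: cvec.subspace_scale[OF component_subspace])
    then show ?thesis
      using Cons.IH[of _ \<delta>] Cons.prems \<delta> a by (simp add: contravariant_F)
  next
    case False
    then have "X (E a) y = 0"
      using E_component_zero[OF a Cons.prems(2)] by simp
    then show ?thesis
      using a by (simp add: contravariant_F X_simps B_simps)
  qed
qed

lemma components_orthogonal:
  assumes "x \<in> component \<beta>" "y \<in> component \<gamma>" "\<beta> \<noteq> \<gamma>"
  shows "B x y = 0"
proof -
  have "B y x = 0"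
    using _ assms(1) unfolding component_def
  proof (rule bilinear_zero_on_span[OF bilinear])
    fix z assume "z \<in> {F_word w | w. set w \<subseteq> P \<and> mset w = \<beta>}"
    then obtain w where "z = F_word w" "set w \<subseteq> P" "mset w = \<beta>" by blast
    then show "B y z = 0"
      using F_word_orthogonal[of w y \<gamma>] assms(2,3) symmetric[of y z] by simp
  qed
  then show ?thesis using symmetric[of x y] by simp
qed

text \<open>
  The radical is a submodule that does not contain \<open>v0\<close>.
\<close>

lemma form_nondegenerate:
  assumes "\<And>y. B x y = 0"
  shows "x = 0"
proof -
  let ?N = "{x. \<forall>y\<in>UNIV. B x y = 0}"
  have "invariant ?N"
    by (rule orthogonal_complement_invariant[OF invariant_UNIV])
  moreover have "v0 \<notin> ?N"
    using normalized by force
  ultimately have "?N = {0}"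
    using simple_UNIV unfolding simple_def by blast
  then show ?thesis using assms by blast
qed

sublocale graded_contravariant P qp kappa X B component weight
proof unfold_locales
  show "\<exists>S. finite S \<and> component \<beta> = cvec.span S" for \<beta>
  proof -
    have "finite {F_word w | w. set w \<subseteq> P \<and> mset w = \<beta>}"
    proof -
      have "finite {w. mset w = \<beta>}"
        using mset_eq_finite ex_mset[of \<beta>] by blast
      then have "finite (F_word ` {w. mset w = \<beta>})" by simp
      then show ?thesis by (rule rev_finite_subset) blast
    qed
    then show ?thesis unfolding component_def by blast
  qed
qed (rule form_nondegenerate components_total E_component E_component_zero F_component K_component
    components_orthogonal; assumption)+

end

section \<open>The tensor product\<close>

lemma tensor_simps:
  shows tensor_add_left: "(v + v') \<otimes>\<^sub>t z = v \<otimes>\<^sub>t z + v' \<otimes>\<^sub>t z"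
    and tensor_add_right: "v \<otimes>\<^sub>t (z + z') = v \<otimes>\<^sub>t z + v \<otimes>\<^sub>t z'"
    and tensor_scale_left: "(c *\<^sub>C v) \<otimes>\<^sub>t z = c *\<^sub>C (v \<otimes>\<^sub>t z)"
    and tensor_scale_right: "v \<otimes>\<^sub>t (c *\<^sub>C z) = c *\<^sub>C (v \<otimes>\<^sub>t z)"
proof -
  have rel: "tensor_eq a b" if "a - b \<in> tensor_relations" for a b :: "'a \<times> 'b \<Rightarrow>\<^sub>0 complex"
    using that by (simp add: tensor_eq_def cvec.span_base)
  show "(v + v') \<otimes>\<^sub>t z = v \<otimes>\<^sub>t z + v' \<otimes>\<^sub>t z"
    by transfer (rule rel, unfold tensor_relations_def diff_diff_eq[symmetric], blast)
  show "v \<otimes>\<^sub>t (z + z') = v \<otimes>\<^sub>t z + v \<otimes>\<^sub>t z'"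
    by transfer (rule rel, unfold tensor_relations_def diff_diff_eq[symmetric], blast)
  show "(c *\<^sub>C v) \<otimes>\<^sub>t z = c *\<^sub>C (v \<otimes>\<^sub>t z)"
    by transfer (rule rel, unfold tensor_relations_def, blast)
  show "v \<otimes>\<^sub>t (c *\<^sub>C z) = c *\<^sub>C (v \<otimes>\<^sub>t z)"
    by transfer (rule rel, unfold tensor_relations_def, blast)
qed

lemma tensor_zero [simp]: "0 \<otimes>\<^sub>t z = 0" "v \<otimes>\<^sub>t 0 = 0"
  using tensor_scale_left[of 0 0 z] tensor_scale_right[of v 0 0] by simp_all

lemma span_tensors: "cvec.span (range (\<lambda>(v, z). v \<otimes>\<^sub>t z)) = UNIV"
proof -
  have "t \<in> cvec.span (range (\<lambda>(v, z). v \<otimes>\<^sub>t z))" for t :: "('a, 'b) tensor"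
  proof (induct t)
    fix p :: "'a \<times> 'b \<Rightarrow>\<^sub>0 complex"
    have abs_single: "abs_tensor (Poly_Mapping.single x c) = c *\<^sub>C (fst x \<otimes>\<^sub>t snd x)" for x :: "'a \<times> 'b" and c
      by (simp add: tensor.abs_eq scaleC_tensor.abs_eq) (rule arg_cong[where f = abs_tensor],
        rule poly_mapping_eqI, simp add: lookup_scaleC lookup_single scaleC_complex_def when_def)
    have "abs_tensor (\<Sum>x\<in>A. Poly_Mapping.single x (Poly_Mapping.lookup p x)) \<in> cvec.span (range (\<lambda>(v, z). v \<otimes>\<^sub>t z))" for A
    proof (induction A rule: infinite_finite_induct)
      case (insert x A)
      have "fst x \<otimes>\<^sub>t snd x \<in> range (\<lambda>(v, z). v \<otimes>\<^sub>t z)"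
        by (rule image_eqI[of _ _ x]) (auto simp: case_prod_unfold)
      then show ?case
        using insert by (simp add: abs_single cvec.span_add cvec.span_scale cvec.span_base flip: plus_tensor.abs_eq)
    qed (simp_all add: cvec.span_zero flip: zero_tensor.abs_eq zero_tensor_def)
    moreover have "p = (\<Sum>x\<in>Poly_Mapping.keys p. Poly_Mapping.single x (Poly_Mapping.lookup p x))"
      by (rule poly_mapping_eqI) (simp add: lookup_sum lookup_single when_def in_keys_iff)
    ultimately show "abs_tensor p \<in> cvec.span (range (\<lambda>(v, z). v \<otimes>\<^sub>t z))"
      by metis
  qed
  then show ?thesis by blast
qed

lemma tensor_induct [case_names pure add scale]:
  assumes pure: "\<And>v z. Q (v \<otimes>\<^sub>t z)" and add: "\<And>s t. Q s \<Longrightarrow> Q t \<Longrightarrow> Q (s + t)"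
    and scale: "\<And>c t. Q t \<Longrightarrow> Q (c *\<^sub>C t)"
  shows "Q t"
proof -
  have "t \<in> cvec.span (range (\<lambda>(v, z). v \<otimes>\<^sub>t z))"
    by (simp add: span_tensors)
  then show ?thesis
  proof (induction rule: cvec.span_induct_alt)
    case base
    show ?case using pure[of 0 0] by simp
  next
    case (step c x y)
    then show ?case using pure by (auto intro: add scale)
  qed
qed

lemma tensor_in_span:
  assumes v: "v \<in> cvec.span S" and z: "z \<in> cvec.span S'"
  shows "v \<otimes>\<^sub>t z \<in> cvec.span {s \<otimes>\<^sub>t s' | s s'. s \<in> S \<and> s' \<in> S'}"
  using v
proof (induction rule: cvec.span_induct_alt)
  case (step c s y)
  have "s \<otimes>\<^sub>t z \<in> cvec.span {s \<otimes>\<^sub>t s' | s s'. s \<in> S \<and> s' \<in> S'}"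
    using z
  proof (induction rule: cvec.span_induct_alt)
    case (step d s' y)
    then have "s \<otimes>\<^sub>t s' \<in> cvec.span {s \<otimes>\<^sub>t s' | s s'. s \<in> S \<and> s' \<in> S'}"
      using \<open>s \<in> S\<close> by (intro cvec.span_base) blast
    with step show ?case
      by (simp add: tensor_add_right tensor_scale_right cvec.span_add cvec.span_scale)
  qed (simp add: cvec.span_zero)
  with step show ?case
    by (simp add: tensor_add_left tensor_scale_left cvec.span_add cvec.span_scale)
qed (simp add: cvec.span_zero)

lemma tensor_basis_expansion:
  assumes "cvec.span T = UNIV"
  shows "\<exists>A c. finite A \<and> A \<subseteq> T \<and> t = (\<Sum>b\<in>A. c b \<otimes>\<^sub>t b)"
proof (induction t rule: tensor_induct)
  case (pure v z)
  have "z \<in> cvec.span T" by (simp add: assms)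
  then obtain A r where "finite A" "A \<subseteq> T" and z: "z = (\<Sum>b\<in>A. r b *\<^sub>C b)"
    unfolding cvec.span_explicit by blast
  moreover have "v \<otimes>\<^sub>t z = (\<Sum>b\<in>A. (r b *\<^sub>C v) \<otimes>\<^sub>t b)"
    unfolding z by (induction A rule: infinite_finite_induct)
      (simp_all add: tensor_add_right tensor_scale_left tensor_scale_right)
  ultimately show ?case by (intro exI[of _ A] exI[of _ "\<lambda>b. r b *\<^sub>C v"]) simp
next
  case (add s t)
  then obtain A c A' c' where A: "finite A" "A \<subseteq> T" "s = (\<Sum>b\<in>A. c b \<otimes>\<^sub>t b)"
    and A': "finite A'" "A' \<subseteq> T" "t = (\<Sum>b\<in>A'. c' b \<otimes>\<^sub>t b)" by blast
  let ?d = "\<lambda>b. (if b \<in> A then c b else 0) + (if b \<in> A' then c' b else 0)"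
  have "(\<Sum>b\<in>A \<union> A'. ?d b \<otimes>\<^sub>t b)
    = (\<Sum>b\<in>A \<union> A'. (if b \<in> A then c b else 0) \<otimes>\<^sub>t b) + (\<Sum>b\<in>A \<union> A'. (if b \<in> A' then c' b else 0) \<otimes>\<^sub>t b)"
    by (simp add: tensor_add_left sum.distrib)
  also have "(\<Sum>b\<in>A \<union> A'. (if b \<in> A then c b else 0) \<otimes>\<^sub>t b) = s"
    unfolding A(3) by (rule sum.mono_neutral_cong_right) (use A(1) A'(1) in auto)
  also have "(\<Sum>b\<in>A \<union> A'. (if b \<in> A' then c' b else 0) \<otimes>\<^sub>t b) = t"
    unfolding A'(3) by (rule sum.mono_neutral_cong_right) (use A(1) A'(1) in auto)
  finally show ?case
    using A(1,2) A'(1,2) by (intro exI[of _ "A \<union> A'"] exI[of _ ?d]) simp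
next
  case (scale a t)
  then obtain A c where A: "finite A" "A \<subseteq> T" "t = (\<Sum>b\<in>A. c b \<otimes>\<^sub>t b)" by blast
  then have "a *\<^sub>C t = (\<Sum>b\<in>A. (a *\<^sub>C c b) \<otimes>\<^sub>t b)"
    by (simp add: cvec.scale_sum_right tensor_scale_left)
  with A(1,2) show ?case by (intro exI[of _ A] exI[of _ "\<lambda>b. a *\<^sub>C c b"]) simp
qed

lemma tensor_form_symmetric:
  assumes BV: "bilinear_form BV" "\<And>x y. BV x y = BV y x" and BZ: "bilinear_form BZ" "\<And>x y. BZ x y = BZ y x"
  shows "tensor_form BV BZ s t = tensor_form BV BZ t s"
proof -
  note form = tensor_form_tensor(1)[OF BV(1) BZ(1)]
  note simps = bilinear_simps[OF tensor_form_tensor(2)[OF BV(1) BZ(1)]]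
  have "tensor_form BV BZ (v \<otimes>\<^sub>t z) t = tensor_form BV BZ t (v \<otimes>\<^sub>t z)" for v z t
    by (induction t rule: tensor_induct) (simp_all add: form simps BV(2) BZ(2))
  then show ?thesis
    by (induction s rule: tensor_induct) (simp_all add: simps)
qed

text \<open>
  Expand \<open>t\<close> along a basis of the second factor. Pairing with \<open>v \<otimes> z\<close> for all \<open>z\<close> gives a vanishing linear
  combination of basis vectors with coefficients \<open>BV (c b) v\<close>.
\<close>

lemma tensor_form_nondegenerate:
  assumes BV: "bilinear_form BV" "\<And>x. (\<And>y. BV x y = 0) \<Longrightarrow> x = 0"
    and BZ: "bilinear_form BZ" "\<And>x. (\<And>y. BZ x y = 0) \<Longrightarrow> x = 0"
    and t: "\<And>s. tensor_form BV BZ t s = 0"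
  shows "t = 0"
proof -
  obtain T :: "'b set" where T: "cvec.independent T" "UNIV \<subseteq> cvec.span T"
    using cvec.maximal_independent_subset[of UNIV] by blast
  obtain A c where A: "finite A" "A \<subseteq> T" "t = (\<Sum>b\<in>A. c b \<otimes>\<^sub>t b)"
    using tensor_basis_expansion[of T t] T(2) by blast
  note form = tensor_form_tensor(1)[OF BV(1) BZ(1)]
  note BT = bilinear_sum[OF tensor_form_tensor(2)[OF BV(1) BZ(1)]]
  have "c b = 0" if "b \<in> A" for b
  proof (rule BV(2))
    fix v
    have "(\<Sum>b\<in>A. BV (c b) v *\<^sub>C b) = 0"
    proof (rule BZ(2))
      fix z
      have "0 = tensor_form BV BZ t (v \<otimes>\<^sub>t z)" by (simp add: t)
      also have "\<dots> = (\<Sum>b\<in>A. BV (c b) v * BZ b z)"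
        unfolding A(3) by (simp add: BT form)
      also have "\<dots> = BZ (\<Sum>b\<in>A. BV (c b) v *\<^sub>C b) z"
        by (simp add: bilinear_sum[OF BZ(1)] bilinear_simps[OF BZ(1)])
      finally show "BZ (\<Sum>b\<in>A. BV (c b) v *\<^sub>C b) z = 0" by simp
    qed
    then show "BV (c b) v = 0"
      by (rule cvec.independentD[OF T(1) A(1,2) _ that])
  qed
  then show ?thesis by (simp add: A(3))
qed

lemma finite_add_decompositions: "finite {(\<beta>, \<gamma>). \<beta> + \<gamma> = (\<delta> :: 'a multiset)}"
proof (induction \<delta>)
  case empty
  have "{(\<beta>, \<gamma>). \<beta> + \<gamma> = ({#} :: 'a multiset)} = {({#}, {#})}" by auto
  then show ?case by simp
next
  case (add a \<delta>)
  let ?S = "{(\<beta>, \<gamma>). \<beta> + \<gamma> = \<delta>}"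
  have "{(\<beta>, \<gamma>). \<beta> + \<gamma> = add_mset a \<delta>}
      \<subseteq> (\<lambda>(\<beta>, \<gamma>). (add_mset a \<beta>, \<gamma>)) ` ?S \<union> (\<lambda>(\<beta>, \<gamma>). (\<beta>, add_mset a \<gamma>)) ` ?S"
  proof clarify
    fix \<beta> \<gamma>
    assume eq: "\<beta> + \<gamma> = add_mset a \<delta>"
      and not: "(\<beta>, \<gamma>) \<notin> (\<lambda>(\<beta>, \<gamma>). (\<beta>, add_mset a \<gamma>)) ` ?S"
    have "a \<in># \<beta> + \<gamma>" by (simp add: eq)
    then consider \<epsilon> where "\<beta> = add_mset a \<epsilon>" | \<epsilon> where "\<gamma> = add_mset a \<epsilon>"
      by (metis multi_member_split union_iff)
    then show "(\<beta>, \<gamma>) \<in> (\<lambda>(\<beta>, \<gamma>). (add_mset a \<beta>, \<gamma>)) ` ?S"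
    proof cases
      case 1
      with eq show ?thesis by (intro image_eqI[of _ _ "(\<epsilon>, \<gamma>)"]) simp_all
    next
      case 2
      with eq not show ?thesis by (auto simp: image_iff)
    qed
  qed
  then show ?case
    using finite_subset[OF _ finite_UnI[OF finite_imageI[OF add] finite_imageI[OF add]]] by blast
qed

text \<open>
  The assumption \<open>weights\<close> says that the product of two torus characters depends only on the sum of the
  degrees, as it does for highest weight modules.
\<close>

locale tensor_operators =
  V: graded_contravariant P qp kappa XV BV GV wtV + Z: graded_contravariant P qp kappa XZ BZ GZ wtZ
  + quantum_operators P qp kappa XT
  for P :: "'r set" and qp kappa
    and XV :: "'r generator \<Rightarrow> 'v::complex_vector \<Rightarrow> 'v" and BV GV wtV
    and XZ :: "'r generator \<Rightarrow> 'z::complex_vector \<Rightarrow> 'z" and BZ GZ wtZ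
    and XT :: "'r generator \<Rightarrow> ('v, 'z) tensor \<Rightarrow> ('v, 'z) tensor" +
  fixes wtT :: "'r \<Rightarrow> 'r multiset \<Rightarrow> complex"
  assumes E_tensor: "\<alpha> \<in> P \<Longrightarrow> XT (E \<alpha>) (v \<otimes>\<^sub>t z) = XV (E \<alpha>) v \<otimes>\<^sub>t XZ (K \<alpha>) z + v \<otimes>\<^sub>t XZ (E \<alpha>) z"
    and F_tensor: "\<alpha> \<in> P \<Longrightarrow> XT (F \<alpha>) (v \<otimes>\<^sub>t z) = XV (F \<alpha>) v \<otimes>\<^sub>t z + XV (Kinv \<alpha>) v \<otimes>\<^sub>t XZ (F \<alpha>) z"
    and K_tensor: "\<alpha> \<in> P \<Longrightarrow> XT (K \<alpha>) (v \<otimes>\<^sub>t z) = XV (K \<alpha>) v \<otimes>\<^sub>t XZ (K \<alpha>) z"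
    and weights: "\<alpha> \<in> P \<Longrightarrow> wtV \<alpha> \<beta> * wtZ \<alpha> \<gamma> = wtT \<alpha> (\<beta> + \<gamma>)"
begin

abbreviation BT where "BT \<equiv> tensor_form BV BZ"

lemmas BT_tensor = tensor_form_tensor(1)[OF V.bilinear Z.bilinear]
lemmas BT_bilinear = tensor_form_tensor(2)[OF V.bilinear Z.bilinear]
lemmas BT_simps = bilinear_simps[OF BT_bilinear]

definition pure :: "'r multiset \<Rightarrow> ('v, 'z) tensor set"
  where "pure \<beta> = {v \<otimes>\<^sub>t z | v z \<beta>1 \<beta>2. v \<in> GV \<beta>1 \<and> z \<in> GZ \<beta>2 \<and> \<beta>1 + \<beta>2 = \<beta>}"

definition GT :: "'r multiset \<Rightarrow> ('v, 'z) tensor set"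
  where "GT \<beta> = cvec.span (pure \<beta>)"

lemma pure_GT: "v \<in> GV \<beta>1 \<Longrightarrow> z \<in> GZ \<beta>2 \<Longrightarrow> \<beta>1 + \<beta>2 = \<beta> \<Longrightarrow> v \<otimes>\<^sub>t z \<in> GT \<beta>"
  unfolding GT_def pure_def by (intro cvec.span_base) blast

text \<open>
  On pure tensors the two sides agree because \<open>f\<^sub>\<alpha> q\<^sup>h\<close> has coproduct \<open>f\<^sub>\<alpha> q\<^sup>h \<otimes> q\<^sup>h + 1 \<otimes> f\<^sub>\<alpha> q\<^sup>h\<close>, the same
  shape as that of \<open>e\<^sub>\<alpha>\<close>.
\<close>

lemma BT_contravariant_E:
  assumes "\<alpha> \<in> P" shows "BT (XT (E \<alpha>) s) t = - BT s (XT (F \<alpha>) (XT (K \<alpha>) t))"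
proof -
  have pure: "BT (XT (E \<alpha>) (v \<otimes>\<^sub>t z)) t = - BT (v \<otimes>\<^sub>t z) (XT (F \<alpha>) (XT (K \<alpha>) t))" for v z t
  proof (induction t rule: tensor_induct)
    case (pure v' z')
    then show ?case
      using assms by (simp add: E_tensor F_tensor K_tensor BT_tensor BT_simps V.contravariant_E
          Z.contravariant_E Z.contravariant_K V.Kinv_K)
  qed (use assms in \<open>simp_all add: X_simps BT_simps\<close>)
  show ?thesis
    by (induction s rule: tensor_induct) (use assms in \<open>simp_all add: pure X_simps BT_simps\<close>)
qed

lemma BT_contravariant_K:
  assumes "\<alpha> \<in> P" shows "BT (XT (K \<alpha>) s) t = BT s (XT (K \<alpha>) t)"
proof -
  have pure: "BT (XT (K \<alpha>) (v \<otimes>\<^sub>t z)) t = BT (v \<otimes>\<^sub>t z) (XT (K \<alpha>) t)" for v z t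
    by (induction t rule: tensor_induct)
      (use assms in \<open>simp_all add: K_tensor BT_tensor V.contravariant_K Z.contravariant_K X_simps BT_simps\<close>)
  show ?thesis
    by (induction s rule: tensor_induct) (use assms in \<open>simp_all add: pure X_simps BT_simps\<close>)
qed

lemma GT_finite_dim: "\<exists>S. finite S \<and> GT \<beta> = cvec.span S"
proof -
  have "\<forall>\<gamma>. \<exists>S. finite S \<and> GV \<gamma> = cvec.span S"
    by (intro allI V.G_finite_dim)
  from choice[OF this] obtain SV where SV: "\<forall>\<gamma>. finite (SV \<gamma>) \<and> GV \<gamma> = cvec.span (SV \<gamma>)"
    by (elim exE)
  have "\<forall>\<gamma>. \<exists>S. finite S \<and> GZ \<gamma> = cvec.span S"
    by (intro allI Z.G_finite_dim)
  from choice[OF this] obtain SZ where SZ: "\<forall>\<gamma>. finite (SZ \<gamma>) \<and> GZ \<gamma> = cvec.span (SZ \<gamma>)"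
    by (elim exE)
  let ?D = "{(\<gamma>, \<delta>). \<gamma> + \<delta> = \<beta>}"
  let ?S = "\<Union>(\<gamma>, \<delta>)\<in>?D. {s \<otimes>\<^sub>t s' | s s'. s \<in> SV \<gamma> \<and> s' \<in> SZ \<delta>}"
  have "finite {s \<otimes>\<^sub>t s' | s s'. s \<in> SV \<gamma> \<and> s' \<in> SZ \<delta>}" for \<gamma> \<delta>
    using finite_image_set2[of "\<lambda>s. s \<in> SV \<gamma>" "\<lambda>s. s \<in> SZ \<delta>"] SV SZ by simp
  then have "finite ?S"
    by (intro finite_UN_I[OF finite_add_decompositions]) (simp add: case_prod_unfold)
  moreover have "GT \<beta> = cvec.span ?S"
  proof (rule antisym)
    have "v \<otimes>\<^sub>t z \<in> cvec.span ?S" if "v \<in> GV \<gamma>" "z \<in> GZ \<delta>" "\<gamma> + \<delta> = \<beta>" for v z \<gamma> \<delta>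
    proof -
      have "v \<otimes>\<^sub>t z \<in> cvec.span {s \<otimes>\<^sub>t s' | s s'. s \<in> SV \<gamma> \<and> s' \<in> SZ \<delta>}"
        using that SV SZ by (intro tensor_in_span) simp_all
      also have "\<dots> \<subseteq> cvec.span ?S"
        using that(3) by (intro cvec.span_mono) blast
      finally show ?thesis .
    qed
    then show "GT \<beta> \<subseteq> cvec.span ?S"
      unfolding GT_def by (intro cvec.span_minimal) (auto simp: pure_def)
    have "?S \<subseteq> pure \<beta>"
    proof
      fix x assume "x \<in> ?S"
      then obtain \<gamma> \<delta> s s' where x: "\<gamma> + \<delta> = \<beta>" "x = s \<otimes>\<^sub>t s'" "s \<in> SV \<gamma>" "s' \<in> SZ \<delta>" by blast
      then have "s \<in> GV \<gamma>" "s' \<in> GZ \<delta>"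
        using SV SZ by (simp_all add: cvec.span_base)
      with x show "x \<in> pure \<beta>"
        unfolding pure_def by blast
    qed
    then show "cvec.span ?S \<subseteq> GT \<beta>"
      unfolding GT_def by (rule cvec.span_mono)
  qed
  ultimately show ?thesis by blast
qed

lemma GT_total: "cvec.span (\<Union>\<beta>. GT \<beta>) = UNIV"
proof -
  let ?G = "\<Union>\<beta>. GT \<beta>"
  have "v \<otimes>\<^sub>t z \<in> cvec.span ?G" for v z
  proof -
    have "v \<otimes>\<^sub>t z \<in> cvec.span {s \<otimes>\<^sub>t s' | s s'. s \<in> (\<Union>\<beta>. GV \<beta>) \<and> s' \<in> (\<Union>\<beta>. GZ \<beta>)}"
      by (rule tensor_in_span) (simp_all add: V.G_total Z.G_total)
    also have "\<dots> \<subseteq> cvec.span ?G"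
      by (rule cvec.span_mono) (auto intro: pure_GT)
    finally show ?thesis .
  qed
  then have "t \<in> cvec.span ?G" for t
    by (induction t rule: tensor_induct) (simp_all add: cvec.span_add cvec.span_scale)
  then show ?thesis by blast
qed

lemma E_pure:
  assumes \<alpha>: "\<alpha> \<in> P" and v: "v \<in> GV \<beta>1" and z: "z \<in> GZ \<beta>2"
  shows "XT (E \<alpha>) (v \<otimes>\<^sub>t z) \<in> (if \<alpha> \<in># \<beta>1 + \<beta>2 then GT (\<beta>1 + \<beta>2 - {#\<alpha>#}) else {0})"
proof -
  let ?G = "GT (\<beta>1 + \<beta>2 - {#\<alpha>#})"
  have Kz: "XZ (K \<alpha>) z \<in> GZ \<beta>2"
    using Z.K_G[OF \<alpha> z] z by (simp add: cvec.subspace_scale[OF Z.G_subspace])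
  have 0: "0 \<in> ?G"
    by (simp add: GT_def cvec.span_zero)
  have 1: "XV (E \<alpha>) v \<otimes>\<^sub>t XZ (K \<alpha>) z \<in> ?G"
  proof (cases "\<alpha> \<in># \<beta>1")
    case True
    then obtain \<gamma> where \<gamma>: "\<beta>1 = add_mset \<alpha> \<gamma>" by (metis multi_member_split)
    then show ?thesis
      using V.E_G[OF \<alpha>, of v \<gamma>] v Kz by (intro pure_GT[of _ \<gamma> _ \<beta>2]) simp_all
  qed (use V.E_G_zero[OF \<alpha> v] 0 in simp)
  have 2: "v \<otimes>\<^sub>t XZ (E \<alpha>) z \<in> ?G"
  proof (cases "\<alpha> \<in># \<beta>2")
    case True
    then obtain \<gamma> where \<gamma>: "\<beta>2 = add_mset \<alpha> \<gamma>" by (metis multi_member_split)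
    then show ?thesis
      using Z.E_G[OF \<alpha>, of z \<gamma>] v z by (intro pure_GT[of _ \<beta>1 _ \<gamma>]) simp_all
  qed (use Z.E_G_zero[OF \<alpha> z] 0 in simp)
  show ?thesis
    using 1 2 V.E_G_zero[OF \<alpha> v] Z.E_G_zero[OF \<alpha> z] \<alpha>
    by (auto simp: E_tensor GT_def cvec.span_add)
qed

lemma E_GT:
  assumes \<alpha>: "\<alpha> \<in> P" and x: "x \<in> GT (add_mset \<alpha> \<beta>)" shows "XT (E \<alpha>) x \<in> GT \<beta>"
  unfolding GT_def
proof (rule span_image_subset[OF _ _ x[unfolded GT_def]])
  fix x assume "x \<in> pure (add_mset \<alpha> \<beta>)"
  then obtain v z \<beta>1 \<beta>2 where "x = v \<otimes>\<^sub>t z" "v \<in> GV \<beta>1" "z \<in> GZ \<beta>2" "\<beta>1 + \<beta>2 = add_mset \<alpha> \<beta>"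
    unfolding pure_def by blast
  then show "XT (E \<alpha>) x \<in> cvec.span (pure \<beta>)"
    using E_pure[OF \<alpha>, of v \<beta>1 z \<beta>2] by (simp add: GT_def)
qed (use \<alpha> in simp)

lemma E_GT_zero:
  assumes \<alpha>: "\<alpha> \<in> P" and x: "x \<in> GT \<beta>" and "\<alpha> \<notin># \<beta>" shows "XT (E \<alpha>) x = 0"
proof -
  have "XT (E \<alpha>) x \<in> cvec.span {}"
  proof (rule span_image_subset[OF _ _ x[unfolded GT_def]])
    fix x assume "x \<in> pure \<beta>"
    then obtain v z \<beta>1 \<beta>2 where "x = v \<otimes>\<^sub>t z" "v \<in> GV \<beta>1" "z \<in> GZ \<beta>2" "\<beta>1 + \<beta>2 = \<beta>"
      unfolding pure_def by blast
    then show "XT (E \<alpha>) x \<in> cvec.span {}"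
      using E_pure[OF \<alpha>, of v \<beta>1 z \<beta>2] assms(3) by (auto simp: cvec.span_empty)
  qed (use \<alpha> in simp)
  then show ?thesis by (simp add: cvec.span_empty)
qed

lemma F_GT:
  assumes \<alpha>: "\<alpha> \<in> P" and x: "x \<in> GT \<beta>" shows "XT (F \<alpha>) x \<in> GT (add_mset \<alpha> \<beta>)"
  unfolding GT_def
proof (rule span_image_subset[OF _ _ x[unfolded GT_def]])
  fix x assume "x \<in> pure \<beta>"
  then obtain v z \<beta>1 \<beta>2 where x: "x = v \<otimes>\<^sub>t z" and v: "v \<in> GV \<beta>1" and z: "z \<in> GZ \<beta>2" and \<beta>: "\<beta>1 + \<beta>2 = \<beta>"
    unfolding pure_def by blast
  have "XV (Kinv \<alpha>) v \<in> GV \<beta>1"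
    using V.Kinv_G[OF \<alpha> v] v by (simp add: cvec.subspace_scale[OF V.G_subspace])
  then have "XV (F \<alpha>) v \<otimes>\<^sub>t z \<in> GT (add_mset \<alpha> \<beta>)" "XV (Kinv \<alpha>) v \<otimes>\<^sub>t XZ (F \<alpha>) z \<in> GT (add_mset \<alpha> \<beta>)"
    using pure_GT[OF V.F_G[OF \<alpha> v] z] pure_GT[OF _ Z.F_G[OF \<alpha> z]] \<beta> by auto
  then show "XT (F \<alpha>) x \<in> cvec.span (pure (add_mset \<alpha> \<beta>))"
    using \<alpha> by (simp add: x F_tensor GT_def cvec.span_add)
qed (use \<alpha> in simp)

lemma K_GT:
  assumes \<alpha>: "\<alpha> \<in> P" and x: "x \<in> GT \<beta>" shows "XT (K \<alpha>) x = wtT \<alpha> \<beta> *\<^sub>C x"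
  using x unfolding GT_def
proof (induction rule: cvec.span_induct_alt)
  case (step c x y)
  then obtain v z \<beta>1 \<beta>2 where x: "x = v \<otimes>\<^sub>t z" and v: "v \<in> GV \<beta>1" and z: "z \<in> GZ \<beta>2" and \<beta>: "\<beta>1 + \<beta>2 = \<beta>"
    unfolding pure_def by blast
  have "XT (K \<alpha>) x = wtT \<alpha> \<beta> *\<^sub>C x"
    using \<alpha> weights[OF \<alpha>, of \<beta>1 \<beta>2] \<beta>
    by (simp add: x K_tensor V.K_G[OF \<alpha> v] Z.K_G[OF \<alpha> z] tensor_scale_left tensor_scale_right scaleC_scaleC mult.commute)
  with step \<alpha> show ?case
    by (simp add: X_simps scaleC_add_right scaleC_scaleC mult.commute)
qed (use \<alpha> in \<open>simp add: X_simps\<close>)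

lemma GT_orthogonal:
  assumes "x \<in> GT \<beta>" "y \<in> GT \<gamma>" "\<beta> \<noteq> \<gamma>" shows "BT x y = 0"
proof -
  have pure: "BT p r = 0" if p: "p \<in> pure \<beta>" and r: "r \<in> pure \<gamma>" for p r
  proof -
    from p obtain v z \<beta>1 \<beta>2 where p: "p = v \<otimes>\<^sub>t z" "v \<in> GV \<beta>1" "z \<in> GZ \<beta>2" "\<beta>1 + \<beta>2 = \<beta>"
      unfolding pure_def by blast
    from r obtain v' z' \<gamma>1 \<gamma>2 where r: "r = v' \<otimes>\<^sub>t z'" "v' \<in> GV \<gamma>1" "z' \<in> GZ \<gamma>2" "\<gamma>1 + \<gamma>2 = \<gamma>"
      unfolding pure_def by blast
    have "\<beta>1 \<noteq> \<gamma>1 \<or> \<beta>2 \<noteq> \<gamma>2" using p r assms(3) by blast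
    then show ?thesis
      using V.orthogonal[OF p(2) r(2)] Z.orthogonal[OF p(3) r(3)] by (auto simp: p(1) r(1) BT_tensor)
  qed
  have sym: "BT s t = BT t s" for s t
    by (rule tensor_form_symmetric[OF V.bilinear V.symmetric Z.bilinear Z.symmetric])
  have "BT y p = 0" if "p \<in> pure \<beta>" for p
    using bilinear_zero_on_span[OF BT_bilinear, of "pure \<gamma>" p y] pure[OF that] assms(2) sym[of y p]
    by (simp add: GT_def)
  then show ?thesis
    using bilinear_zero_on_span[OF BT_bilinear, of "pure \<beta>" y x] assms(1) sym[of x y]
    by (simp add: GT_def)
qed

sublocale graded_contravariant P qp kappa XT BT GT wtT
proof unfold_locales
  show "BT s t = BT t s" for s t
    by (rule tensor_form_symmetric[OF V.bilinear V.symmetric Z.bilinear Z.symmetric])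
  show "t = 0" if "\<And>s. BT t s = 0" for t
    by (rule tensor_form_nondegenerate[OF V.bilinear V.nondegenerate Z.bilinear Z.nondegenerate that])
qed (rule BT_bilinear BT_contravariant_E BT_contravariant_K GT_finite_dim GT_total E_GT E_GT_zero
    F_GT K_GT GT_orthogonal; assumption)+

end

section \<open>Modules over the quantum group\<close>

context quantum_group
begin

lemma cl_hom: "cl \<in> ring_hom R (Uq P ip lq)"
  using ideal.rcos_ring_hom[OF ideal_I] by (simp add: Uq_def cls_def[abs_def])

lemma cl_add: "p \<in> carrier R \<Longrightarrow> r \<in> carrier R \<Longrightarrow> cl (p + r) = cl p \<oplus>\<^bsub>Uq P ip lq\<^esub> cl r"
  using ring_hom_add[OF cl_hom, of p r] by simp

lemma cl_mult: "p \<in> carrier R \<Longrightarrow> r \<in> carrier R \<Longrightarrow> cl (p * r) = cl p \<otimes>\<^bsub>Uq P ip lq\<^esub> cl r"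
  using ring_hom_mult[OF cl_hom, of p r] by simp

context
  fixes \<rho> :: "'r free_algebra set \<Rightarrow> 'm::complex_vector \<Rightarrow> 'm"
  assumes module: "uq_module P ip lq \<rho>"
begin

lemma action_linear: "p \<in> carrier R \<Longrightarrow> clinear (\<rho> (cl p))"
  using module cl_in_carrier by (simp add: uq_module_def)

lemma action_add: "p \<in> carrier R \<Longrightarrow> r \<in> carrier R \<Longrightarrow> \<rho> (cl (p + r)) v = \<rho> (cl p) v + \<rho> (cl r) v"
  using module by (simp add: uq_module_def cl_add cl_in_carrier)

lemma action_mult: "p \<in> carrier R \<Longrightarrow> r \<in> carrier R \<Longrightarrow> \<rho> (cl (p * r)) v = \<rho> (cl p) (\<rho> (cl r) v)"
  using module by (simp add: uq_module_def cl_mult cl_in_carrier)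

lemma action_scal: "\<rho> (cl (scal c)) v = c *\<^sub>C v"
  using module by (simp add: uq_module_def)

lemma action_one: "\<rho> (cl 1) v = v"
  using action_scal[of 1] by (simp add: scal_one scaleC_one)

lemma action_scaleC: "p \<in> carrier R \<Longrightarrow> \<rho> (cl (c *\<^sub>C p)) v = c *\<^sub>C \<rho> (cl p) v"
  by (simp add: scaleC_eq_scal action_mult action_scal free_ring_scal)

lemma action_uminus: "p \<in> carrier R \<Longrightarrow> \<rho> (cl (- p)) v = - \<rho> (cl p) v"
  using action_scaleC[of p "- 1"] by (simp add: scaleC_one)

lemma action_diff: "p \<in> carrier R \<Longrightarrow> r \<in> carrier R \<Longrightarrow> \<rho> (cl (p - r)) v = \<rho> (cl p) v - \<rho> (cl r) v"
  using action_add[of p "- r"] by (simp add: action_uminus free_ring_closed)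

lemma action_cong: "p \<approx> r \<Longrightarrow> \<rho> (cl p) v = \<rho> (cl r) v"
  using cls_eq_iff cong_carrier by metis

lemma module_operators: "quantum_operators P qp kappa (\<lambda>g. \<rho> (cl (gen g)))"
proof (rule quantum_operators.intro)
  note simps = action_mult action_scaleC carrier_gen free_ring_mult
  show "clinear (\<rho> (cl (gen g)))" if "g \<in> generators P" for g
    using that by (intro action_linear carrier_gen)
  show "qp \<alpha> \<beta> \<noteq> 0" for \<alpha> \<beta>
    by simp
  fix \<alpha> x assume \<alpha>: "\<alpha> \<in> P"
  show "\<rho> (cl (gen (K \<alpha>))) (\<rho> (cl (gen (Kinv \<alpha>))) x) = x"
    using action_cong[OF K_Kinv[OF \<alpha>], of x] \<alpha> by (simp add: simps action_one)
  show "\<rho> (cl (gen (Kinv \<alpha>))) (\<rho> (cl (gen (K \<alpha>))) x) = x"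
    using action_cong[OF Kinv_K[OF \<alpha>], of x] \<alpha> by (simp add: simps action_one)
  fix \<beta> assume \<beta>: "\<beta> \<in> P"
  show "\<rho> (cl (gen (K \<alpha>))) (\<rho> (cl (gen (E \<beta>))) x) = qp \<alpha> \<beta> *\<^sub>C \<rho> (cl (gen (E \<beta>))) (\<rho> (cl (gen (K \<alpha>))) x)"
    using action_cong[OF KE[OF \<alpha> \<beta>], of x] \<alpha> \<beta> by (simp add: simps)
  show "\<rho> (cl (gen (K \<alpha>))) (\<rho> (cl (gen (F \<beta>))) x)
      = inverse (qp \<alpha> \<beta>) *\<^sub>C \<rho> (cl (gen (F \<beta>))) (\<rho> (cl (gen (K \<alpha>))) x)"
    using action_cong[OF KF[OF \<alpha> \<beta>], of x] \<alpha> \<beta> by (simp add: simps)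
  have zero: "\<rho> (cl 0) x = 0"
    using action_scal[of 0 x] by simp
  have "\<rho> (cl (gen (E \<alpha>))) (\<rho> (cl (gen (F \<beta>))) x) - \<rho> (cl (gen (F \<beta>))) (\<rho> (cl (gen (E \<alpha>))) x)
    = \<rho> (cl (if \<alpha> = \<beta> then kappa *\<^sub>C (gen (K \<alpha>) - gen (Kinv \<alpha>)) else 0)) x"
    using action_cong[OF EF_cong[OF \<alpha> \<beta>], of x] \<alpha> \<beta>
    by (simp only: simps action_diff in_generators)
  also have "\<dots> = (if \<alpha> = \<beta> then kappa *\<^sub>C (\<rho> (cl (gen (K \<alpha>))) x - \<rho> (cl (gen (Kinv \<alpha>))) x) else 0)"
    using \<alpha> \<beta> by (simp add: action_scaleC action_diff zero carrier_gen free_ring_diff)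
  finally show "\<rho> (cl (gen (E \<alpha>))) (\<rho> (cl (gen (F \<beta>))) x) = \<rho> (cl (gen (F \<beta>))) (\<rho> (cl (gen (E \<alpha>))) x)
      + (if \<alpha> = \<beta> then kappa *\<^sub>C (\<rho> (cl (gen (K \<alpha>))) x - \<rho> (cl (gen (Kinv \<alpha>))) x) else 0)"
    by (simp only: diff_eq_eq add.commute)
qed

interpretation M: quantum_operators P qp kappa "\<lambda>g. \<rho> (cl (gen g))"
  by (rule module_operators)

text \<open>
  The algebra is generated by the letters and acts through products and sums, hence stability under
  the generators is enough.
\<close>

lemma submodule_eq_invariant: "submodule P ip lq \<rho> = M.invariant"
proof (rule ext, rule iffI)
  fix N assume "submodule P ip lq \<rho> N"
  then show "M.invariant N"
    by (simp add: submodule_def M.invariant_def cl_in_carrier carrier_gen)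
next
  fix N assume N: "M.invariant N"
  note sub = M.invariant_subspace[OF N]
  have "\<forall>v\<in>N. \<rho> (cl p) v \<in> N" if "p \<in> carrier R" for p
    using that
  proof (induction rule: free_ring_induct)
    case (scal c)
    then show ?case by (simp add: action_scal cvec.subspace_scale[OF sub])
  next
    case (gen g)
    then show ?case using M.invariant_X[OF N] by simp
  next
    case (add p r)
    then show ?case by (simp add: action_add cvec.subspace_add[OF sub])
  next
    case (mult p r)
    then show ?case by (simp add: action_mult)
  qed
  then show "submodule P ip lq \<rho> N"
    using sub by (auto simp: submodule_def carrier_Uq)
qed

lemma irreducible_eq_simple: "irreducible_submodule P ip lq \<rho> = M.simple"
  by (simp add: fun_eq_iff irreducible_submodule_def M.simple_def submodule_eq_invariant)

lemma completely_reducible_iff_semisimple: "completely_reducible P ip lq \<rho> \<longleftrightarrow> M.semisimple"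
  by (simp add: completely_reducible_def M.semisimple_def irreducible_eq_simple)

lemma module_contravariant_operators:
  assumes "contravariant P ip lq \<rho> B"
  shows "contravariant_operators P qp kappa (\<lambda>g. \<rho> (cl (gen g))) B"
proof (intro contravariant_operators.intro contravariant_operators_axioms.intro module_operators)
  show B: "bilinear_form B" and "B x y = B y x" for x y
    using assms by (auto simp: contravariant_def symmetric_form_def)
  have contr: "B (\<rho> (cl p) x) y = B x (\<rho> (omega P ip lq (cl p)) y)" if "p \<in> carrier R" for p x y
    using assms that cl_in_carrier by (simp add: contravariant_def)
  fix \<alpha> x y assume \<alpha>: "\<alpha> \<in> P"
  show "B (\<rho> (cl (gen (E \<alpha>))) x) y = - B x (\<rho> (cl (gen (F \<alpha>))) (\<rho> (cl (gen (K \<alpha>))) y))"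
    using \<alpha> by (simp add: contr omega_gen action_uminus action_mult carrier_gen free_ring_mult bilinear_simps[OF B])
  show "B (\<rho> (cl (gen (K \<alpha>))) x) y = B x (\<rho> (cl (gen (K \<alpha>))) y)"
    using \<alpha> by (simp add: contr omega_gen carrier_gen)
qed

end

end

section \<open>Complete reducibility\<close>

lemma dual_space_add: "\<mu> \<in> dual_space H \<Longrightarrow> \<nu> \<in> dual_space H \<Longrightarrow> (\<lambda>h. \<mu> h + \<nu> h) \<in> dual_space H"
  by (auto simp: dual_space_def algebra_simps)

lemma dual_space_scale: "\<mu> \<in> dual_space H \<Longrightarrow> (\<lambda>h. c * \<mu> h) \<in> dual_space H"
  by (auto simp: dual_space_def algebra_simps)

lemma killing_inner_product_commute:
  "killing_inner_product br H ip \<Longrightarrow> \<mu> \<in> dual_space H \<Longrightarrow> \<nu> \<in> dual_space H \<Longrightarrow> ip \<mu> \<nu> = ip \<nu> \<mu>"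
  by (simp add: killing_inner_product_def)

lemma killing_inner_product_right:
  assumes ip: "killing_inner_product br H ip" and \<alpha>: "\<alpha> \<in> dual_space H"
    and \<mu>: "\<mu> \<in> dual_space H" and \<nu>: "\<nu> \<in> dual_space H"
  shows "ip \<alpha> (\<lambda>h. \<mu> h + \<nu> h) = ip \<alpha> \<mu> + ip \<alpha> \<nu>" and "ip \<alpha> (\<lambda>h. c * \<mu> h) = c * ip \<alpha> \<mu>"
proof -
  note sym = killing_inner_product_commute[OF ip]
  have add: "ip (\<lambda>h. \<mu> h + \<nu> h) \<alpha> = ip \<mu> \<alpha> + ip \<nu> \<alpha>" and scale: "ip (\<lambda>h. c * \<mu> h) \<alpha> = c * ip \<mu> \<alpha>"
    using ip \<alpha> \<mu> \<nu> by (simp_all add: killing_inner_product_def)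
  show "ip \<alpha> (\<lambda>h. \<mu> h + \<nu> h) = ip \<alpha> \<mu> + ip \<alpha> \<nu>"
    using sym[OF \<alpha> dual_space_add[OF \<mu> \<nu>]] sym[OF \<alpha> \<mu>] sym[OF \<alpha> \<nu>] add by simp
  show "ip \<alpha> (\<lambda>h. c * \<mu> h) = c * ip \<alpha> \<mu>"
    using sym[OF \<alpha> dual_space_scale[OF \<mu>, of c]] sym[OF \<alpha> \<mu>] scale by simp
qed

text \<open>
  The torus character in degree \<open>\<beta>\<close> comes from an element of the dual of \<open>H\<close>, namely \<open>\<mu> - \<Sum>\<beta>\<close>, as the
  definition of a weight vector demands.
\<close>

lemma weight_minus_roots:
  assumes ip: "killing_inner_product br H ip" and P: "P \<subseteq> dual_space H" and \<mu>: "\<mu> \<in> dual_space H"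
    and \<beta>: "set_mset \<beta> \<subseteq> P"
  shows "\<exists>\<nu>\<in>dual_space H. \<forall>\<alpha>\<in>P.
    q_power lq (ip \<alpha> \<mu>) * inverse (\<Prod>\<gamma>\<in>#\<beta>. q_power lq (ip \<alpha> \<gamma>)) = q_power lq (ip \<alpha> \<nu>)"
  using \<beta>
proof (induction \<beta>)
  case empty
  then show ?case using \<mu> by (intro bexI[of _ \<mu>]) simp_all
next
  case (add \<gamma> \<beta>)
  then obtain \<nu> where \<nu>: "\<nu> \<in> dual_space H" "\<forall>\<alpha>\<in>P.
    q_power lq (ip \<alpha> \<mu>) * inverse (\<Prod>\<gamma>\<in>#\<beta>. q_power lq (ip \<alpha> \<gamma>)) = q_power lq (ip \<alpha> \<nu>)"
    by auto
  have \<gamma>: "\<gamma> \<in> dual_space H"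
    using add.prems P by auto
  let ?\<nu> = "\<lambda>h. \<nu> h + (- 1) * \<gamma> h"
  have "q_power lq (ip \<alpha> \<mu>) * inverse (\<Prod>\<gamma>\<in>#add_mset \<gamma> \<beta>. q_power lq (ip \<alpha> \<gamma>)) = q_power lq (ip \<alpha> ?\<nu>)"
    if \<alpha>: "\<alpha> \<in> P" for \<alpha>
  proof -
    have \<alpha>': "\<alpha> \<in> dual_space H" using \<alpha> P by blast
    have "ip \<alpha> ?\<nu> = ip \<alpha> \<nu> + - ip \<alpha> \<gamma>"
      using killing_inner_product_right(1)[OF ip \<alpha>' \<nu>(1) dual_space_scale[OF \<gamma>, of "- 1"]]
        killing_inner_product_right(2)[OF ip \<alpha>' \<gamma> \<gamma>, of "- 1"] by simp
    then have "q_power lq (ip \<alpha> ?\<nu>) = q_power lq (ip \<alpha> \<nu>) * inverse (q_power lq (ip \<alpha> \<gamma>))"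
      by (simp only: q_power_add q_power_minus)
    also have "q_power lq (ip \<alpha> \<nu>) = q_power lq (ip \<alpha> \<mu>) * inverse (\<Prod>\<gamma>\<in>#\<beta>. q_power lq (ip \<alpha> \<gamma>))"
      using \<nu>(2) \<alpha> by simp
    finally show ?thesis by (simp add: mult.commute mult.left_commute)
  qed
  then show ?case
    using dual_space_add[OF \<nu>(1) dual_space_scale[OF \<gamma>, of "- 1"]] by (intro bexI[of _ ?\<nu>]) auto
qed

text \<open>
  Only multisets of simple roots occur as degrees, which matters because weights are available for
  those alone.
\<close>

lemma (in highest_weight_operators) component_trivial:
  "\<not> set_mset \<beta> \<subseteq> P \<Longrightarrow> component \<beta> = {0}"
proof -
  assume "\<not> set_mset \<beta> \<subseteq> P"
  then have "{F_word w | w. set w \<subseteq> P \<and> mset w = \<beta>} = {}" by auto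
  then show ?thesis by (simp only: component_def cvec.span_empty)
qed

lemma (in quantum_group) highest_weight_module_operators:
  assumes "uq_module P ip lq \<rho>" "irreducible_module P ip lq \<rho>"
    and "contravariant P ip lq \<rho> B" "B v0 v0 = 1"
    and "\<And>\<alpha>. \<alpha> \<in> P \<Longrightarrow> \<rho> (cl (gen (E \<alpha>))) v0 = 0"
    and "\<And>\<alpha>. \<alpha> \<in> P \<Longrightarrow> \<rho> (cl (gen (K \<alpha>))) v0 = lam \<alpha> *\<^sub>C v0"
  shows "highest_weight_operators P qp kappa (\<lambda>g. \<rho> (cl (gen g))) B v0 lam"
  using assms module_contravariant_operators[OF assms(1,3)] irreducible_eq_simple[OF assms(1)]
  by (intro highest_weight_operators.intro highest_weight_operators_axioms.intro) simp_all

lemma (in quantum_group) tensor_action_pure: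
  assumes "uq_module P ip lq \<rho>V" "uq_module P ip lq \<rho>Z" "tensor_action P ip lq \<rho>V \<rho>Z \<rho>T" "\<alpha> \<in> P"
  shows "\<rho>T (cl (gen (E \<alpha>))) (v \<otimes>\<^sub>t z)
      = \<rho>V (cl (gen (E \<alpha>))) v \<otimes>\<^sub>t \<rho>Z (cl (gen (K \<alpha>))) z + v \<otimes>\<^sub>t \<rho>Z (cl (gen (E \<alpha>))) z"
    and "\<rho>T (cl (gen (F \<alpha>))) (v \<otimes>\<^sub>t z)
      = \<rho>V (cl (gen (F \<alpha>))) v \<otimes>\<^sub>t z + \<rho>V (cl (gen (Kinv \<alpha>))) v \<otimes>\<^sub>t \<rho>Z (cl (gen (F \<alpha>))) z"
    and "\<rho>T (cl (gen (K \<alpha>))) (v \<otimes>\<^sub>t z) = \<rho>V (cl (gen (K \<alpha>))) v \<otimes>\<^sub>t \<rho>Z (cl (gen (K \<alpha>))) z"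
proof -
  have "\<rho>T (cl (gen g)) (v \<otimes>\<^sub>t z) = (\<Sum>(a, b)\<leftarrow>coproduct g. \<rho>V (cl a) v \<otimes>\<^sub>t \<rho>Z (cl b) z)"
    if "g \<in> generators P" for g
    using assms(3) that by (simp add: tensor_action_def)
  note coproduct = this[unfolded coproduct_def]
  note one = action_one[OF assms(1)] action_one[OF assms(2)]
  show "\<rho>T (cl (gen (E \<alpha>))) (v \<otimes>\<^sub>t z)
      = \<rho>V (cl (gen (E \<alpha>))) v \<otimes>\<^sub>t \<rho>Z (cl (gen (K \<alpha>))) z + v \<otimes>\<^sub>t \<rho>Z (cl (gen (E \<alpha>))) z"
    using coproduct[of "E \<alpha>"] assms(4) by (simp add: one)
  show "\<rho>T (cl (gen (F \<alpha>))) (v \<otimes>\<^sub>t z)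
      = \<rho>V (cl (gen (F \<alpha>))) v \<otimes>\<^sub>t z + \<rho>V (cl (gen (Kinv \<alpha>))) v \<otimes>\<^sub>t \<rho>Z (cl (gen (F \<alpha>))) z"
    using coproduct[of "F \<alpha>"] assms(4) by (simp add: one)
  show "\<rho>T (cl (gen (K \<alpha>))) (v \<otimes>\<^sub>t z) = \<rho>V (cl (gen (K \<alpha>))) v \<otimes>\<^sub>t \<rho>Z (cl (gen (K \<alpha>))) z"
    using coproduct[of "K \<alpha>"] assms(4) by simp
qed

theorem theorem6p3:
  fixes br :: "'g::complex_vector \<Rightarrow> 'g \<Rightarrow> 'g"
    and H :: "'g set"
    and P :: "('g \<Rightarrow> complex) set"
    and ip :: "('g \<Rightarrow> complex) \<Rightarrow> ('g \<Rightarrow> complex) \<Rightarrow> complex"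
    and q lq :: complex
    and \<rho>V :: "('g \<Rightarrow> complex) free_algebra set \<Rightarrow> 'v::complex_vector \<Rightarrow> 'v"
    and \<rho>Z :: "('g \<Rightarrow> complex) free_algebra set \<Rightarrow> 'z::complex_vector \<Rightarrow> 'z"
    and \<rho>T :: "('g \<Rightarrow> complex) free_algebra set \<Rightarrow> ('v, 'z) tensor \<Rightarrow> ('v, 'z) tensor"
    and v0 :: 'v and z0 :: 'z
    and BV :: "'v \<Rightarrow> 'v \<Rightarrow> complex" and BZ :: "'z \<Rightarrow> 'z \<Rightarrow> complex"
  assumes "semisimple_lie_algebra br"
    and "cartan_subalgebra br H"
    and "simple_roots br H P"
    and "killing_inner_product br H ip"
    and "q \<noteq> 0" and "\<And>n::nat. n > 0 \<Longrightarrow> q ^ n \<noteq> 1"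
    and "exp lq = q"
    and "uq_module P ip lq \<rho>V" and "irreducible_module P ip lq \<rho>V"
    and "highest_vector H P ip lq \<rho>V v0"
    and "uq_module P ip lq \<rho>Z" and "irreducible_module P ip lq \<rho>Z"
    and "highest_vector H P ip lq \<rho>Z z0"
    and "shapovalov_form P ip lq \<rho>V v0 BV"
    and "shapovalov_form P ip lq \<rho>Z z0 BZ"
    and "tensor_action P ip lq \<rho>V \<rho>Z \<rho>T"
  shows "completely_reducible P ip lq \<rho>T \<longleftrightarrow>
    nondegenerate_on (cvec.span {w. singular_vector H P ip lq \<rho>T w}) (tensor_form BV BZ)"
proof -
  note ip = assms(4) and V = assms(8) and Z = assms(11) and action = assms(16)
  have T: "uq_module P ip lq \<rho>T"
    using action by (simp add: tensor_action_def)
  have P: "P \<subseteq> dual_space H"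
    using assms(3) by (auto simp: simple_roots_def roots_def)
  interpret Q: quantum_group P ip lq
    using killing_inner_product_commute[OF ip] P by unfold_locales blast
  have weight: "\<exists>\<mu>\<in>dual_space H. \<forall>\<alpha>\<in>P. \<rho> (Q.cl (gen (K \<alpha>))) v = q_power lq (ip \<alpha> \<mu>) *\<^sub>C v"
    and E_zero: "\<alpha> \<in> P \<Longrightarrow> \<rho> (Q.cl (gen (E \<alpha>))) v = 0"
    if "highest_vector H P ip lq \<rho> v"
    for \<alpha> v and \<rho> :: "('g \<Rightarrow> complex) free_algebra set \<Rightarrow> 'b::complex_vector \<Rightarrow> 'b"
    using that by (auto simp: highest_vector_def singular_vector_def weight_vector_def)
  obtain \<mu>V where \<mu>V: "\<mu>V \<in> dual_space H"
    "\<And>\<alpha>. \<alpha> \<in> P \<Longrightarrow> \<rho>V (Q.cl (gen (K \<alpha>))) v0 = q_power lq (ip \<alpha> \<mu>V) *\<^sub>C v0"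
    using weight[OF assms(10)] by blast
  obtain \<mu>Z where \<mu>Z: "\<mu>Z \<in> dual_space H"
    "\<And>\<alpha>. \<alpha> \<in> P \<Longrightarrow> \<rho>Z (Q.cl (gen (K \<alpha>))) z0 = q_power lq (ip \<alpha> \<mu>Z) *\<^sub>C z0"
    using weight[OF assms(13)] by blast
  interpret V: highest_weight_operators P Q.qp Q.kappa "\<lambda>g. \<rho>V (Q.cl (gen g))" BV v0 "\<lambda>\<alpha>. q_power lq (ip \<alpha> \<mu>V)"
    by (rule Q.highest_weight_module_operators[OF V assms(9)])
      (use assms(14) E_zero[OF assms(10)] \<mu>V(2) in \<open>simp_all add: shapovalov_form_def\<close>)
  interpret Z: highest_weight_operators P Q.qp Q.kappa "\<lambda>g. \<rho>Z (Q.cl (gen g))" BZ z0 "\<lambda>\<alpha>. q_power lq (ip \<alpha> \<mu>Z)"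
    by (rule Q.highest_weight_module_operators[OF Z assms(12)])
      (use assms(15) E_zero[OF assms(13)] \<mu>Z(2) in \<open>simp_all add: shapovalov_form_def\<close>)
  define wtT where "wtT \<alpha> \<beta> = q_power lq (ip \<alpha> \<mu>V) * q_power lq (ip \<alpha> \<mu>Z)
    * inverse (\<Prod>\<gamma>\<in>#\<beta>. Q.qp \<alpha> \<gamma>)" for \<alpha> \<beta>
  interpret T: tensor_operators P Q.qp Q.kappa "\<lambda>g. \<rho>V (Q.cl (gen g))" BV V.component V.weight
      "\<lambda>g. \<rho>Z (Q.cl (gen g))" BZ Z.component Z.weight "\<lambda>g. \<rho>T (Q.cl (gen g))" wtT
  proof (intro tensor_operators.intro tensor_operators_axioms.intro)
    show "quantum_operators P Q.qp Q.kappa (\<lambda>g. \<rho>T (Q.cl (gen g)))"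
      by (rule Q.module_operators[OF T])
    show "V.weight \<alpha> \<beta> * Z.weight \<alpha> \<gamma> = wtT \<alpha> (\<beta> + \<gamma>)" if "\<alpha> \<in> P" for \<alpha> \<beta> \<gamma>
      by (simp add: V.weight_def Z.weight_def wtT_def mult.commute mult.left_commute)
  qed (rule V.graded_contravariant_axioms Z.graded_contravariant_axioms
      Q.tensor_action_pure[OF V Z action]; assumption)+
  have "T.extremal = cvec.span {w. singular_vector H P ip lq \<rho>T w}"
  proof (rule antisym)
    show "cvec.span {w. singular_vector H P ip lq \<rho>T w} \<subseteq> T.extremal"
      by (intro cvec.span_minimal T.extremal_subspace) (auto simp: singular_vector_def T.extremal_def)
    have "x \<in> cvec.span {w. singular_vector H P ip lq \<rho>T w}" if x: "x \<in> T.extremal" "x \<in> T.GT \<beta>" for x \<beta>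
    proof (cases "x = 0")
      case False
      have "set_mset \<beta> \<subseteq> P"
      proof (rule ccontr)
        assume "\<not> set_mset \<beta> \<subseteq> P"
        \<comment> \<open>One of the two degrees adding up to \<open>\<beta>\<close> then contains an element outside \<open>P\<close>.\<close>
        then have "T.pure \<beta> \<subseteq> {0}"
          unfolding T.pure_def using V.component_trivial Z.component_trivial by fastforce
        then have "T.GT \<beta> \<subseteq> {0}"
          unfolding T.GT_def by (intro cvec.span_minimal) (auto simp: cvec.subspace_def)
        then show False using x(2) False by blast
      qed
      from weight_minus_roots[OF ip P dual_space_add[OF \<mu>V(1) \<mu>Z(1)] this, of lq]
      obtain \<nu> where \<nu>: "\<nu> \<in> dual_space H" "\<And>\<alpha>. \<alpha> \<in> P \<Longrightarrow>
          q_power lq (ip \<alpha> (\<lambda>h. \<mu>V h + \<mu>Z h)) * inverse (\<Prod>\<gamma>\<in>#\<beta>. q_power lq (ip \<alpha> \<gamma>)) = q_power lq (ip \<alpha> \<nu>)"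
        by blast
      have "wtT \<alpha> \<beta> = q_power lq (ip \<alpha> \<nu>)" if \<alpha>: "\<alpha> \<in> P" for \<alpha>
        using \<nu>(2)[OF \<alpha>] killing_inner_product_right(1)[OF ip _ \<mu>V(1) \<mu>Z(1), of \<alpha>] \<alpha> P
        by (auto simp: wtT_def Q.qp_def q_power_add)
      then have "singular_vector H P ip lq \<rho>T x"
        using False x(1) T.K_GT[OF _ x(2)] \<nu>(1)
        by (auto simp: singular_vector_def weight_vector_def T.extremal_def)
      then show ?thesis by (simp add: cvec.span_base)
    qed (simp add: cvec.span_zero)
    then show "T.extremal \<subseteq> cvec.span {w. singular_vector H P ip lq \<rho>T w}"
      by (subst T.extremal_graded_span) (intro cvec.span_minimal, auto)
  qed
  then show ?thesis
    using Q.completely_reducible_iff_semisimple[OF T] T.semisimple_if_nondegenerate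
      T.nondegenerate_if_semisimple by auto
qed

end
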